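(* Let $n\ge1$. The map $P\mapsto\xi_P$ is a bijection from $\widetilde{\mathscr{L}}_{\mathrm{Heis}}(n,\mathbb{F}_q)$ to the set of Heisenberg characters of $\mathbf{U}_n(\mathbb{F}_q)$. Consequently the number of Heisenberg characters of $\mathbf{U}_n(\mathbb{F}_q)$ is $\widetilde{\mathcal{H}}_n(q-1)$.
   Context: Unitriangular setup: $\mathfrak{n}=\mathfrak{u}_n(\mathbb{F}_q)$ (strictly upper triangular $n\times n$ matrices), $G=\mathbf{U}_n(\mathbb{F}_q)=1+\mathfrak n$; $e^*_{ij}\in\mathfrak n^*$ is $X\mapsto X_{ij}$. A Heisenberg character is an irreducible character whose kernel contains $[G,[G,G]]$. Fix a nontrivial homomorphism $\theta:\mathbb F_q^+\to\mathbb C^\times$, and for $\lambda\in\mathfrak n^*$ let $\theta_\lambda(1+X)=\theta(\lambda(X))$. Define $\mathfrak{l}^0_\lambda=\{0\}$, $\mathfrak{s}^0_\lambda=\mathfrak{n}$, $\mathfrak{l}^{i+1}_\lambda=\{X\in\mathfrak{s}^i_\lambda:\lambda(XY)=0\ \forall Y\in\mathfrak{s}^i_\lambda\}$, $\mathfrak{s}^{i+1}_\lambda=\{X\in\mathfrak{s}^i_\lambda:\lambda(XY)=0\ \forall Y\in\mathfrak{l}^{i+1}_\lambda\}$, $\overline{\mathfrak l}_\lambda=\bigcup_i\mathfrak l^i_\lambda$, $\overline L_\lambda=1+\overline{\mathfrak l}_\lambda$, and $\xi_\lambda=\mathrm{Ind}_{\overline L_\lambda}^G(\theta_\lambda|_{\overline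 L_\lambda})$. Lattice paths: a lattice path with steps in $S\subseteq\mathbb N^2$ is a finite sequence $(s_1,\dots,s_\ell)$ of elements of $S$, starting at $(0,0)$ and ending at $s_1+\dots+s_\ell$. An $\mathbb F_q$-labeled lattice path assigns to each step $(i,j)$ a sequence of $j$ labels in $\mathbb F_q^\times$. Write $\to,\nearrow,\uparrow,\upuparrows$ for the steps $(1,0),(1,1),(0,1),(0,2)$, with labels as subscripts ($\nearrow_t,\uparrow_t,\upuparrows_{t,u}$). $\mathscr{L}_{\mathrm{Heis}}(n,\mathbb F_q)$ is the set of labeled paths with steps in $\{(1,0),(1,1),(0,1),(0,2)\}$ ending on the line $x+y=n-1$, and $\widetilde{\mathscr L}_{\mathrm{Heis}}(n,\mathbb F_q)$ the subset of those not beginning with $(0,2)$. For $P=(s_1,\dots,s_\ell)\in\widetilde{\mathscr L}_{\mathrm{Heis}}(n,\mathbb F_q)$ let $d_k(P)$ be the coordinate sum of the starting point of step $s_k$, and $i=d_k(P)+1$; set $\lambda_{P,k}=0$ if $s_k=\to$, $=te^*_{i,i+1}$ if $s_k=\uparrow_t$, $=te^*_{i,i+2}$ if $s_k=\nearrow_t$, $=te^*_{i-1,i+1}+ue^*_{i,i+2}$ if $s_k=\upuparrows_{t,u}$. Let $\lambda_P=\sum_k\lambda_{P,k}$ and $\xi_P=\xi_{\lambda_P}$. Polynomials: $D'(a,b)$ is the number of (unlabeled) lattice paths from $(0,0)$ to $(a,b)$ with steps in $\{(1,0),(1,1),(0,1),(0,2)\}$; $\mathcal H_{m+1}(x)=\sum_{k=0}^mD'(m-k,k)x^k$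 for $m\ge0$, $\mathcal H_m=0$ for $m\le0$; $\widetilde{\mathcal H}_n(x)=\mathcal H_n(x)-x^2\mathcal H_{n-2}(x)$. *)

theory Defs
  imports
    "HOL-Algebra.Generated_Groups"
    "HOL-Computational_Algebra.Polynomial"
    "Jordan_Normal_Form.VS_Connect"
begin

definition mat_trace :: "'a::comm_monoid_add mat \<Rightarrow> 'a" where
  "mat_trace A = (\<Sum>i<dim_row A. A $$ (i, i))"

definition representation ::
    "('g, 'b) monoid_scheme \<Rightarrow> nat \<Rightarrow> ('g \<Rightarrow> complex mat) \<Rightarrow> bool" where
  "representation G d \<rho> \<longleftrightarrow> \<rho> \<in> hom G (units_of (ring_mat TYPE(complex) d ()))"

definition irreducible_representation ::
    "('g, 'b) monoid_scheme \<Rightarrow> nat \<Rightarrow> ('g \<Rightarrow> complex mat) \<Rightarrow> bool" where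
  "irreducible_representation G d \<rho> \<longleftrightarrow>
     representation G d \<rho> \<and> d \<noteq> 0 \<and>
     (\<forall>W. VectorSpace.subspace class_ring W (module_vec TYPE(complex) d) \<and>
          (\<forall>g\<in>carrier G. \<forall>v\<in>W. \<rho> g *\<^sub>v v \<in> W) \<longrightarrow>
          W = {0\<^sub>v d} \<or> W = carrier_vec d)"

text \<open>Class functions on \<^term>\<open>G\<close>, in particular characters, are made extensional (they
  are \<^const>\<open>undefined\<close> off the carrier), so that equality of functions is equality on the
  group.\<close>

definition character_of ::
    "('g, 'b) monoid_scheme \<Rightarrow> ('g \<Rightarrow> complex mat) \<Rightarrow> 'g \<Rightarrow> complex" where
  "character_of G \<rho> = (\<lambda>g\<in>carrier G. mat_trace (\<rho> g))"

definition irreducible_characters :: "('g, 'b) monoid_scheme \<Rightarrow> ('g \<Rightarrow> complex) set" where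
  "irreducible_characters G =
     {character_of G \<rho> | \<rho> d. irreducible_representation G d \<rho>}"

definition character_kernel ::
    "('g, 'b) monoid_scheme \<Rightarrow> ('g \<Rightarrow> complex) \<Rightarrow> 'g set" where
  "character_kernel G \<chi> = {g \<in> carrier G. \<chi> g = \<chi> \<one>\<^bsub>G\<^esub>}"

definition induced_function ::
    "('g, 'b) monoid_scheme \<Rightarrow> 'g set \<Rightarrow> ('g \<Rightarrow> complex) \<Rightarrow> 'g \<Rightarrow> complex" where
  "induced_function G H \<phi> = (\<lambda>g\<in>carrier G.
     (\<Sum>x\<in>carrier G.
        let y = x \<otimes>\<^bsub>G\<^esub> g \<otimes>\<^bsub>G\<^esub> inv\<^bsub>G\<^esub> x in if y \<in> H then \<phi> y else 0) / of_nat (card H))"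

definition commutator_subgroup ::
    "('g, 'b) monoid_scheme \<Rightarrow> 'g set \<Rightarrow> 'g set \<Rightarrow> 'g set" where
  "commutator_subgroup G H K =
     generate G {h \<otimes>\<^bsub>G\<^esub> k \<otimes>\<^bsub>G\<^esub> inv\<^bsub>G\<^esub> h \<otimes>\<^bsub>G\<^esub> inv\<^bsub>G\<^esub> k | h k. h \<in> H \<and> k \<in> K}"

definition heisenberg_characters :: "('g, 'b) monoid_scheme \<Rightarrow> ('g \<Rightarrow> complex) set" where
  "heisenberg_characters G = {\<chi> \<in> irreducible_characters G.
     commutator_subgroup G (carrier G) (derived G (carrier G)) \<subseteq> character_kernel G \<chi>}"

definition strictly_upper :: "nat \<Rightarrow> 'a::zero mat set" where
  "strictly_upper n = {X \<in> carrier_mat n n. \<forall>i<n. \<forall>j\<le>i. X $$ (i, j) = 0}"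

definition unitriangular_group :: "nat \<Rightarrow> 'a::ring_1 mat monoid" where
  "unitriangular_group n =
     \<lparr>carrier = {1\<^sub>m n + X | X. X \<in> strictly_upper n}, mult = (*), one = 1\<^sub>m n\<rparr>"

text \<open>Functionals on the strictly upper triangular matrices are functions on matrices, named
  \<open>\<mu>\<close> because \<open>\<lambda>\<close> is reserved for abstraction. Rows and columns are numbered
  from 1 in \<open>matrix_coord\<close>, but from 0 in \<open>$$\<close>.\<close>

definition matrix_coord :: "nat \<Rightarrow> nat \<Rightarrow> 'a mat \<Rightarrow> 'a" where
  "matrix_coord i j X = X $$ (i - 1, j - 1)"

fun l_seq :: "nat \<Rightarrow> ('a::ring_1 mat \<Rightarrow> 'a) \<Rightarrow> nat \<Rightarrow> 'a mat set"
  and s_seq :: "nat \<Rightarrow> ('a::ring_1 mat \<Rightarrow> 'a) \<Rightarrow> nat \<Rightarrow> 'a mat set" where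
  "l_seq n \<mu> 0 = {0\<^sub>m n n}"
| "s_seq n \<mu> 0 = strictly_upper n"
| "l_seq n \<mu> (Suc i) = {X \<in> s_seq n \<mu> i. \<forall>Y\<in>s_seq n \<mu> i. \<mu> (X * Y) = 0}"
| "s_seq n \<mu> (Suc i) = {X \<in> s_seq n \<mu> i. \<forall>Y\<in>l_seq n \<mu> (Suc i). \<mu> (X * Y) = 0}"

definition l_bar :: "nat \<Rightarrow> ('a::ring_1 mat \<Rightarrow> 'a) \<Rightarrow> 'a mat set" where
  "l_bar n \<mu> = (\<Union>i. l_seq n \<mu> i)"

definition L_bar :: "nat \<Rightarrow> ('a::ring_1 mat \<Rightarrow> 'a) \<Rightarrow> 'a mat set" where
  "L_bar n \<mu> = {1\<^sub>m n + X | X. X \<in> l_bar n \<mu>}"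

definition nontrivial_additive_character :: "('a::ring_1 \<Rightarrow> complex) \<Rightarrow> bool" where
  "nontrivial_additive_character \<theta> \<longleftrightarrow>
     (\<forall>x. \<theta> x \<noteq> 0) \<and> (\<forall>x y. \<theta> (x + y) = \<theta> x * \<theta> y) \<and> (\<exists>x. \<theta> x \<noteq> 1)"

definition theta_fun ::
    "nat \<Rightarrow> ('a::ring_1 \<Rightarrow> complex) \<Rightarrow> ('a mat \<Rightarrow> 'a) \<Rightarrow> 'a mat \<Rightarrow> complex" where
  "theta_fun n \<theta> \<mu> g = \<theta> (\<mu> (g - 1\<^sub>m n))"

definition xi ::
    "nat \<Rightarrow> ('a::ring_1 \<Rightarrow> complex) \<Rightarrow> ('a mat \<Rightarrow> 'a) \<Rightarrow> 'a mat \<Rightarrow> complex" where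
  "xi n \<theta> \<mu> =
     induced_function (unitriangular_group n) (L_bar n \<mu>) (theta_fun n \<theta> \<mu>)"

type_synonym step = "nat \<times> nat"

definition path_end :: "step list \<Rightarrow> nat \<times> nat" where
  "path_end p = (sum_list (map fst p), sum_list (map snd p))"

text \<open>A labeled path is the list of its steps, each paired with its list of labels.\<close>

definition labeled_paths :: "step set \<Rightarrow> (step \<times> 'a::zero list) list set" where
  "labeled_paths S =
     {P. \<forall>(s, ts)\<in>set P. s \<in> S \<and> length ts = snd s \<and> 0 \<notin> set ts}"

definition heis_steps :: "step set" where
  "heis_steps = {(1, 0), (1, 1), (0, 1), (0, 2)}"

definition heis_paths :: "nat \<Rightarrow> (step \<times> 'a::zero list) list set" where
  "heis_paths n = {P \<in> labeled_paths heis_steps.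
     fst (path_end (map fst P)) + snd (path_end (map fst P)) = n - 1}"

definition heis_paths_tilde :: "nat \<Rightarrow> (step \<times> 'a::zero list) list set" where
  "heis_paths_tilde n = {P \<in> heis_paths n. P = [] \<or> fst (hd P) \<noteq> (0, 2)}"

text \<open>Steps are indexed from 0 in \<open>start_sum\<close> and \<open>path_functional\<close>.\<close>

definition start_sum :: "(step \<times> 'a list) list \<Rightarrow> nat \<Rightarrow> nat" where
  "start_sum P k =
     fst (path_end (map fst (take k P))) + snd (path_end (map fst (take k P)))"

definition step_functional ::
    "nat \<Rightarrow> step \<times> 'a list \<Rightarrow> 'a::ring_1 mat \<Rightarrow> 'a" where
  "step_functional i st X = (case st of (s, ts) \<Rightarrow>
     if s = (0, 1) then ts ! 0 * matrix_coord i (i + 1) X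
     else if s = (1, 1) then ts ! 0 * matrix_coord i (i + 2) X
     else if s = (0, 2) then
       ts ! 0 * matrix_coord (i - 1) (i + 1) X + ts ! 1 * matrix_coord i (i + 2) X
     else 0)"

definition path_functional :: "(step \<times> 'a list) list \<Rightarrow> 'a::ring_1 mat \<Rightarrow> 'a" where
  "path_functional P X = (\<Sum>k<length P. step_functional (start_sum P k + 1) (P ! k) X)"

definition xi_path ::
    "nat \<Rightarrow> ('a::ring_1 \<Rightarrow> complex) \<Rightarrow> (step \<times> 'a list) list \<Rightarrow> 'a mat \<Rightarrow> complex" where
  "xi_path n \<theta> P = xi n \<theta> (path_functional P)"

definition num_paths :: "nat \<Rightarrow> nat \<Rightarrow> nat" where
  "num_paths a b = card {p. set p \<subseteq> heis_steps \<and> path_end p = (a, b)}"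

text \<open>The index is an integer, so that \<open>m - 2\<close> below is not truncated at 0.\<close>

definition heis_poly :: "int \<Rightarrow> int poly" where
  "heis_poly m = (if m \<le> 0 then 0
     else let r = nat (m - 1) in \<Sum>k\<le>r. monom (int (num_paths (r - k) k)) k)"

definition heis_poly_tilde :: "int \<Rightarrow> int poly" where
  "heis_poly_tilde m = heis_poly m - monom 1 2 * heis_poly (m - 2)"

end

theory Submission
  imports Defs "Jordan_Normal_Form.Spectral_Radius"
begin

text \<open>Modulo \<open>[G, [G, G]]\<close> a unitriangular matrix is determined by its first two
  superdiagonals \<open>a\<close> and \<open>c\<close>, which multiply as in a Heisenberg group. A functional
  \<open>\<delta> \<cdot> a + \<gamma> \<cdot> c\<close> gives an alternating form on \<open>a\<close> that links \<open>a\<^sub>p\<close> and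
  \<open>a\<^sub>p\<^sub>+\<^sub>1\<close> whenever \<open>\<gamma>\<^sub>p \<noteq> 0\<close>. Its orthogonal summands are the blocks cut out by the
  zeros of \<open>\<gamma>\<close>; a block of odd size has a one-dimensional radical, detected by its first
  coordinate, and a block of even size has none. An irreducible character trivial on
  \<open>[G, [G, G]]\<close> is therefore determined by \<open>\<gamma>\<close> and by one value of \<open>\<delta>\<close> for each
  block of odd size: it vanishes off the preimage \<open>Z\<close> of the radical, is a multiple of a
  linear character there, and its degree \<open>d\<close> satisfies \<open>d\<^sup>2 |Z| = |G|\<close>. The subgroup
  \<open>L_bar\<close> consists of the elements with \<open>a\<^sub>p = 0\<close> whenever the run of nonzero entries of
  \<open>\<gamma>\<close> from \<open>p\<close> on has odd length, so that every character of this form is induced from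
  it. Reading a lattice path step by step encodes the blocks: an odd block is a step \<open>(1, 0)\<close>
  or \<open>(0, 1)\<close>, an even block is a step \<open>(1, 1)\<close>, followed in both cases by steps
  \<open>(0, 2)\<close>.\<close>

subsection \<open>Representations over the complex numbers\<close>

text \<open>The degree of an induced character is never computed from the index of
  \<open>L \<gamma>\<close>. The character \<open>heis_char \<delta> \<gamma>\<close> is only shown
  to be irreducible and evaluated on \<open>Z \<gamma>\<close>; the classification
  \<open>irrep_classified\<close> is then applied to this very character, and since the data are
  determined by the values on \<open>Z\<close>, it must return the data one started from. Vanishing
  off \<open>Z\<close> and the degree follow from that. Completeness is direct as well: every
  irreducible character trivial on \<open>U3\<close> is analysed by Schur's lemma, so no sum of
  squared degrees has to be matched against the group order. Values at inverses replace complex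
  conjugates, so unitarity is never invoked. The character theory is done for an abstract group with
  coordinate functions \<open>a\<close> and \<open>c\<close>; matrices enter to provide these, to
  identify \<open>U3\<close> with \<open>[G, [G, G]]\<close>, and to run the recursion behind
  \<open>l_bar\<close>. That recursion strips every run of nonzero entries of
  \<open>\<gamma>\<close> from its right end, two positions per round, which is where the parity of
  run lengths comes from.\<close>

lemma sum_twisted_eq_0:
  fixes f :: "'b \<Rightarrow> complex"
  assumes "bij_betw T A A" and "\<And>x. x \<in> A \<Longrightarrow> f (T x) = k * f x" and "k \<noteq> 1"
  shows "sum f A = 0"
proof -
  have "sum f A = (\<Sum>x\<in>A. f (T x))"
    using sum.reindex_bij_betw[OF assms(1), of f] by simp
  also have "\<dots> = k * sum f A"
    using assms(2) by (simp add: sum_distrib_left)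
  finally show ?thesis using assms(3) by simp
qed

lemma subspace_vec_iff:
  "VectorSpace.subspace class_ring W (module_vec TYPE('a::field) d) \<longleftrightarrow>
     W \<subseteq> carrier_vec d \<and> 0\<^sub>v d \<in> W \<and> (\<forall>v\<in>W. \<forall>w\<in>W. v + w \<in> W) \<and>
     (\<forall>k. \<forall>v\<in>W. k \<cdot>\<^sub>v v \<in> W)"
  using vec_vs[where 'a = 'a and n = d] vec_module[where 'a = 'a and n = d]
  unfolding VectorSpace.subspace_def submodule_def
  by (auto simp: module_vec_simps class_ring_simps)

subsection \<open>Entrywise sums of matrices\<close>

text \<open>Matrices of all sizes share one type and have no common zero, so sums are formed
  entrywise at a fixed dimension \<open>d\<close>.\<close>

definition mat_sum :: "nat \<Rightarrow> 'i set \<Rightarrow> ('i \<Rightarrow> complex mat) \<Rightarrow> complex mat" where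
  "mat_sum d S F = mat d d (\<lambda>(i, j). \<Sum>s\<in>S. F s $$ (i, j))"

lemma mat_sum_carrier [simp]: "mat_sum d S F \<in> carrier_mat d d"
  and mat_sum_dim [simp]: "dim_row (mat_sum d S F) = d" "dim_col (mat_sum d S F) = d"
  and mat_sum_index [simp]:
    "i < d \<Longrightarrow> j < d \<Longrightarrow> mat_sum d S F $$ (i, j) = (\<Sum>s\<in>S. F s $$ (i, j))"
  by (auto simp: mat_sum_def)

lemma mult_mat_index:
  assumes "A \<in> carrier_mat m k" "B \<in> carrier_mat k n" "i < m" "j < n"
  shows "(A * B) $$ (i, j) = (\<Sum>l<k. A $$ (i, l) * B $$ (l, j))"
  using assms by (auto simp: scalar_prod_def atLeast0LessThan intro!: sum.cong)

lemma smult_one_mult_vec: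
  "v \<in> carrier_vec d \<Longrightarrow> (k \<cdot>\<^sub>m 1\<^sub>m d) *\<^sub>v v = k \<cdot>\<^sub>v (v :: 'a::comm_semiring_1 vec)"
  by (intro eq_vecI) (auto simp: scalar_prod_def if_distrib[of "\<lambda>x. x * _"]
      if_distrib[of "\<lambda>x. _ * x"] cong: if_cong)

lemma mult_mat_zero_vec:
  "A \<in> carrier_mat m n \<Longrightarrow> A *\<^sub>v 0\<^sub>v n = 0\<^sub>v m" for A :: "'a::semiring_0 mat"
  by (intro eq_vecI) (auto simp: scalar_prod_def)

lemma mult_mat_sum:
  assumes "X \<in> carrier_mat d d" "\<And>s. s \<in> S \<Longrightarrow> F s \<in> carrier_mat d d"
  shows "X * mat_sum d S F = mat_sum d S (\<lambda>s. X * F s)"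
proof (rule eq_matI)
  fix i j assume "i < dim_row (mat_sum d S (\<lambda>s. X * F s))"
    "j < dim_col (mat_sum d S (\<lambda>s. X * F s))"
  then have ij: "i < d" "j < d" by auto
  have "(X * mat_sum d S F) $$ (i, j) = (\<Sum>l<d. \<Sum>s\<in>S. X $$ (i, l) * F s $$ (l, j))"
    using ij assms(1) by (subst mult_mat_index) (auto simp: sum_distrib_left)
  also have "\<dots> = (\<Sum>s\<in>S. \<Sum>l<d. X $$ (i, l) * F s $$ (l, j))" by (rule sum.swap)
  also have "\<dots> = (\<Sum>s\<in>S. (X * F s) $$ (i, j))"
    by (rule sum.cong) (use ij assms in \<open>auto intro!: mult_mat_index[symmetric]\<close>)
  finally show "(X * mat_sum d S F) $$ (i, j) = mat_sum d S (\<lambda>s. X * F s) $$ (i, j)"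
    using ij by simp
qed (use assms in auto)

lemma mat_sum_mult:
  assumes "X \<in> carrier_mat d d" "\<And>s. s \<in> S \<Longrightarrow> F s \<in> carrier_mat d d"
  shows "mat_sum d S F * X = mat_sum d S (\<lambda>s. F s * X)"
proof (rule eq_matI)
  fix i j assume "i < dim_row (mat_sum d S (\<lambda>s. F s * X))"
    "j < dim_col (mat_sum d S (\<lambda>s. F s * X))"
  then have ij: "i < d" "j < d" by auto
  have "(mat_sum d S F * X) $$ (i, j) = (\<Sum>l<d. \<Sum>s\<in>S. F s $$ (i, l) * X $$ (l, j))"
    using ij assms(1) by (subst mult_mat_index) (auto simp: sum_distrib_right)
  also have "\<dots> = (\<Sum>s\<in>S. \<Sum>l<d. F s $$ (i, l) * X $$ (l, j))" by (rule sum.swap)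
  also have "\<dots> = (\<Sum>s\<in>S. (F s * X) $$ (i, j))"
    by (rule sum.cong) (use ij assms in \<open>auto intro!: mult_mat_index[symmetric]\<close>)
  finally show "(mat_sum d S F * X) $$ (i, j) = mat_sum d S (\<lambda>s. F s * X) $$ (i, j)"
    using ij by simp
qed (use assms in auto)

lemma mat_sum_reindex:
  assumes "bij_betw T A B"
  shows "mat_sum d B F = mat_sum d A (\<lambda>s. F (T s))"
  by (rule eq_matI) (auto simp: sum.reindex_bij_betw[OF assms, symmetric])

lemma mat_sum_cong:
  assumes "\<And>s. s \<in> A \<Longrightarrow> F s = F' s"
  shows "mat_sum d A F = mat_sum d A F'"
  using assms by (auto simp: mat_sum_def)

lemma mat_sum_mult_vec_closed:
  assumes W: "VectorSpace.subspace class_ring W (module_vec TYPE(complex) d)"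
    and "finite S" and "v \<in> W"
    and "\<And>s. s \<in> S \<Longrightarrow> F s \<in> carrier_mat d d"
    and "\<And>s. s \<in> S \<Longrightarrow> F s *\<^sub>v v \<in> W"
  shows "mat_sum d S F *\<^sub>v v \<in> W"
  using assms(2,4,5)
proof (induction S rule: finite_induct)
  case empty
  have "v \<in> carrier_vec d" using W assms(3) by (auto simp: subspace_vec_iff)
  then have "mat_sum d {} F *\<^sub>v v = 0\<^sub>v d"
    by (intro eq_vecI) (auto simp: scalar_prod_def)
  then show ?case using W by (auto simp: subspace_vec_iff)
next
  case (insert s S)
  have v: "v \<in> carrier_vec d" using W assms(3) by (auto simp: subspace_vec_iff)
  have "mat_sum d (insert s S) F = F s + mat_sum d S F"
    using insert by (intro eq_matI) auto
  then have "mat_sum d (insert s S) F *\<^sub>v v = F s *\<^sub>v v + mat_sum d S F *\<^sub>v v"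
    using v insert by (simp add: add_mult_distrib_mat_vec[of _ d d])
  then show ?case using W insert by (auto simp: subspace_vec_iff)
qed

lemma mat_trace_mult_commute:
  assumes "A \<in> carrier_mat d d" "B \<in> carrier_mat d d"
  shows "mat_trace (A * B) = mat_trace (B * (A :: 'a::comm_ring_1 mat))"
proof -
  have "mat_trace (A * B) = (\<Sum>i<d. \<Sum>l<d. A $$ (i, l) * B $$ (l, i))"
    unfolding mat_trace_def using assms
    by (intro sum.cong) (auto intro!: mult_mat_index simp del: index_mult_mat(1))
  also have "\<dots> = (\<Sum>l<d. \<Sum>i<d. B $$ (l, i) * A $$ (i, l))"
    by (subst sum.swap) (simp add: mult.commute)
  also have "\<dots> = mat_trace (B * A)"
    unfolding mat_trace_def using assms
    by (intro sum.cong) (auto intro!: mult_mat_index[symmetric] simp del: index_mult_mat(1))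
  finally show ?thesis .
qed

lemma mat_trace_smult_one: "mat_trace (k \<cdot>\<^sub>m 1\<^sub>m d) = of_nat d * (k :: complex)"
  by (simp add: mat_trace_def)

lemma mat_trace_smult: "mat_trace (k \<cdot>\<^sub>m A) = k * mat_trace (A :: 'a::comm_ring_1 mat)"
  if "A \<in> carrier_mat d d"
  using that by (auto simp: mat_trace_def sum_distrib_left)

lemma mat_mult_vec_eqI:
  fixes A :: "'a::field mat"
  assumes "A \<in> carrier_mat d d" "B \<in> carrier_mat d d"
    and "\<And>v. v \<in> carrier_vec d \<Longrightarrow> A *\<^sub>v v = B *\<^sub>v v"
  shows "A = B"
proof (rule eq_matI)
  fix i j assume "i < dim_row B" "j < dim_col B"
  then have ij: "i < d" "j < d" using assms by auto
  have "(A *\<^sub>v unit_vec d j) $ i = (B *\<^sub>v unit_vec d j) $ i" using assms(3) by simp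
  then show "A $$ (i, j) = B $$ (i, j)" using ij assms(1,2) by simp
qed (use assms in auto)

subsection \<open>Irreducible representations\<close>

locale irrep = group G for G (structure) +
  fixes d :: nat and \<rho> :: "'a \<Rightarrow> complex mat"
  assumes finG: "finite (carrier G)" and irr: "irreducible_representation G d \<rho>"
begin

declare mult_carrier_mat[of _ d d _ d, simp] mult_mat_vec_carrier[of _ d d, simp]

lemma rep_carrier [simp]: "g \<in> carrier G \<Longrightarrow> \<rho> g \<in> carrier_mat d d"
  and rep_mult: "g \<in> carrier G \<Longrightarrow> h \<in> carrier G \<Longrightarrow> \<rho> (g \<otimes> h) = \<rho> g * \<rho> h"
  and dim_pos: "d > 0"
  and irreducible: "VectorSpace.subspace class_ring W (module_vec TYPE(complex) d) \<Longrightarrow>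
     (\<And>g v. g \<in> carrier G \<Longrightarrow> v \<in> W \<Longrightarrow> \<rho> g *\<^sub>v v \<in> W) \<Longrightarrow>
     W = {0\<^sub>v d} \<or> W = carrier_vec d"
  using irr unfolding irreducible_representation_def representation_def hom_def
  by (auto simp: units_of_def Units_def ring_mat_simps)

text \<open>An idempotent with a left inverse is the identity.\<close>

lemma rep_one: "\<rho> \<one> = 1\<^sub>m d"
proof -
  have "\<rho> \<one> \<in> Units (ring_mat TYPE(complex) d ())"
    using irr by (auto simp: irreducible_representation_def representation_def hom_def units_of_def)
  then obtain B where B: "B \<in> carrier_mat d d" "B * \<rho> \<one> = 1\<^sub>m d"
    by (auto simp: Units_def ring_mat_simps)
  have "\<rho> \<one> = (B * \<rho> \<one>) * \<rho> \<one>"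
    using B left_mult_one_mat[OF rep_carrier[OF one_closed]] by metis
  also have "\<dots> = B * (\<rho> \<one> * \<rho> \<one>)" using B(1) by (intro assoc_mult_mat[of _ d d _ d _ d]) auto
  also have "\<dots> = B * \<rho> \<one>" using rep_mult[of \<one> \<one>] by simp
  finally show ?thesis using B by simp
qed

lemma rep_inv:
  assumes "g \<in> carrier G"
  shows "\<rho> g * \<rho> (inv g) = 1\<^sub>m d" "\<rho> (inv g) * \<rho> g = 1\<^sub>m d"
  using assms by (simp_all add: rep_one flip: rep_mult)

lemma character_eq: "g \<in> carrier G \<Longrightarrow> character_of G \<rho> g = mat_trace (\<rho> g)"
  by (simp add: character_of_def)

lemma character_one: "character_of G \<rho> \<one> = of_nat d"
  by (simp add: character_eq rep_one mat_trace_def)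

text \<open>An eigenspace of \<open>A\<close> is invariant because \<open>A\<close> commutes with
  the representation, and it is nonzero because an eigenvalue exists over the complex
  numbers.\<close>

lemma schur:
  assumes A: "A \<in> carrier_mat d d" and comm: "\<And>g. g \<in> carrier G \<Longrightarrow> A * \<rho> g = \<rho> g * A"
  shows "\<exists>k. A = k \<cdot>\<^sub>m 1\<^sub>m d"
proof -
  obtain k where "eigenvalue A k"
    using spectrum_non_empty[OF A dim_pos] by (auto simp: spectrum_def)
  then obtain v where v: "v \<in> carrier_vec d" "v \<noteq> 0\<^sub>v d" "A *\<^sub>v v = k \<cdot>\<^sub>v v"
    using A by (auto simp: eigenvalue_def eigenvector_def)
  define W where "W = {v \<in> carrier_vec d. A *\<^sub>v v = k \<cdot>\<^sub>v v}"
  have "VectorSpace.subspace class_ring W (module_vec TYPE(complex) d)"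
    using A unfolding subspace_vec_iff W_def
    by (auto simp: mult_add_distrib_mat_vec[of _ d d] smult_add_distrib_vec mult_mat_vec[of _ d d]
        smult_smult_assoc mult.commute)
  moreover have "\<rho> g *\<^sub>v w \<in> W" if "g \<in> carrier G" "w \<in> W" for g w
  proof -
    have w: "w \<in> carrier_vec d" "A *\<^sub>v w = k \<cdot>\<^sub>v w" using that by (auto simp: W_def)
    have "A *\<^sub>v (\<rho> g *\<^sub>v w) = (A * \<rho> g) *\<^sub>v w"
      using A w that by (intro assoc_mult_mat_vec[symmetric]) auto
    also have "\<dots> = \<rho> g *\<^sub>v (A *\<^sub>v w)"
      using A w that comm by (simp add: assoc_mult_mat_vec[of _ d d _ d])
    also have "\<dots> = k \<cdot>\<^sub>v (\<rho> g *\<^sub>v w)" using w that by (simp add: mult_mat_vec[of _ d d])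
    finally show ?thesis using w that by (auto simp: W_def)
  qed
  ultimately have "W = carrier_vec d" using irreducible[of W] v by (auto simp: W_def)
  then have "A *\<^sub>v w = (k \<cdot>\<^sub>m 1\<^sub>m d) *\<^sub>v w" if "w \<in> carrier_vec d" for w
    using that by (auto simp: W_def smult_one_mult_vec)
  then show ?thesis using mat_mult_vec_eqI[OF A, of "k \<cdot>\<^sub>m 1\<^sub>m d"] by auto
qed

lemma bij_mult_left: "h \<in> carrier G \<Longrightarrow> bij_betw (\<lambda>g. h \<otimes> g) (carrier G) (carrier G)"
  by (intro bij_betwI[where g = "\<lambda>g. inv h \<otimes> g"]) (auto simp flip: m_assoc)

text \<open>Translating the summation index shows that the sum of conjugates commutes with every
  \<open>\<rho> h\<close>, so Schur's lemma applies; each conjugate has the trace of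
  \<open>A\<close>, which determines the scalar.\<close>

lemma averaged_scalar:
  assumes A: "A \<in> carrier_mat d d"
  shows "\<exists>k. mat_sum d (carrier G) (\<lambda>g. \<rho> g * A * \<rho> (inv g)) = k \<cdot>\<^sub>m 1\<^sub>m d \<and>
    of_nat d * k = of_nat (card (carrier G)) * mat_trace A"
proof -
  let ?F = "\<lambda>g. \<rho> g * A * \<rho> (inv g)"
  let ?B = "mat_sum d (carrier G) ?F"
  have F: "?F g \<in> carrier_mat d d" if "g \<in> carrier G" for g using A that by simp
  have "?B * \<rho> h = \<rho> h * ?B" if h: "h \<in> carrier G" for h
  proof -
    have "?B = mat_sum d (carrier G) (\<lambda>g. ?F (h \<otimes> g))"
      by (rule mat_sum_reindex[OF bij_mult_left[OF h]])
    then have "?B * \<rho> h = mat_sum d (carrier G) (\<lambda>g. ?F (h \<otimes> g) * \<rho> h)"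
      using h F by (simp add: mat_sum_mult)
    also have "\<dots> = mat_sum d (carrier G) (\<lambda>g. \<rho> h * ?F g)"
    proof (rule mat_sum_cong)
      fix g assume g: "g \<in> carrier G"
      have "?F (h \<otimes> g) * \<rho> h = \<rho> h * \<rho> g * A * (\<rho> (inv g) * (\<rho> (inv h) * \<rho> h))"
        using g h A by (simp add: rep_mult inv_mult_group assoc_mult_mat[of _ d d _ d _ d])
      then show "?F (h \<otimes> g) * \<rho> h = \<rho> h * ?F g"
        using g h A right_mult_one_mat[OF rep_carrier[OF inv_closed[OF g]]] by (simp add: rep_inv assoc_mult_mat[of _ d d _ d _ d])
    qed
    also have "\<dots> = \<rho> h * ?B" using h F by (simp add: mult_mat_sum)
    finally show ?thesis .
  qed
  then obtain k where k: "?B = k \<cdot>\<^sub>m 1\<^sub>m d" using schur[of ?B] by auto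
  have "mat_trace (?F g) = mat_trace A" if g: "g \<in> carrier G" for g
  proof -
    have "mat_trace (?F g) = mat_trace (\<rho> (inv g) * (\<rho> g * A))"
      using g A by (intro mat_trace_mult_commute[of _ d]) auto
    also have "\<rho> (inv g) * (\<rho> g * A) = A"
      using g A rep_inv[OF g] by (simp add: assoc_mult_mat[of _ d d _ d _ d, symmetric])
    finally show ?thesis .
  qed
  moreover have "mat_trace ?B = (\<Sum>g\<in>carrier G. mat_trace (?F g))"
  proof -
    have "mat_trace ?B = (\<Sum>i<d. \<Sum>g\<in>carrier G. ?F g $$ (i, i))" by (simp add: mat_trace_def)
    also have "\<dots> = (\<Sum>g\<in>carrier G. \<Sum>i<d. ?F g $$ (i, i))" by (rule sum.swap)
    also have "\<dots> = (\<Sum>g\<in>carrier G. mat_trace (?F g))"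
      by (rule sum.cong) (auto simp: mat_trace_def carrier_matD[OF rep_carrier])
    finally show ?thesis .
  qed
  ultimately have "mat_trace ?B = of_nat (card (carrier G)) * mat_trace A" by simp
  then show ?thesis using k mat_trace_smult_one[of k d] by auto
qed

text \<open>Schur orthogonality of the diagonal matrix coefficients, obtained by averaging matrix
  units.\<close>

lemma character_norm:
  "(\<Sum>g\<in>carrier G. character_of G \<rho> g * character_of G \<rho> (inv g)) = of_nat (card (carrier G))"
proof -
  have entry: "(\<Sum>g\<in>carrier G. \<rho> g $$ (i, i) * \<rho> (inv g) $$ (j, j)) =
      (if i = j then of_nat (card (carrier G)) / of_nat d else 0)" if ij: "i < d" "j < d" for i j
  proof -
    \<comment> \<open>The matrix unit at \<open>(i, j)\<close>: entry \<open>(i, j)\<close> of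
      \<open>\<rho> g * E * \<rho> (inv g)\<close> is exactly the product of diagonal entries to be
      summed.\<close>
    define E where "E = mat d d (\<lambda>(r, s). if r = i \<and> s = j then 1 else 0 :: complex)"
    have E: "E \<in> carrier_mat d d" by (simp add: E_def)
    have "(\<rho> g * E * \<rho> (inv g)) $$ (i, j) = \<rho> g $$ (i, i) * \<rho> (inv g) $$ (j, j)"
      if g: "g \<in> carrier G" for g
    proof -
      have "(\<rho> g * E) $$ (i, l) = (if l = j then \<rho> g $$ (i, i) else 0)" if "l < d" for l
      proof -
        have "(\<rho> g * E) $$ (i, l) = (\<Sum>k<d. \<rho> g $$ (i, k) * E $$ (k, l))"
          using that ij g E by (intro mult_mat_index) auto
        also have "\<dots> = (\<Sum>k<d. if k = i then (if l = j then \<rho> g $$ (i, i) else 0) else 0)"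
          by (rule sum.cong) (use that ij in \<open>auto simp: E_def\<close>)
        finally show ?thesis using ij by simp
      qed
      then have "(\<rho> g * E * \<rho> (inv g)) $$ (i, j) =
          (\<Sum>l<d. (if l = j then \<rho> g $$ (i, i) * \<rho> (inv g) $$ (j, j) else 0))"
        using ij g E by (subst mult_mat_index[of _ d d _ d]) (auto simp: if_distrib[of "\<lambda>x. x * _"] cong: if_cong)
      then show ?thesis using ij by simp
    qed
    moreover obtain k where "mat_sum d (carrier G) (\<lambda>g. \<rho> g * E * \<rho> (inv g)) = k \<cdot>\<^sub>m 1\<^sub>m d"
      and k: "of_nat d * k = of_nat (card (carrier G)) * mat_trace E"
      using averaged_scalar[OF E] by blast
    then have "(\<Sum>g\<in>carrier G. (\<rho> g * E * \<rho> (inv g)) $$ (i, j)) = (k \<cdot>\<^sub>m 1\<^sub>m d) $$ (i, j)"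
      using mat_sum_index[OF ij] by metis
    moreover have "mat_trace E = (if i = j then 1 else 0)"
    proof -
      have "mat_trace E = (\<Sum>r<d. if r = i then (if i = j then 1 else 0) else 0)"
        by (auto simp: mat_trace_def E_def intro!: sum.cong)
      then show ?thesis using ij by simp
    qed
    ultimately show ?thesis using ij k dim_pos by (auto simp: field_simps)
  qed
  have "(\<Sum>g\<in>carrier G. character_of G \<rho> g * character_of G \<rho> (inv g)) =
      (\<Sum>g\<in>carrier G. \<Sum>i<d. \<Sum>j<d. \<rho> g $$ (i, i) * \<rho> (inv g) $$ (j, j))"
    by (rule sum.cong)
      (auto simp: character_eq mat_trace_def sum_product carrier_matD[OF rep_carrier])
  also have "\<dots> = (\<Sum>i<d. \<Sum>j<d. \<Sum>g\<in>carrier G. \<rho> g $$ (i, i) * \<rho> (inv g) $$ (j, j))"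
    by (subst sum.swap, subst sum.swap) (rule refl)
  also have "\<dots> = (\<Sum>i<d. \<Sum>j<d. if i = j then of_nat (card (carrier G)) / of_nat d else 0)"
    using entry by simp
  also have "\<dots> = of_nat (card (carrier G))" using dim_pos by simp
  finally show ?thesis .
qed

text \<open>The vectors fixed by \<open>N\<close> form an invariant subspace by normality, hence all
  of the space unless it is zero. The trace hypothesis excludes zero without any estimate on
  eigenvalues.\<close>

lemma trivial_on_normal_subgroup:
  assumes N: "N \<lhd> G" and \<chi>: "\<And>u. u \<in> N \<Longrightarrow> character_of G \<rho> u = of_nat d" and u: "u \<in> N"
  shows "\<rho> u = 1\<^sub>m d"
proof -
  interpret N: normal N G by (rule N)
  note sub [simp] = N.mem_carrier
  have finN: "finite N" using finG N.subset finite_subset by blast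
  define W where "W = {v \<in> carrier_vec d. \<forall>u\<in>N. \<rho> u *\<^sub>v v = v}"
  have "VectorSpace.subspace class_ring W (module_vec TYPE(complex) d)"
    unfolding subspace_vec_iff W_def
    by (auto simp: mult_add_distrib_mat_vec[of _ d d] mult_mat_vec[of _ d d]
        mult_mat_zero_vec[of _ d d])
  moreover have "\<rho> g *\<^sub>v w \<in> W" if g: "g \<in> carrier G" and w: "w \<in> W" for g w
  proof -
    have "\<rho> u *\<^sub>v (\<rho> g *\<^sub>v w) = \<rho> g *\<^sub>v w" if u: "u \<in> N" for u
    proof -
      have u': "inv g \<otimes> u \<otimes> g \<in> N" using N.inv_op_closed1[OF g u] .
      have "\<rho> u *\<^sub>v (\<rho> g *\<^sub>v w) = \<rho> (u \<otimes> g) *\<^sub>v w"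
        using g u w by (simp add: rep_mult W_def assoc_mult_mat_vec[of _ d d _ d])
      also have "u \<otimes> g = g \<otimes> (inv g \<otimes> u \<otimes> g)" using g u by (simp flip: m_assoc)
      also have "\<rho> \<dots> *\<^sub>v w = \<rho> g *\<^sub>v (\<rho> (inv g \<otimes> u \<otimes> g) *\<^sub>v w)"
        using g u' w by (simp only: rep_mult sub) (simp add: W_def assoc_mult_mat_vec[of _ d d _ d])
      finally show ?thesis using w u' by (simp add: W_def)
    qed
    then show ?thesis using w g by (auto simp: W_def)
  qed
  moreover have "W \<noteq> {0\<^sub>v d}"
  proof
    assume W: "W = {0\<^sub>v d}"
    \<comment> \<open>The image of \<open>P\<close> consists of vectors fixed by \<open>N\<close>,
      so \<open>P\<close> would vanish, whereas its trace is \<open>card N * d\<close>.\<close>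
    define P where "P = mat_sum d N \<rho>"
    have P: "P \<in> carrier_mat d d" by (simp add: P_def)
    have "P *\<^sub>v v = 0\<^sub>m d d *\<^sub>v v" if v: "v \<in> carrier_vec d" for v
    proof -
      have "\<rho> u * P = P" if u: "u \<in> N" for u
      proof -
        have "bij_betw (\<lambda>x. u \<otimes> x) N N"
          using u by (intro bij_betwI[where g = "\<lambda>g. inv u \<otimes> g"]) (auto simp flip: m_assoc)
        then have "P = mat_sum d N (\<lambda>x. \<rho> (u \<otimes> x))" unfolding P_def by (rule mat_sum_reindex)
        also have "\<dots> = \<rho> u * P"
          using u unfolding P_def by (subst mult_mat_sum) (auto intro!: mat_sum_cong simp: rep_mult)
        finally show ?thesis by simp
      qed
      then have "P *\<^sub>v v \<in> W"
        using P v by (auto simp: W_def assoc_mult_mat_vec[of _ d d _ d, symmetric])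
      then show ?thesis using v by (auto simp: W)
    qed
    then have "P = 0\<^sub>m d d" using P by (intro mat_mult_vec_eqI[of _ d]) auto
    then have "mat_trace P = 0" by (simp add: mat_trace_def)
    moreover have "mat_trace P = (\<Sum>u\<in>N. character_of G \<rho> u)"
    proof -
      have "mat_trace P = (\<Sum>i<d. \<Sum>u\<in>N. \<rho> u $$ (i, i))" by (simp add: mat_trace_def P_def)
      also have "\<dots> = (\<Sum>u\<in>N. \<Sum>i<d. \<rho> u $$ (i, i))" by (rule sum.swap)
      finally show ?thesis
        by (auto simp: character_eq mat_trace_def carrier_matD[OF rep_carrier])
    qed
    ultimately have "of_nat (card N * d) = (0 :: complex)" using \<chi> by simp
    then show False using dim_pos finN N.one_closed by (auto simp: card_eq_0_iff)
  qed
  ultimately have "W = carrier_vec d" using irreducible[of W] by blast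
  then have "\<rho> u *\<^sub>v w = 1\<^sub>m d *\<^sub>v w" if "w \<in> carrier_vec d" for w
    using that u by (auto simp: W_def)
  then show ?thesis using u mat_mult_vec_eqI[of "\<rho> u" d "1\<^sub>m d"] by auto
qed

end

subsection \<open>Induction of a linear character from a normal subgroup\<close>

text \<open>The \<open>t i\<close> represent the right cosets of \<open>L\<close>, so
  \<open>d\<close> is the index of \<open>L\<close> and the dimension of the induced
  representation.\<close>

locale induced_linear = normal L G for L and G (structure) +
  fixes \<phi> :: "'a \<Rightarrow> complex" and d :: nat and t :: "nat \<Rightarrow> 'a"
  assumes finG: "finite (carrier G)"
    and phi_mult: "x \<in> L \<Longrightarrow> y \<in> L \<Longrightarrow> \<phi> (x \<otimes> y) = \<phi> x * \<phi> y"
    and phi_one: "\<phi> \<one> = 1"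
    and t_closed [simp]: "i < d \<Longrightarrow> t i \<in> carrier G"
    and t_transversal: "g \<in> carrier G \<Longrightarrow> \<exists>!i. i < d \<and> g \<otimes> inv (t i) \<in> L"
begin

lemma one_mem: "\<one> \<in> L"
  by (rule subgroup.one_closed[OF is_subgroup])

definition phi0 :: "'a \<Rightarrow> complex" where
  "phi0 y = (if y \<in> L then \<phi> y else 0)"

text \<open>The monomial matrix of the induced representation with respect to the coset
  representatives: each row has one nonzero entry.\<close>

definition ind_rep :: "'a \<Rightarrow> complex mat" where
  "ind_rep g = mat d d (\<lambda>(i, j). phi0 (t i \<otimes> g \<otimes> inv (t j)))"

lemma ind_rep_carrier [simp]: "ind_rep g \<in> carrier_mat d d"
  and ind_rep_index [simp]:
    "i < d \<Longrightarrow> j < d \<Longrightarrow> ind_rep g $$ (i, j) = phi0 (t i \<otimes> g \<otimes> inv (t j))"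
  by (auto simp: ind_rep_def)

lemma phi0_mult:
  assumes "x \<in> L" "y \<in> carrier G"
  shows "phi0 (x \<otimes> y) = \<phi> x * phi0 y"
proof -
  have "x \<otimes> y \<in> L \<longleftrightarrow> y \<in> L"
  proof
    assume "x \<otimes> y \<in> L"
    then have "inv x \<otimes> (x \<otimes> y) \<in> L" using assms by simp
    then show "y \<in> L" using assms by (simp flip: m_assoc)
  qed (use assms in auto)
  then show ?thesis using assms by (auto simp: phi0_def phi_mult)
qed

lemma phi_inv: "x \<in> L \<Longrightarrow> \<phi> x * \<phi> (inv x) = 1"
  using phi_mult[of x "inv x"] by (simp add: phi_one)

lemma conj_mem: "x \<in> carrier G \<Longrightarrow> y \<in> L \<Longrightarrow> x \<otimes> y \<otimes> inv x \<in> L"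
  by (rule inv_op_closed2)

lemma conj_mem_iff:
  assumes "x \<in> carrier G" "y \<in> carrier G"
  shows "x \<otimes> y \<otimes> inv x \<in> L \<longleftrightarrow> y \<in> L"
proof
  assume "x \<otimes> y \<otimes> inv x \<in> L"
  then have "inv x \<otimes> (x \<otimes> y \<otimes> inv x) \<otimes> x \<in> L" using assms by (intro inv_op_closed1)
  moreover have "inv x \<otimes> (x \<otimes> y \<otimes> inv x) \<otimes> x = y"
    using assms by (simp add: m_assoc) (simp flip: m_assoc)
  ultimately show "y \<in> L" by simp
qed (use assms conj_mem in auto)

lemma phi0_conj:
  assumes "l \<in> L" "y \<in> carrier G"
  shows "phi0 (l \<otimes> y \<otimes> inv l) = phi0 y"
proof (cases "y \<in> L")
  case True
  then have "\<phi> (l \<otimes> y \<otimes> inv l) = \<phi> l * \<phi> (inv l) * \<phi> y"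
    using assms by (simp add: phi_mult)
  then show ?thesis using assms True by (simp add: phi0_def phi_inv)
next
  case False
  then show ?thesis using assms conj_mem_iff[of l y] by (simp add: phi0_def)
qed

lemma t_eq:
  assumes "i < d" "j < d" "t i \<otimes> inv (t j) \<in> L"
  shows "i = j"
proof -
  have "t i \<otimes> inv (t i) \<in> L" using assms one_mem by simp
  then show ?thesis using ex1E[OF t_transversal[of "t i"]] assms t_closed by metis
qed

lemma ind_rep_mult:
  assumes "g \<in> carrier G" "h \<in> carrier G"
  shows "ind_rep (g \<otimes> h) = ind_rep g * ind_rep h"
proof (rule eq_matI)
  fix i k assume "i < dim_row (ind_rep g * ind_rep h)" "k < dim_col (ind_rep g * ind_rep h)"
  then have ik: "i < d" "k < d" by (auto simp: ind_rep_def)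
  \<comment> \<open>Row \<open>i\<close> of \<open>ind_rep g\<close> is nonzero only in column
    \<open>j\<close>, so a single term of the matrix product survives.\<close>
  obtain j where j: "j < d" "t i \<otimes> g \<otimes> inv (t j) \<in> L"
    and uniq: "\<And>j'. j' < d \<Longrightarrow> t i \<otimes> g \<otimes> inv (t j') \<in> L \<Longrightarrow> j' = j"
    using t_transversal[OF m_closed[OF t_closed[OF ik(1)] assms(1)]] by blast
  have "(ind_rep g * ind_rep h) $$ (i, k) =
      (\<Sum>l<d. phi0 (t i \<otimes> g \<otimes> inv (t l)) * phi0 (t l \<otimes> h \<otimes> inv (t k)))"
    using ik by (subst mult_mat_index[of _ d d _ d]) auto
  also have "\<dots> = (\<Sum>l<d. if l = j then \<phi> (t i \<otimes> g \<otimes> inv (t j)) *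
      phi0 (t j \<otimes> h \<otimes> inv (t k)) else 0)"
    by (rule sum.cong) (use j in \<open>auto simp: phi0_def dest: uniq\<close>)
  also have "\<dots> = phi0 (t i \<otimes> g \<otimes> inv (t j) \<otimes> (t j \<otimes> h \<otimes> inv (t k)))"
    using j ik assms by (subst phi0_mult) auto
  also have "t i \<otimes> g \<otimes> inv (t j) \<otimes> (t j \<otimes> h \<otimes> inv (t k)) = t i \<otimes> (g \<otimes> h) \<otimes> inv (t k)"
  proof -
    have "inv (t j) \<otimes> (t j \<otimes> h \<otimes> inv (t k)) = h \<otimes> inv (t k)"
      using j ik assms by (simp flip: m_assoc)
    then show ?thesis using j ik assms by (simp add: m_assoc)
  qed
  finally show "ind_rep (g \<otimes> h) $$ (i, k) = (ind_rep g * ind_rep h) $$ (i, k)"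
    using ik by simp
qed (auto simp: ind_rep_def)

lemma ind_rep_one: "ind_rep \<one> = 1\<^sub>m d"
  by (rule eq_matI) (auto simp: ind_rep_def phi0_def phi_one dest: t_eq)

lemma ind_rep_representation: "representation G d ind_rep"
proof -
  have "ind_rep g \<in> Units (ring_mat TYPE(complex) d ())" if "g \<in> carrier G" for g
  proof -
    have "ind_rep (inv g) * ind_rep g = 1\<^sub>m d" "ind_rep g * ind_rep (inv g) = 1\<^sub>m d"
      using that by (simp_all add: ind_rep_one flip: ind_rep_mult)
    then show ?thesis unfolding Units_def ring_mat_simps using ind_rep_carrier by blast
  qed
  then show ?thesis
    by (auto simp: representation_def hom_def units_of_def ring_mat_simps ind_rep_mult)
qed

lemma sum_over_cosets:
  "(\<Sum>x\<in>carrier G. F x) = (\<Sum>i<d. \<Sum>l\<in>L. F (l \<otimes> t i) :: complex)"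
proof -
  have "bij_betw (\<lambda>(i, l). l \<otimes> t i) ({..<d} \<times> L) (carrier G)"
  proof (rule bij_betw_imageI)
    show "inj_on (\<lambda>(i, l). l \<otimes> t i) ({..<d} \<times> L)"
    proof (rule inj_onI, clarify)
      fix i l i' l' assume *: "i < d" "l \<in> L" "i' < d" "l' \<in> L" "l \<otimes> t i = l' \<otimes> t i'"
      have "inv l \<otimes> (l \<otimes> t i) = t i" using *(1-4) by (simp flip: m_assoc)
      then have "t i \<otimes> inv (t i') = inv l \<otimes> (l' \<otimes> t i') \<otimes> inv (t i')" using *(5) by simp
      also have "\<dots> = inv l \<otimes> l'" using *(1-4) by (simp add: m_assoc)
      finally have "i = i'" using * by (intro t_eq) auto
      then show "i = i' \<and> l = l'" using * by simp
    qed
    show "(\<lambda>(i, l). l \<otimes> t i) ` ({..<d} \<times> L) = carrier G"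
    proof (intro equalityI subsetI)
      fix g assume g: "g \<in> carrier G"
      then obtain i where i: "i < d" "g \<otimes> inv (t i) \<in> L" using t_transversal by blast
      have "g = (g \<otimes> inv (t i)) \<otimes> t i" using g i by (simp add: m_assoc)
      then show "g \<in> (\<lambda>(i, l). l \<otimes> t i) ` ({..<d} \<times> L)" using i by force
    qed auto
  qed
  then show ?thesis
    using sum.reindex_bij_betw[of "\<lambda>(i, l). l \<otimes> t i" "{..<d} \<times> L" "carrier G" F]
    by (simp add: sum.cartesian_product case_prod_beta)
qed

text \<open>Conjugation by \<open>l \<otimes> t i\<close> gives a value independent of
  \<open>l\<close>, as \<open>phi0\<close> is invariant under conjugation by \<open>L\<close>; the
  resulting factor \<open>card L\<close> cancels the denominator in
  \<open>induced_function\<close>.\<close>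

lemma character_ind_rep: "character_of G ind_rep = induced_function G L \<phi>"
proof (rule ext)
  fix g
  have finL: "finite L" "L \<noteq> {}" using finG subset finite_subset one_mem by blast+
  have "(\<Sum>x\<in>carrier G. phi0 (x \<otimes> g \<otimes> inv x)) =
      of_nat (card L) * mat_trace (ind_rep g)" if g: "g \<in> carrier G"
  proof -
    have "phi0 (l \<otimes> t i \<otimes> g \<otimes> inv (l \<otimes> t i)) = phi0 (t i \<otimes> g \<otimes> inv (t i))"
      if "i < d" "l \<in> L" for i l
    proof -
      have "l \<otimes> t i \<otimes> g \<otimes> inv (l \<otimes> t i) = l \<otimes> (t i \<otimes> g \<otimes> inv (t i)) \<otimes> inv l"
        using that g by (simp add: inv_mult_group m_assoc)
      then show ?thesis using that g phi0_conj by simp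
    qed
    then have "(\<Sum>x\<in>carrier G. phi0 (x \<otimes> g \<otimes> inv x)) =
        (\<Sum>i<d. of_nat (card L) * phi0 (t i \<otimes> g \<otimes> inv (t i)))"
      unfolding sum_over_cosets by simp
    also have "\<dots> = of_nat (card L) * mat_trace (ind_rep g)"
      by (simp add: mat_trace_def sum_distrib_left carrier_matD[OF ind_rep_carrier])
    finally show ?thesis .
  qed
  then show "character_of G ind_rep g = induced_function G L \<phi> g"
    using finL by (auto simp: character_of_def induced_function_def Let_def phi0_def)
qed

text \<open>On \<open>L\<close> the induced representation is diagonal with pairwise distinct characters, so
  averaging over \<open>L\<close> isolates the coordinates of a vector, and the group permutes the
  coordinate lines transitively.\<close>

lemma ind_rep_irreducible:
  assumes sep: "\<And>x. x \<in> carrier G \<Longrightarrow> x \<notin> L \<Longrightarrow> \<exists>l\<in>L. \<phi> (x \<otimes> l \<otimes> inv x) \<noteq> \<phi> l"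
  shows "irreducible_representation G d ind_rep"
proof -
  have finL: "finite L" using finG subset finite_subset by blast
  have cardL: "card L \<noteq> 0" using card_0_eq[OF finL] one_mem by blast
  have d: "d \<noteq> 0" using ex1_implies_ex[OF t_transversal[OF monoid.one_closed[OF is_monoid]]] by auto
  have "W = carrier_vec d"
    if W: "VectorSpace.subspace class_ring W (module_vec TYPE(complex) d)"
      and inv: "\<And>g v. g \<in> carrier G \<Longrightarrow> v \<in> W \<Longrightarrow> ind_rep g *\<^sub>v v \<in> W"
      and v: "v \<in> W" "v \<noteq> 0\<^sub>v d" for W v
  proof -
    have Wc: "W \<subseteq> carrier_vec d" and W_smult: "\<And>k v. v \<in> W \<Longrightarrow> k \<cdot>\<^sub>v v \<in> W"
      using W unfolding subspace_vec_iff by blast+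
    have vc: "v \<in> carrier_vec d" using v Wc by blast
    have "v = 0\<^sub>v d" if "\<forall>i<d. v $ i = 0" using vc that by (intro eq_vecI) auto
    then obtain i where i: "i < d" "v $ i \<noteq> 0" using v by blast
    \<comment> \<open>Up to the factor \<open>card L\<close> this is the projection onto coordinate
      \<open>i\<close>: the weights are the inverse values of the linear character by which
      \<open>L\<close> acts on that coordinate.\<close>
    let ?P = "mat_sum d L (\<lambda>l. \<phi> (t i \<otimes> inv l \<otimes> inv (t i)) \<cdot>\<^sub>m ind_rep l)"
    have "?P *\<^sub>v v \<in> W"
    proof (rule mat_sum_mult_vec_closed[OF W finL v(1)])
      fix l assume l: "l \<in> L"
      have "(k \<cdot>\<^sub>m ind_rep l) *\<^sub>v v = k \<cdot>\<^sub>v (ind_rep l *\<^sub>v v)" for k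
        using vc by (intro eq_vecI) (auto simp: scalar_prod_def sum_distrib_left ind_rep_def mult.assoc)
      then show "(\<phi> (t i \<otimes> inv l \<otimes> inv (t i)) \<cdot>\<^sub>m ind_rep l) *\<^sub>v v \<in> W"
        using W_smult[OF inv[OF mem_carrier[OF l] v(1)]] by simp
    qed auto
    have entry: "?P $$ (j, k) = (if j = i \<and> k = i then of_nat (card L) else 0)"
      if jk: "j < d" "k < d" for j k
    proof -
      have offd: "phi0 (t j \<otimes> l \<otimes> inv (t k)) = (if j = k then \<phi> (t j \<otimes> l \<otimes> inv (t j)) else 0)"
        if "l \<in> L" for l
      proof (cases "j = k")
        case True
        then show ?thesis using conj_mem that jk by (simp add: phi0_def)
      next
        case False
        have "t j \<otimes> l \<otimes> inv (t k) = (t j \<otimes> l \<otimes> inv (t j)) \<otimes> (t j \<otimes> inv (t k))"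
        proof -
          have "inv (t j) \<otimes> (t j \<otimes> inv (t k)) = inv (t k)" using jk by (simp flip: m_assoc)
          then show ?thesis using jk that by (simp add: m_assoc)
        qed
        then have "phi0 (t j \<otimes> l \<otimes> inv (t k)) = \<phi> (t j \<otimes> l \<otimes> inv (t j)) * phi0 (t j \<otimes> inv (t k))"
          using conj_mem that jk by (simp add: phi0_mult)
        then show ?thesis using False t_eq[of j k] jk by (auto simp: phi0_def)
      qed
      have "?P $$ (j, k) =
          (\<Sum>l\<in>L. \<phi> (t i \<otimes> inv l \<otimes> inv (t i)) * phi0 (t j \<otimes> l \<otimes> inv (t k)))"
        using jk by (simp add: ind_rep_def)
      also have "\<dots> = (\<Sum>l\<in>L. if j = k then
          \<phi> (t i \<otimes> inv l \<otimes> inv (t i)) * \<phi> (t j \<otimes> l \<otimes> inv (t j)) else 0)"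
        by (rule sum.cong) (auto simp: offd)
      finally have P: "?P $$ (j, k) = (if j = k then
          (\<Sum>l\<in>L. \<phi> (t i \<otimes> inv l \<otimes> inv (t i)) * \<phi> (t j \<otimes> l \<otimes> inv (t j))) else 0)" by simp
      have conj_mult: "\<phi> (t k \<otimes> (x \<otimes> y) \<otimes> inv (t k)) =
          \<phi> (t k \<otimes> x \<otimes> inv (t k)) * \<phi> (t k \<otimes> y \<otimes> inv (t k))"
        if "x \<in> L" "y \<in> L" "k < d" for x y k
      proof -
        have "inv (t k) \<otimes> (t k \<otimes> y \<otimes> inv (t k)) = y \<otimes> inv (t k)"
          using that by (simp flip: m_assoc)
        then have "t k \<otimes> (x \<otimes> y) \<otimes> inv (t k) =
            (t k \<otimes> x \<otimes> inv (t k)) \<otimes> (t k \<otimes> y \<otimes> inv (t k))"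
          using that by (simp add: m_assoc)
        then show ?thesis using that conj_mem by (simp add: phi_mult)
      qed
      show ?thesis
      proof (cases "j = k \<and> j \<noteq> i")
        case True
        let ?x = "t j \<otimes> inv (t i)"
        have x: "?x \<in> carrier G" "?x \<notin> L" using t_eq[of j i] True jk i by auto
        obtain l' where l': "l' \<in> L" "\<phi> (?x \<otimes> l' \<otimes> inv ?x) \<noteq> \<phi> l'" using sep[OF x] by blast
        \<comment> \<open>Pulled back through \<open>t i\<close>, so that the actions on coordinates
          \<open>i\<close> and \<open>j\<close> take at \<open>l\<close> the two values that
          \<open>sep\<close> makes different.\<close>
        define l where "l = inv (t i) \<otimes> l' \<otimes> t i"
        have l: "l \<in> L" using l' i inv_op_closed1[of "t i" l'] by (simp add: l_def)
        have 1: "t i \<otimes> l \<otimes> inv (t i) = l'"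
          using l' i by (simp add: l_def m_assoc) (simp flip: m_assoc)
        have 2: "t j \<otimes> l \<otimes> inv (t j) = ?x \<otimes> l' \<otimes> inv ?x"
          using l' i jk by (simp add: l_def m_assoc inv_mult_group)
        let ?f = "\<lambda>l. \<phi> (t i \<otimes> inv l \<otimes> inv (t i)) * \<phi> (t j \<otimes> l \<otimes> inv (t j))"
        let ?k = "\<phi> (t i \<otimes> inv l \<otimes> inv (t i)) * \<phi> (t j \<otimes> l \<otimes> inv (t j))"
        have "sum ?f L = 0"
        proof (rule sum_twisted_eq_0)
          show "bij_betw (\<lambda>x. l \<otimes> x) L L"
            using l by (intro bij_betwI[where g = "\<lambda>g. inv l \<otimes> g"]) (auto simp flip: m_assoc)
          show "?f (l \<otimes> x) = ?k * ?f x" if "x \<in> L" for x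
          proof -
            have "?f (l \<otimes> x) = \<phi> (t i \<otimes> (inv x \<otimes> inv l) \<otimes> inv (t i)) *
                \<phi> (t j \<otimes> (l \<otimes> x) \<otimes> inv (t j))" using l that by (simp add: inv_mult_group)
            then show ?thesis using l that i jk by (simp only: conj_mult m_inv_closed) simp
          qed
          show "?k \<noteq> 1"
          proof
            assume k: "?k = 1"
            have "\<phi> (t i \<otimes> (l \<otimes> inv l) \<otimes> inv (t i)) = 1"
              using l i by (simp add: phi_one)
            then have "\<phi> (t i \<otimes> l \<otimes> inv (t i)) * \<phi> (t i \<otimes> inv l \<otimes> inv (t i)) = 1"
              using l i conj_mult[of l "inv l" i] by simp
            with k have "\<phi> (t i \<otimes> l \<otimes> inv (t i)) = \<phi> (t j \<otimes> l \<otimes> inv (t j))"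
              by (metis mult.assoc mult.commute mult.right_neutral)
            then show False using l' unfolding 1 2 by simp
          qed
        qed
        then show ?thesis using P True by simp
      next
        case False
        show ?thesis
        proof (cases "j = k")
          case True
          then have eq: "j = i" "k = i" using False by auto
          have "\<phi> (t i \<otimes> inv l \<otimes> inv (t i)) * \<phi> (t i \<otimes> l \<otimes> inv (t i)) = 1" if "l \<in> L" for l
            using conj_mult[of "inv l" l i] that i by (simp add: phi_one)
          then show ?thesis unfolding P unfolding eq by simp
        next
          case False
          then show ?thesis unfolding P by auto
        qed
      qed
    qed
    have "?P *\<^sub>v v = (of_nat (card L) * v $ i) \<cdot>\<^sub>v unit_vec d i"
    proof (rule eq_vecI)
      fix j assume "j < dim_vec ((of_nat (card L) * v $ i) \<cdot>\<^sub>v unit_vec d i)"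
      then have j: "j < d" by simp
      have "(?P *\<^sub>v v) $ j = (\<Sum>k<d. ?P $$ (j, k) * v $ k)"
        using j vc by (auto simp: scalar_prod_def atLeast0LessThan intro!: sum.cong)
      also have "\<dots> = (\<Sum>k<d. if k = i then (if j = i then of_nat (card L) * v $ i else 0) else 0)"
        by (rule sum.cong) (use j in \<open>auto simp: entry simp del: mat_sum_index\<close>)
      finally show "(?P *\<^sub>v v) $ j = ((of_nat (card L) * v $ i) \<cdot>\<^sub>v unit_vec d i) $ j"
        using i j by simp
    qed simp
    then have "inverse (of_nat (card L) * v $ i) \<cdot>\<^sub>v ((of_nat (card L) * v $ i) \<cdot>\<^sub>v unit_vec d i) \<in> W"
      using \<open>?P *\<^sub>v v \<in> W\<close> W_smult by simp
    then have ei: "unit_vec d i \<in> W"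
      using i cardL by (simp add: smult_smult_assoc field_simps)
    have ej: "unit_vec d j \<in> W" if j: "j < d" for j
    proof -
      \<comment> \<open>This group element carries coordinate line \<open>i\<close> to line
        \<open>j\<close> with coefficient \<open>\<phi> \<one> = 1\<close>.\<close>
      have "ind_rep (inv (t j) \<otimes> t i) *\<^sub>v unit_vec d i = unit_vec d j"
      proof (rule eq_vecI)
        fix k assume "k < dim_vec (unit_vec d j)"
        then have k: "k < d" by simp
        have "t k \<otimes> (inv (t j) \<otimes> t i) \<otimes> inv (t i) = t k \<otimes> inv (t j)"
          using i j k by (simp add: m_assoc)
        moreover have "t k \<otimes> inv (t j) \<in> L \<longleftrightarrow> k = j" using t_eq[of k j] k j by auto
        ultimately show "(ind_rep (inv (t j) \<otimes> t i) *\<^sub>v unit_vec d i) $ k = unit_vec d j $ k"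
          using i j k by (auto simp: ind_rep_def phi0_def phi_one)
      qed (simp add: ind_rep_def)
      then show ?thesis using inv[OF _ ei, of "inv (t j) \<otimes> t i"] i j by simp
    qed
    have "w \<in> W" if w: "w \<in> carrier_vec d" for w
    proof -
      \<comment> \<open>The linear combination \<open>w\<close> of unit vectors is written as one
        sum of matrices applied to \<open>unit_vec d i\<close>, the form that
        \<open>mat_sum_mult_vec_closed\<close> accepts.\<close>
      let ?E = "\<lambda>j. mat d d (\<lambda>(r, s). if r = j \<and> s = i then w $ j else 0)"
      have E: "?E j *\<^sub>v unit_vec d i = w $ j \<cdot>\<^sub>v unit_vec d j" if "j < d" for j
        using that i by (intro eq_vecI) auto
      have "mat_sum d {..<d} ?E *\<^sub>v unit_vec d i \<in> W"
        by (rule mat_sum_mult_vec_closed[OF W _ ei]) (simp_all add: E ej W_smult)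
      moreover have "mat_sum d {..<d} ?E *\<^sub>v unit_vec d i = w"
        using w i by (intro eq_vecI) (auto simp: sum.delta)
      ultimately show ?thesis by simp
    qed
    then show ?thesis using Wc by blast
  qed
  moreover have "0\<^sub>v d \<in> W" if "VectorSpace.subspace class_ring W (module_vec TYPE(complex) d)" for W
    using that by (auto simp: subspace_vec_iff)
  ultimately show ?thesis
    unfolding irreducible_representation_def using ind_rep_representation d by blast
qed

end

text \<open>Mackey's criterion for a normal subgroup: \<open>sep\<close> says that no element
  outside \<open>H\<close> fixes \<open>\<phi>\<close> under conjugation. What remains is to number
  the right cosets and choose representatives.\<close>

lemma (in normal) induced_linear_irreducible:
  assumes finG: "finite (carrier G)"
    and \<phi>: "\<And>x y. x \<in> H \<Longrightarrow> y \<in> H \<Longrightarrow> \<phi> (x \<otimes> y) = \<phi> x * \<phi> y" "\<phi> \<one> = 1"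
    and sep: "\<And>x. x \<in> carrier G \<Longrightarrow> x \<notin> H \<Longrightarrow> \<exists>l\<in>H. \<phi> (x \<otimes> l \<otimes> inv x) \<noteq> \<phi> l"
  shows "induced_function G H \<phi> \<in> irreducible_characters G"
proof -
  have "finite (rcosets H)" using rcosets_finite finG subset by (simp add: RCOSETS_def)
  then obtain e where e: "bij_betw e {..<card (rcosets H)} (rcosets H)"
    by (metis ex_bij_betw_nat_finite atLeast0LessThan)
  define d where "d = card (rcosets H)"
  define t where "t i = (SOME x. x \<in> carrier G \<and> e i = H #> x)" for i
  have t: "t i \<in> carrier G \<and> e i = H #> t i" if "i < d" for i
  proof -
    have "e i \<in> rcosets H" using e that unfolding d_def by (auto simp: bij_betw_def)
    then have "\<exists>x. x \<in> carrier G \<and> e i = H #> x" by (auto simp: RCOSETS_def)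
    from someI_ex[OF this] show ?thesis unfolding t_def .
  qed
  have "induced_linear H G \<phi> d t"
  proof unfold_locales
    show "\<exists>!i. i < d \<and> g \<otimes> inv t i \<in> H" if g: "g \<in> carrier G" for g
    proof -
      have *: "g \<otimes> inv t i \<in> H \<longleftrightarrow> H #> g = e i" if "i < d" for i
      proof -
        have "g \<otimes> inv t i \<in> H \<longleftrightarrow> g \<in> H #> t i"
          using t[OF that] g rcos_module[OF is_group] by blast
        also have "\<dots> \<longleftrightarrow> H #> g = H #> t i"
          using t[OF that] repr_independence[OF _ _ is_subgroup, of g "t i"]
            rcos_self[OF g is_subgroup] by auto
        finally show ?thesis using t[OF that] by simp
      qed
      have "H #> g \<in> rcosets H" using g subset by (auto simp: RCOSETS_def)
      then obtain i where i: "i < d" "e i = H #> g"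
        using e unfolding d_def bij_betw_def by (metis imageE lessThan_iff)
      show ?thesis
      proof (rule ex1I[of _ i])
        show "i < d \<and> g \<otimes> inv t i \<in> H" using i * by simp
        fix j assume j: "j < d \<and> g \<otimes> inv t j \<in> H"
        then have "e j = e i" using i *[of j] by simp
        then show "j = i" using j i e unfolding d_def bij_betw_def inj_on_def by simp
      qed
    qed
  qed (use finG \<phi> t in auto)
  then interpret induced_linear H G \<phi> d t .
  show ?thesis
    unfolding irreducible_characters_def
    using ind_rep_irreducible[OF sep] character_ind_rep by force
qed

subsection \<open>Runs of nonzero entries\<close>

text \<open>Meaningful only if \<open>\<gamma>\<close> vanishes somewhere from \<open>p\<close> on,
  which \<open>supp_below\<close> provides.\<close>

definition run_length :: "(nat \<Rightarrow> 'f::zero) \<Rightarrow> nat \<Rightarrow> nat" where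
  "run_length \<gamma> p = (LEAST k. \<gamma> (p + k) = 0)"

text \<open>For matrices of size \<open>n = m + 1\<close> the second superdiagonal has positions
  \<open>p + 2 < n\<close>, hence \<open>Suc p < m\<close> and not \<open>p < m\<close>.\<close>

definition supp_below :: "nat \<Rightarrow> (nat \<Rightarrow> 'f::zero) \<Rightarrow> bool" where
  "supp_below m \<gamma> \<longleftrightarrow> (\<forall>p. \<gamma> p \<noteq> 0 \<longrightarrow> Suc p < m)"

lemma run_length_eq_0: "\<gamma> p = 0 \<Longrightarrow> run_length \<gamma> p = 0"
  by (simp add: run_length_def)

lemma run_length_Suc:
  assumes "supp_below m \<gamma>" "\<gamma> p \<noteq> 0"
  shows "run_length \<gamma> p = Suc (run_length \<gamma> (Suc p))"
proof -
  have "\<gamma> (p + m) = 0" using assms(1) by (force simp: supp_below_def)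
  then have "(LEAST k. \<gamma> (p + k) = 0) = Suc (LEAST k. \<gamma> (p + Suc k) = 0)"
    using assms(2) by (intro Least_Suc) auto
  then show ?thesis by (simp add: run_length_def)
qed

lemma odd_run_length_nonzero: "odd (run_length \<gamma> p) \<Longrightarrow> \<gamma> p \<noteq> 0"
  using run_length_eq_0[of \<gamma> p] by auto

lemma odd_run_length_Suc:
  assumes "supp_below m \<gamma>" "\<gamma> p \<noteq> 0"
  shows "odd (run_length \<gamma> p) \<longleftrightarrow> even (run_length \<gamma> (Suc p))"
  using run_length_Suc[OF assms] by simp

text \<open>The first coordinates of the blocks of odd size: a run of \<open>r\<close> links joins
  \<open>r + 1\<close> coordinates, so an even run length means an odd block.\<close>

definition run_starts :: "(nat \<Rightarrow> 'f::zero) \<Rightarrow> nat set" where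
  "run_starts \<gamma> = {p. even (run_length \<gamma> p) \<and> (p = 0 \<or> \<gamma> (p - 1) = 0)}"

text \<open>Functionals in normal form. Only the restriction of \<open>\<delta>\<close> to the
  radical affects the character, so \<open>\<delta>\<close> is normalised to be supported at the
  starts of odd blocks.\<close>

definition functional_data :: "nat \<Rightarrow> ((nat \<Rightarrow> 'f::zero) \<times> (nat \<Rightarrow> 'f)) set" where
  "functional_data m =
     {(\<delta>, \<gamma>). supp_below m \<gamma> \<and> (\<forall>p. \<delta> p \<noteq> 0 \<longrightarrow> p < m \<and> p \<in> run_starts \<gamma>)}"

text \<open>The change of the functional under conjugation, see \<open>lam_conj\<close>.\<close>

definition alt_form :: "nat \<Rightarrow> (nat \<Rightarrow> 'f::comm_ring) \<Rightarrow> (nat \<Rightarrow> 'f) \<Rightarrow> (nat \<Rightarrow> 'f) \<Rightarrow> 'f" where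
  "alt_form m \<gamma> x y = (\<Sum>p<m. \<gamma> p * (x p * y (Suc p) - x (Suc p) * y p))"

text \<open>The condition that the coefficient of each \<open>y j\<close> in
  \<open>alt_form m \<gamma> x y\<close> vanishes, see \<open>alt_form_eq\<close>. The case
  \<open>j = 0\<close> is separate because \<open>j - 1\<close> is truncated.\<close>

definition alt_radical :: "nat \<Rightarrow> (nat \<Rightarrow> 'f::comm_ring) \<Rightarrow> (nat \<Rightarrow> 'f) \<Rightarrow> bool" where
  "alt_radical m \<gamma> x \<longleftrightarrow> (\<forall>j<m. (if j = 0 then 0 else \<gamma> (j - 1) * x (j - 1)) = \<gamma> j * x (Suc j))"

lemma alt_form_eq:
  assumes "supp_below m \<gamma>"
  shows "alt_form m \<gamma> x y =
    (\<Sum>j<m. ((if j = 0 then 0 else \<gamma> (j - 1) * x (j - 1)) - \<gamma> j * x (Suc j)) * y j)"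
proof -
  let ?f = "\<lambda>j. (if j = 0 then 0 else \<gamma> (j - 1) * x (j - 1)) * y j"
  \<comment> \<open>Collecting coefficients of \<open>y\<close> shifts the index by one; the extra
    top term carries \<open>\<gamma> (m - 1)\<close>, which is zero by
    \<open>supp_below\<close>.\<close>
  have "?f m = 0" using assms by (cases m) (force simp: supp_below_def)+
  then have "(\<Sum>j<m. ?f j) = sum ?f {..<Suc m}" by simp
  also have "\<dots> = (\<Sum>p<m. \<gamma> p * (x p * y (Suc p)))"
    by (simp only: sum.lessThan_Suc_shift) (simp add: mult.assoc)
  finally show ?thesis
    by (simp add: alt_form_def left_diff_distrib right_diff_distrib sum_subtractf mult.assoc)
qed

lemma alt_form_commute: "alt_form m \<gamma> y x = - alt_form m \<gamma> x y"
  unfolding alt_form_def sum_negf[symmetric] by (rule sum.cong) (auto simp: algebra_simps)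

lemma alt_form_radical:
  "supp_below m \<gamma> \<Longrightarrow> alt_radical m \<gamma> x \<Longrightarrow> alt_form m \<gamma> x y = 0"
  by (auto simp: alt_form_eq alt_radical_def intro!: sum.neutral)

lemma alt_form_scale: "alt_form m \<gamma> x (\<lambda>p. k * y p) = k * alt_form m \<gamma> x y"
  by (auto simp: alt_form_def sum_distrib_left algebra_simps intro!: sum.cong)

lemma not_alt_radical:
  fixes x :: "nat \<Rightarrow> 'f::field"
  assumes "supp_below m \<gamma>" "\<not> alt_radical m \<gamma> x"
  shows "\<exists>y. (\<forall>p\<ge>m. y p = 0) \<and> alt_form m \<gamma> x y \<noteq> 0"
proof -
  obtain j where j: "j < m"
    "(if j = 0 then 0 else \<gamma> (j - 1) * x (j - 1)) \<noteq> \<gamma> j * x (Suc j)"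
    using assms(2) unfolding alt_radical_def by blast
  let ?y = "\<lambda>p. if p = j then 1 else 0 :: 'f"
  have "alt_form m \<gamma> x ?y =
      (\<Sum>p<m. if p = j then (if j = 0 then 0 else \<gamma> (j - 1) * x (j - 1)) - \<gamma> j * x (Suc j) else 0)"
    unfolding alt_form_eq[OF assms(1)] by (rule sum.cong) auto
  also have "\<dots> = (if j = 0 then 0 else \<gamma> (j - 1) * x (j - 1)) - \<gamma> j * x (Suc j)"
    using j(1) by simp
  also have "\<dots> \<noteq> 0" using j(2) by simp
  finally show ?thesis using j(1) by (intro exI[of _ ?y]) auto
qed

text \<open>Induction from the right end of a run: the radical equation at \<open>Suc p\<close> ties
  \<open>x p\<close> to \<open>x (p + 2)\<close>, whose run length is smaller by two, and at the
  last link the right side is zero.\<close>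

lemma alt_radical_odd:
  fixes x :: "nat \<Rightarrow> 'f::field"
  assumes \<gamma>: "supp_below m \<gamma>" and x: "alt_radical m \<gamma> x"
  shows "odd (run_length \<gamma> p) \<Longrightarrow> x p = 0"
proof (induction "run_length \<gamma> p" arbitrary: p rule: less_induct)
  case less
  have nz: "\<gamma> p \<noteq> 0" using odd_run_length_nonzero less.prems .
  then have "Suc p < m" using \<gamma> by (auto simp: supp_below_def)
  then have eq: "\<gamma> p * x p = \<gamma> (Suc p) * x (Suc (Suc p))"
    using x unfolding alt_radical_def by (auto dest!: spec[of _ "Suc p"])
  show ?case
  proof (cases "\<gamma> (Suc p) = 0")
    case True
    then show ?thesis using eq nz by simp
  next
    case False
    then have "run_length \<gamma> p = Suc (Suc (run_length \<gamma> (Suc (Suc p))))"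
      using run_length_Suc[OF \<gamma>] nz by metis
    then show ?thesis using less eq nz by simp
  qed
qed

text \<open>A position of even run length that starts no block has a link on its left, and the
  radical equation at \<open>p - 1\<close> then carries the zero from \<open>p - 2\<close> to
  \<open>p\<close>.\<close>

lemma alt_radical_zero:
  fixes x :: "nat \<Rightarrow> 'f::field"
  assumes \<gamma>: "supp_below m \<gamma>" and x: "alt_radical m \<gamma> x"
    and starts: "\<And>p. p < m \<Longrightarrow> p \<in> run_starts \<gamma> \<Longrightarrow> x p = 0"
  shows "p < m \<Longrightarrow> x p = 0"
proof (induction p rule: less_induct)
  case (less p)
  show ?case
  proof (cases "odd (run_length \<gamma> p) \<or> p \<in> run_starts \<gamma>")
    case True
    then show ?thesis using alt_radical_odd[OF \<gamma> x] starts less.prems by auto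
  next
    case False
    then obtain q where q: "p = Suc q" "\<gamma> q \<noteq> 0"
      by (cases p) (auto simp: run_starts_def)
    have "(if q = 0 then 0 else \<gamma> (q - 1) * x (q - 1)) = \<gamma> q * x p"
      using x less.prems q unfolding alt_radical_def by auto
    moreover have "q \<noteq> 0 \<Longrightarrow> x (q - 1) = 0" using less q by simp
    ultimately show ?thesis using q(2) by (auto split: if_splits)
  qed
qed

text \<open>Division by zero makes this vector vanish beyond the run that begins at \<open>s\<close>.\<close>

fun radical_vec :: "(nat \<Rightarrow> 'f::field) \<Rightarrow> nat \<Rightarrow> nat \<Rightarrow> 'f" where
  "radical_vec \<gamma> s p = (if p < s then 0 else if p = s then 1 else if p = Suc s then 0
     else radical_vec \<gamma> s (p - 2) * \<gamma> (p - 2) / \<gamma> (p - 1))"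

declare radical_vec.simps [simp del]

text \<open>Nonzero entries advance by two inside one run, each time lowering the run length by two,
  so they keep its parity and never reach the start of another block.\<close>

lemma radical_vec_even:
  assumes \<gamma>: "supp_below m \<gamma>" and s: "s \<in> run_starts \<gamma>"
  shows "radical_vec \<gamma> s p \<noteq> 0 \<Longrightarrow> even (run_length \<gamma> p) \<and> (p = s \<or> p \<notin> run_starts \<gamma>)"
proof (induction p rule: less_induct)
  case (less p)
  show ?case
  proof (cases "p = s")
    case True
    then show ?thesis using s by (auto simp: run_starts_def)
  next
    case False
    then have p: "p > Suc s" using less.prems radical_vec.simps[of \<gamma> s p] by (auto split: if_splits)
    then obtain q where q: "p = Suc (Suc q)" "q < p" by (metis Suc_lessE lessI less_Suc_eq)
    have nz: "radical_vec \<gamma> s q \<noteq> 0" "\<gamma> q \<noteq> 0" "\<gamma> (Suc q) \<noteq> 0"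
      using less.prems p q radical_vec.simps[of \<gamma> s p] by auto
    have "run_length \<gamma> q = Suc (Suc (run_length \<gamma> p))"
      using run_length_Suc[OF \<gamma>] nz q by metis
    then show ?thesis using less.IH[OF q(2) nz(1)] nz q by (auto simp: run_starts_def)
  qed
qed

lemma alt_radical_radical_vec:
  assumes \<gamma>: "supp_below m \<gamma>" and s: "s \<in> run_starts \<gamma>"
  shows "alt_radical m \<gamma> (radical_vec \<gamma> s)"
  unfolding alt_radical_def
proof (intro allI impI)
  fix j assume "j < m"
  show "(if j = 0 then 0 else \<gamma> (j - 1) * radical_vec \<gamma> s (j - 1)) = \<gamma> j * radical_vec \<gamma> s (Suc j)"
  proof (cases "j \<le> s")
    case True
    have "radical_vec \<gamma> s (Suc s) = 0" by (simp add: radical_vec.simps)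
    moreover have "Suc j = s \<Longrightarrow> \<gamma> j = 0" using s by (auto simp: run_starts_def)
    ultimately show ?thesis using True
      by (cases "j = s"; cases "Suc j = s") (auto simp: radical_vec.simps)
  next
    case False
    then obtain q where q: "j = Suc q" by (cases j) auto
    show ?thesis
    proof (cases "\<gamma> j = 0")
      case True
      \<comment> \<open>The run ends here: a nonzero entry at \<open>q\<close> would sit at run
        length 1, against \<open>radical_vec_even\<close>.\<close>
      have "radical_vec \<gamma> s q = 0" if "\<gamma> q \<noteq> 0"
      proof (rule ccontr)
        assume "radical_vec \<gamma> s q \<noteq> 0"
        then have "even (run_length \<gamma> q)" using radical_vec_even[OF \<gamma> s] by blast
        then show False using run_length_Suc[OF \<gamma> that] run_length_eq_0[of \<gamma> j] True q by simp
      qed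
      then show ?thesis using True q by auto
    next
      case nz: False
      have "radical_vec \<gamma> s (Suc j) = radical_vec \<gamma> s q * \<gamma> q / \<gamma> j"
        using False q by (subst radical_vec.simps) auto
      then show ?thesis using nz q by simp
    qed
  qed
qed

lemma radical_vec_start: "radical_vec \<gamma> s s = 1"
  by (simp add: radical_vec.simps)

subsection \<open>Additive characters of a finite field\<close>

locale additive_character =
  fixes \<theta> :: "'f::{field, finite} \<Rightarrow> complex"
  assumes nontriv: "nontrivial_additive_character \<theta>"
begin

lemma theta_nonzero [simp]: "\<theta> x \<noteq> 0"
  and theta_add: "\<theta> (x + y) = \<theta> x * \<theta> y"
  using nontriv by (auto simp: nontrivial_additive_character_def)

lemma theta_0 [simp]: "\<theta> 0 = 1"
  using theta_add[of 0 0] by simp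

lemma theta_minus: "\<theta> (- x) = inverse (\<theta> x)"
  using theta_add[of x "- x"] by (simp add: field_simps)

lemma theta_diff: "\<theta> (x - y) = \<theta> x / \<theta> y"
  using theta_add[of x "- y"] by (simp add: theta_minus field_simps)

lemma theta_separates:
  assumes "u \<noteq> 0"
  shows "\<exists>t. \<theta> (t * u) \<noteq> 1"
proof -
  obtain x where "\<theta> x \<noteq> 1" using nontriv by (auto simp: nontrivial_additive_character_def)
  then show ?thesis using assms by (intro exI[of _ "x / u"]) simp
qed

text \<open>Were the conclusion false, the characters \<open>\<omega>\<close> and \<open>\<theta> \<circ> w\<close> would be orthogonal for
  every \<open>w\<close>; but the sum over all \<open>w\<close> of their inner products counts the common kernel.\<close>

lemma character_eq_theta:
  fixes f :: "nat \<Rightarrow> 'g \<Rightarrow> 'f"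
  assumes "group G" and A: "subgroup A G" and finA: "finite A" and finI: "finite I"
    and \<omega>_mult: "\<And>x y. x \<in> A \<Longrightarrow> y \<in> A \<Longrightarrow> \<omega> (x \<otimes>\<^bsub>G\<^esub> y) = \<omega> x * (\<omega> y :: complex)"
    and f_add: "\<And>p x y. p \<in> I \<Longrightarrow> x \<in> A \<Longrightarrow> y \<in> A \<Longrightarrow> f p (x \<otimes>\<^bsub>G\<^esub> y) = f p x + f p y"
    and \<omega>_triv: "\<And>x. x \<in> A \<Longrightarrow> (\<And>p. p \<in> I \<Longrightarrow> f p x = 0) \<Longrightarrow> \<omega> x = 1"
  shows "\<exists>w. (\<forall>p. p \<notin> I \<longrightarrow> w p = 0) \<and> (\<forall>x\<in>A. \<omega> x = \<theta> (\<Sum>p\<in>I. w p * f p x))"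
proof (rule ccontr)
  interpret group G by fact
  interpret A: subgroup A G by fact
  define W where "W = {w :: nat \<Rightarrow> 'f. \<forall>p. p \<notin> I \<longrightarrow> w p = 0}"
  define K where "K = {x \<in> A. \<forall>p\<in>I. f p x = 0}"
  define e where "e w x = (\<Sum>p\<in>I. w p * f p x)" for w x
  have "finite {w :: nat \<Rightarrow> 'f. \<forall>p. (p \<in> I \<longrightarrow> w p \<in> UNIV) \<and> (p \<notin> I \<longrightarrow> w p = 0)}"
    using finI by (intro finite_set_of_finite_funs) auto
  then have finW: "finite W" by (simp add: W_def)
  have W0: "(\<lambda>p. 0) \<in> W" by (simp add: W_def)
  assume "\<nexists>w. (\<forall>p. p \<notin> I \<longrightarrow> w p = 0) \<and> (\<forall>x\<in>A. \<omega> x = \<theta> (\<Sum>p\<in>I. w p * f p x))"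
  then have ne: "\<exists>y\<in>A. \<omega> y \<noteq> \<theta> (e w y)" if "w \<in> W" for w
    using that unfolding W_def e_def by blast
  have orth: "(\<Sum>x\<in>A. \<omega> x * \<theta> (- e w x)) = 0" if w: "w \<in> W" for w
  proof -
    obtain y where y: "y \<in> A" "\<omega> y \<noteq> \<theta> (e w y)" using ne[OF w] by blast
    show ?thesis
    proof (rule sum_twisted_eq_0)
      show "bij_betw (\<lambda>x. y \<otimes>\<^bsub>G\<^esub> x) A A"
        using y(1) by (intro bij_betwI[where g = "\<lambda>x. inv\<^bsub>G\<^esub> y \<otimes>\<^bsub>G\<^esub> x"]) (auto simp flip: m_assoc)
      show "\<omega> (y \<otimes>\<^bsub>G\<^esub> x) * \<theta> (- e w (y \<otimes>\<^bsub>G\<^esub> x)) = (\<omega> y * \<theta> (- e w y)) * (\<omega> x * \<theta> (- e w x))"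
        if "x \<in> A" for x
      proof -
        have "e w (y \<otimes>\<^bsub>G\<^esub> x) = e w y + e w x"
          using y(1) that f_add by (simp add: e_def distrib_left sum.distrib)
        then show ?thesis using y(1) that \<omega>_mult by (simp add: theta_minus theta_diff field_simps)
      qed
      show "\<omega> y * \<theta> (- e w y) \<noteq> 1" using y(2) by (simp add: theta_minus field_simps)
    qed
  qed
  have inner: "(\<Sum>w\<in>W. \<theta> (- e w x)) = (if x \<in> K then of_nat (card W) else 0)" if x: "x \<in> A" for x
  proof (cases "x \<in> K")
    case True
    then show ?thesis by (simp add: K_def e_def)
  next
    case False
    then obtain p where p: "p \<in> I" "f p x \<noteq> 0" using x by (auto simp: K_def)
    obtain t where t: "\<theta> (t * - f p x) \<noteq> 1" using theta_separates[of "- f p x"] p(2) by auto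
    have "(\<Sum>w\<in>W. \<theta> (- e w x)) = 0"
    proof (rule sum_twisted_eq_0)
      \<comment> \<open>Shifting one coefficient, at a coordinate where \<open>x\<close> is nonzero,
        multiplies every term by the same value different from 1.\<close>
      show "bij_betw (\<lambda>w. w(p := w p + t)) W W"
        using p(1) by (intro bij_betwI[where g = "\<lambda>w. w(p := w p - t)"]) (auto simp: W_def)
      show "\<theta> (- e (w(p := w p + t)) x) = \<theta> (t * - f p x) * \<theta> (- e w x)" for w
      proof -
        have "e (w(p := w p + t)) x = (\<Sum>q\<in>I. w q * f q x + (if q = p then t * f p x else 0))"
          unfolding e_def by (rule sum.cong) (auto simp: distrib_right)
        also have "\<dots> = e w x + t * f p x" using p(1) finI by (simp add: sum.distrib e_def)
        finally show ?thesis by (simp add: theta_minus theta_diff field_simps)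
      qed
    qed (use t in auto)
    then show ?thesis using False by simp
  qed
  have "0 = (\<Sum>w\<in>W. \<Sum>x\<in>A. \<omega> x * \<theta> (- e w x))" using orth by simp
  also have "\<dots> = (\<Sum>x\<in>A. \<Sum>w\<in>W. \<omega> x * \<theta> (- e w x))" by (rule sum.swap)
  also have "\<dots> = (\<Sum>x\<in>A. if x \<in> K then of_nat (card W) else 0)"
  proof (rule sum.cong)
    fix x assume x: "x \<in> A"
    have "x \<in> K \<Longrightarrow> \<omega> x = 1" using \<omega>_triv x by (auto simp: K_def)
    then show "(\<Sum>w\<in>W. \<omega> x * \<theta> (- e w x)) = (if x \<in> K then of_nat (card W) else 0)"
      using inner[OF x] by (simp flip: sum_distrib_left)
  qed simp
  also have "\<dots> = of_nat (card W * card K)"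
    using finA by (simp add: sum.If_cases Int_def K_def conj_commute)
  finally have "card W * card K = 0" by (metis of_nat_eq_0_iff)
  moreover have "\<one>\<^bsub>G\<^esub> \<in> K"
  proof -
    have "f p \<one>\<^bsub>G\<^esub> = 0" if "p \<in> I" for p using f_add[OF that A.one_closed A.one_closed]
      by (metis add_cancel_right_right one_closed r_one)
    then show ?thesis by (simp add: K_def)
  qed
  moreover have "finite K" using finA by (simp add: K_def)
  ultimately show False using finW W0 by (auto simp: card_eq_0_iff)
qed

end

subsection \<open>Groups extending a Heisenberg group\<close>

text \<open>The quotient by \<open>U3\<close> is the set of pairs \<open>(a, c)\<close> with the multiplication below; for
  unitriangular matrices, \<open>a\<close> and \<open>c\<close> are the first two superdiagonals.\<close>

locale heis_group = group G + additive_character \<theta>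
  for G (structure) and \<theta> :: "'f::{field, finite} \<Rightarrow> complex" +
  fixes m :: nat and a c :: "nat \<Rightarrow> 'a \<Rightarrow> 'f"
  assumes finG: "finite (carrier G)"
    and a_mult: "g \<in> carrier G \<Longrightarrow> h \<in> carrier G \<Longrightarrow> a p (g \<otimes> h) = a p g + a p h"
    and c_mult: "g \<in> carrier G \<Longrightarrow> h \<in> carrier G \<Longrightarrow>
      c p (g \<otimes> h) = c p g + c p h + a p g * a (Suc p) h"
    and a_out: "p \<ge> m \<Longrightarrow> a p g = 0"
    and c_out: "Suc p \<ge> m \<Longrightarrow> c p g = 0"
    and surj: "\<exists>g\<in>carrier G. (\<forall>p<m. a p g = x p) \<and> (\<forall>p. Suc p < m \<longrightarrow> c p g = y p)"
begin

lemma a_one: "a p \<one> = 0"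
  using a_mult[of \<one> \<one> p] by (metis add_cancel_right_right one_closed r_one)

lemma c_one: "c p \<one> = 0"
  using c_mult[of \<one> \<one> p]
  by (metis add_cancel_right_right one_closed r_one a_one mult_zero_left)

lemma a_inv: "g \<in> carrier G \<Longrightarrow> a p (inv g) = - a p g"
  using a_mult[of g "inv g" p] by (simp add: a_one add_eq_0_iff)

lemma a_conj: "x \<in> carrier G \<Longrightarrow> g \<in> carrier G \<Longrightarrow> a p (x \<otimes> g \<otimes> inv x) = a p g"
  by (simp add: a_mult a_inv)

text \<open>Comparing \<open>c\<close> on both sides of \<open>(x g x^-1) x = x g\<close> avoids a
  formula for \<open>c p (inv x)\<close>.\<close>

lemma c_conj:
  assumes "x \<in> carrier G" "g \<in> carrier G"
  shows "c p (x \<otimes> g \<otimes> inv x) = c p g + (a p x * a (Suc p) g - a (Suc p) x * a p g)"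
proof -
  have "x \<otimes> g \<otimes> inv x \<otimes> x = x \<otimes> g" using assms by (simp add: m_assoc)
  then have "c p (x \<otimes> g \<otimes> inv x \<otimes> x) = c p (x \<otimes> g)" by simp
  then show ?thesis
    using assms c_mult[of "x \<otimes> g \<otimes> inv x" x p] c_mult[of x g p] a_conj[OF assms]
    by (simp add: algebra_simps)
qed

lemma ex_element:
  assumes "\<forall>p\<ge>m. x p = 0" "\<forall>p. Suc p \<ge> m \<longrightarrow> y p = 0"
  shows "\<exists>g\<in>carrier G. (\<lambda>p. a p g) = x \<and> (\<lambda>p. c p g) = y"
proof -
  obtain g where g: "g \<in> carrier G" "\<forall>p<m. a p g = x p" "\<forall>p. Suc p < m \<longrightarrow> c p g = y p"
    using surj[of x y] by blast
  have "a p g = x p" for p using g(2) assms(1) a_out[of p g] by (cases "p < m") auto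
  moreover have "c p g = y p" for p using g(3) assms(2) c_out[of p g] by (cases "Suc p < m") auto
  ultimately show ?thesis using g(1) by blast
qed

section \<open>Subgroups and characters attached to a functional\<close>

definition U2 :: "'a set" where "U2 = {g \<in> carrier G. \<forall>p. a p g = 0}"

definition U3 :: "'a set" where "U3 = {g \<in> carrier G. \<forall>p. a p g = 0 \<and> c p g = 0}"

definition L :: "(nat \<Rightarrow> 'f) \<Rightarrow> 'a set" where
  "L \<gamma> = {g \<in> carrier G. \<forall>p. odd (run_length \<gamma> p) \<longrightarrow> a p g = 0}"

definition Z :: "(nat \<Rightarrow> 'f) \<Rightarrow> 'a set" where
  "Z \<gamma> = {g \<in> carrier G. alt_radical m \<gamma> (\<lambda>p. a p g)}"

definition lam :: "(nat \<Rightarrow> 'f) \<Rightarrow> (nat \<Rightarrow> 'f) \<Rightarrow> 'a \<Rightarrow> 'f" where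
  "lam \<delta> \<gamma> g = (\<Sum>p<m. \<delta> p * a p g) + (\<Sum>p<m. \<gamma> p * c p g)"

definition heis_char :: "(nat \<Rightarrow> 'f) \<Rightarrow> (nat \<Rightarrow> 'f) \<Rightarrow> 'a \<Rightarrow> complex" where
  "heis_char \<delta> \<gamma> = induced_function G (L \<gamma>) (\<lambda>g. \<theta> (lam \<delta> \<gamma> g))"

lemma L_closed: "g \<in> L \<gamma> \<Longrightarrow> g \<in> carrier G"
  and Z_closed: "g \<in> Z \<gamma> \<Longrightarrow> g \<in> carrier G"
  and U2_closed: "g \<in> U2 \<Longrightarrow> g \<in> carrier G"
  and U3_closed: "g \<in> U3 \<Longrightarrow> g \<in> carrier G"
  by (auto simp: L_def Z_def U2_def U3_def)

lemma normalI_conj: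
  assumes "subgroup N G" "\<And>x g. x \<in> carrier G \<Longrightarrow> g \<in> N \<Longrightarrow> x \<otimes> g \<otimes> inv x \<in> N"
  shows "N \<lhd> G"
  using assms by (auto simp: normal_inv_iff)

lemma L_normal: "L \<gamma> \<lhd> G"
  by (intro normalI_conj subgroupI)
    (auto simp: L_def a_mult a_inv a_conj a_one intro: exI[of _ \<one>])

lemma U2_normal: "U2 \<lhd> G"
  by (intro normalI_conj subgroupI)
    (auto simp: U2_def a_mult a_inv a_conj a_one intro: exI[of _ \<one>])

lemma Z_normal: "Z \<gamma> \<lhd> G"
proof (intro normalI_conj subgroupI)
  show "Z \<gamma> \<noteq> {}" by (auto simp: Z_def alt_radical_def a_one intro!: exI[of _ \<one>])
  show "x \<otimes> y \<in> Z \<gamma>" if "x \<in> Z \<gamma>" "y \<in> Z \<gamma>" for x y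
  proof -
    have *: "(if j = 0 then 0 else \<gamma> (j - 1) * (a (j - 1) x + a (j - 1) y)) =
        \<gamma> j * (a (Suc j) x + a (Suc j) y)" if "j < m" for j
    proof -
      have "(if j = 0 then 0 else \<gamma> (j - 1) * a (j - 1) x) = \<gamma> j * a (Suc j) x"
        "(if j = 0 then 0 else \<gamma> (j - 1) * a (j - 1) y) = \<gamma> j * a (Suc j) y"
        using \<open>x \<in> Z \<gamma>\<close> \<open>y \<in> Z \<gamma>\<close> that by (simp_all add: Z_def alt_radical_def)
      then show ?thesis by (cases "j = 0") (auto simp: distrib_left)
    qed
    show ?thesis
      unfolding Z_def alt_radical_def mem_Collect_eq a_mult[OF that[THEN Z_closed]]
      using * that[THEN Z_closed] by blast
  qed
qed (auto simp: Z_def alt_radical_def a_inv a_conj)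

lemma c_inv_U2: "g \<in> U2 \<Longrightarrow> c p (inv g) = - c p g"
  using c_mult[of g "inv g" p] by (simp add: U2_def c_one add_eq_0_iff)

lemma U3_normal: "U3 \<lhd> G"
proof (intro normalI_conj subgroupI)
  show "U3 \<noteq> {}" by (auto simp: U3_def a_one c_one intro!: exI[of _ \<one>])
  show "inv g \<in> U3" if "g \<in> U3" for g
    using that c_inv_U2[of g] by (auto simp: U3_def U2_def a_inv)
  show "x \<otimes> g \<otimes> inv x \<in> U3" if "x \<in> carrier G" "g \<in> U3" for x g
    using that a_conj[of x g] c_conj[of x g] by (simp add: U3_def)
qed (auto simp: U3_def a_mult c_mult)

lemma U3_subset_U2: "U3 \<subseteq> U2"
  by (auto simp: U2_def U3_def)

lemma U2_subset_Z: "U2 \<subseteq> Z \<gamma>"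
  by (auto simp: U2_def Z_def alt_radical_def)

lemma Z_subset_L: "supp_below m \<gamma> \<Longrightarrow> Z \<gamma> \<subseteq> L \<gamma>"
  by (auto simp: Z_def L_def dest: alt_radical_odd)

lemma lam_one: "lam \<delta> \<gamma> \<one> = 0"
  by (simp add: lam_def a_one c_one)

text \<open>The obstruction is the cross term \<open>\<gamma> p * a p g * a (Suc p) h\<close>. If
  \<open>\<gamma> p\<close> is nonzero, one of \<open>p\<close> and \<open>Suc p\<close> has odd run
  length, where elements of \<open>L \<gamma>\<close> vanish. Thus \<open>\<theta>\<close> of the
  functional is a linear character of \<open>L \<gamma>\<close>.\<close>

lemma lam_mult:
  assumes \<gamma>: "supp_below m \<gamma>" and gh: "g \<in> L \<gamma>" "h \<in> L \<gamma>"
  shows "lam \<delta> \<gamma> (g \<otimes> h) = lam \<delta> \<gamma> g + lam \<delta> \<gamma> h"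
proof -
  have "\<gamma> p * c p (g \<otimes> h) = \<gamma> p * c p g + \<gamma> p * c p h" for p
  proof (cases "\<gamma> p = 0")
    case False
    then have "odd (run_length \<gamma> p) \<or> odd (run_length \<gamma> (Suc p))"
      using odd_run_length_Suc[OF \<gamma>] by blast
    then have "a p g * a (Suc p) h = 0" using gh by (auto simp: L_def)
    then show ?thesis using gh by (simp add: c_mult L_closed distrib_left)
  qed simp
  moreover have "\<delta> p * a p (g \<otimes> h) = \<delta> p * a p g + \<delta> p * a p h" for p
    using gh by (simp add: a_mult L_closed distrib_left)
  ultimately show ?thesis by (simp add: lam_def sum.distrib)
qed

lemma lam_conj:
  assumes "x \<in> carrier G" "g \<in> carrier G"
  shows "lam \<delta> \<gamma> (x \<otimes> g \<otimes> inv x) =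
    lam \<delta> \<gamma> g + alt_form m \<gamma> (\<lambda>p. a p x) (\<lambda>p. a p g)"
  using assms by (simp add: lam_def a_conj c_conj alt_form_def distrib_left sum.distrib)

text \<open>Take the last \<open>p\<close> of odd run length with \<open>a p x\<close> nonzero and
  let \<open>l\<close> have the single coordinate \<open>t\<close> at \<open>Suc p\<close>. The
  pairing also involves \<open>a (p + 2) x\<close>, but if \<open>\<gamma> (Suc p)\<close> is
  nonzero then \<open>p + 2\<close> has odd run length too, so maximality removes that term.\<close>

lemma separated:
  assumes \<gamma>: "supp_below m \<gamma>" and x: "x \<in> carrier G" "x \<notin> L \<gamma>"
  shows "\<exists>l\<in>L \<gamma>. \<theta> (lam \<delta> \<gamma> (x \<otimes> l \<otimes> inv x)) \<noteq> \<theta> (lam \<delta> \<gamma> l)"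
proof -
  define Q where "Q = {p. odd (run_length \<gamma> p) \<and> a p x \<noteq> 0}"
  have "Q \<subseteq> {..m}" using a_out by (auto simp: Q_def) (meson le_cases)
  then have finQ: "finite Q" using finite_subset by blast
  have "Q \<noteq> {}" using x by (auto simp: Q_def L_def)
  define p where "p = Max Q"
  have p: "odd (run_length \<gamma> p)" "a p x \<noteq> 0"
    using Max_in[OF finQ \<open>Q \<noteq> {}\<close>] by (auto simp: p_def Q_def)
  have nz: "\<gamma> p \<noteq> 0" using odd_run_length_nonzero p(1) .
  have pm: "Suc p < m" using nz \<gamma> by (auto simp: supp_below_def)
  have ev: "even (run_length \<gamma> (Suc p))" using odd_run_length_Suc[OF \<gamma> nz] p(1) by simp
  have far: "\<gamma> (Suc p) * a (Suc (Suc p)) x = 0"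
  proof (rule ccontr)
    assume *: "\<gamma> (Suc p) * a (Suc (Suc p)) x \<noteq> 0"
    then have "odd (run_length \<gamma> (Suc (Suc p)))" using odd_run_length_Suc[OF \<gamma>, of "Suc p"] ev by auto
    then have "Suc (Suc p) \<in> Q" using * by (auto simp: Q_def)
    then show False using Max_ge[OF finQ, of "Suc (Suc p)"] by (simp add: p_def)
  qed
  obtain t where t: "\<theta> (t * (\<gamma> p * a p x)) \<noteq> 1"
    using theta_separates[of "\<gamma> p * a p x"] nz p(2) by auto
  let ?y = "\<lambda>q. if q = Suc p then t else 0"
  obtain l where l: "l \<in> carrier G" "(\<lambda>p. a p l) = ?y"
    using ex_element[of ?y "\<lambda>_. 0"] pm by auto
  have al: "a q l = ?y q" for q using l(2) by (rule fun_cong)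
  have lL: "l \<in> L \<gamma>" using l(1) ev by (auto simp: L_def al)
  have "alt_form m \<gamma> (\<lambda>p. a p x) ?y =
      (\<Sum>j<m. if j = Suc p then (\<gamma> p * a p x - \<gamma> (Suc p) * a (Suc (Suc p)) x) * t else 0)"
    unfolding alt_form_eq[OF \<gamma>] by (rule sum.cong) auto
  also have "\<dots> = t * (\<gamma> p * a p x)" using pm far by (simp add: mult.commute)
  finally have "lam \<delta> \<gamma> (x \<otimes> l \<otimes> inv x) = lam \<delta> \<gamma> l + t * (\<gamma> p * a p x)"
    using lam_conj[OF x(1) l(1)] l(2) by simp
  then show ?thesis using t lL by (intro bexI[of _ l]) (auto simp: theta_add)
qed

lemma heis_char_irreducible:
  assumes "supp_below m \<gamma>"
  shows "heis_char \<delta> \<gamma> \<in> irreducible_characters G"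
  unfolding heis_char_def
  using assms separated
  by (intro normal.induced_linear_irreducible[OF L_normal finG])
    (auto simp: lam_mult theta_add lam_one)

text \<open>The form vanishes on the radical, so all conjugates of \<open>z\<close> give the same
  summand in the induced function; the common factor is absorbed into the value at
  \<open>\<one>\<close>.\<close>

lemma heis_char_Z:
  assumes \<gamma>: "supp_below m \<gamma>" and z: "z \<in> Z \<gamma>"
  shows "heis_char \<delta> \<gamma> z = heis_char \<delta> \<gamma> \<one> * \<theta> (lam \<delta> \<gamma> z)"
proof -
  have "heis_char \<delta> \<gamma> z = of_nat (card (carrier G)) / of_nat (card (L \<gamma>)) * \<theta> (lam \<delta> \<gamma> z)"
    if z: "z \<in> Z \<gamma>" for z
  proof -
    have "x \<otimes> z \<otimes> inv x \<in> L \<gamma> \<and> lam \<delta> \<gamma> (x \<otimes> z \<otimes> inv x) = lam \<delta> \<gamma> z" if x: "x \<in> carrier G" for x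
    proof
      show "x \<otimes> z \<otimes> inv x \<in> L \<gamma>"
        using normal.inv_op_closed2[OF Z_normal x z] Z_subset_L[OF \<gamma>] by blast
      have "alt_form m \<gamma> (\<lambda>p. a p x) (\<lambda>p. a p z) = - alt_form m \<gamma> (\<lambda>p. a p z) (\<lambda>p. a p x)"
        by (rule alt_form_commute)
      also have "\<dots> = 0" using z alt_form_radical[OF \<gamma>] by (simp add: Z_def)
      finally show "lam \<delta> \<gamma> (x \<otimes> z \<otimes> inv x) = lam \<delta> \<gamma> z"
        using lam_conj[OF x Z_closed[OF z]] by simp
    qed
    then show ?thesis
      using Z_closed[OF z] by (simp add: heis_char_def induced_function_def Let_def)
  qed
  from this[OF z] this[of \<one>] show ?thesis
    using subgroup.one_closed[OF normal_imp_subgroup[OF Z_normal]] by (simp add: lam_one)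
qed

lemma heis_char_U3:
  assumes "supp_below m \<gamma>" "u \<in> U3"
  shows "heis_char \<delta> \<gamma> u = heis_char \<delta> \<gamma> \<one>"
proof -
  have "lam \<delta> \<gamma> u = 0" using assms(2) by (simp add: U3_def lam_def)
  then show ?thesis
    using heis_char_Z[OF assms(1), of u \<delta>] subsetD[OF U3_subset_U2 assms(2)] U2_subset_Z[of \<gamma>] by auto
qed

section \<open>Recovering the functional from values on \<open>Z\<close>\<close>

lemma gamma_unique:
  assumes \<gamma>: "supp_below m \<gamma>" "supp_below m \<gamma>'"
    and eq: "\<And>g. g \<in> U2 \<Longrightarrow> \<theta> (lam \<delta> \<gamma> g) = \<theta> (lam \<delta>' \<gamma>' g)"
  shows "\<gamma> = \<gamma>'"
proof (rule ext, rule ccontr)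
  fix p assume ne: "\<gamma> p \<noteq> \<gamma>' p"
  then have pm: "Suc p < m" using \<gamma> by (metis supp_below_def)
  obtain t where t: "\<theta> (t * (\<gamma> p - \<gamma>' p)) \<noteq> 1" using theta_separates[of "\<gamma> p - \<gamma>' p"] ne by auto
  \<comment> \<open>An element of \<open>U2\<close> with the single coordinate \<open>t\<close> at
    \<open>p\<close> reads off \<open>\<gamma> p\<close> alone.\<close>
  let ?y = "\<lambda>q. if q = p then t else 0"
  obtain g where g: "g \<in> carrier G" "(\<lambda>p. a p g) = (\<lambda>_. 0)" "(\<lambda>p. c p g) = ?y"
    using ex_element[of "\<lambda>_. 0" ?y] pm by auto
  have "lam \<epsilon> \<mu> g = \<mu> p * t" for \<epsilon> \<mu>
  proof -
    have "lam \<epsilon> \<mu> g = (\<Sum>q<m. if q = p then \<mu> p * t else 0)"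
      using fun_cong[OF g(2)] fun_cong[OF g(3)]
      by (auto simp: lam_def if_distrib[of "\<lambda>x. _ * x"] cong: if_cong)
    then show ?thesis using pm by simp
  qed
  moreover have "g \<in> U2" using g(1) fun_cong[OF g(2)] by (simp add: U2_def)
  ultimately have "\<theta> (\<gamma> p * t - \<gamma>' p * t) = 1" using eq[of g] by (simp add: theta_diff)
  then show False using t by (simp add: algebra_simps)
qed

text \<open>The multiples of \<open>radical_vec \<gamma> s\<close> test \<open>\<delta> s\<close>
  alone: among the starts of odd blocks, the only places where \<open>\<delta>\<close> may be
  nonzero, that vector is nonzero only at \<open>s\<close>.\<close>

lemma delta_unique:
  assumes \<delta>: "(\<delta>, \<gamma>) \<in> functional_data m" "(\<delta>', \<gamma>) \<in> functional_data m"
    and eq: "\<And>g. g \<in> Z \<gamma> \<Longrightarrow> \<theta> (lam \<delta> \<gamma> g) = \<theta> (lam \<delta>' \<gamma> g)"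
  shows "\<delta> = \<delta>'"
proof (rule ext, rule ccontr)
  fix s assume ne: "\<delta> s \<noteq> \<delta>' s"
  then have s: "s < m" "s \<in> run_starts \<gamma>" using \<delta> by (auto simp: functional_data_def) metis+
  have \<gamma>: "supp_below m \<gamma>" using \<delta> by (simp add: functional_data_def)
  obtain t where t: "\<theta> (t * (\<delta> s - \<delta>' s)) \<noteq> 1" using theta_separates[of "\<delta> s - \<delta>' s"] ne by auto
  \<comment> \<open>The cut-off at \<open>m\<close> lets \<open>ex_element\<close> apply and
    disturbs no radical equation, since \<open>\<gamma> j = 0\<close> once
    \<open>Suc j \<ge> m\<close>.\<close>
  let ?x = "\<lambda>p. if p < m then t * radical_vec \<gamma> s p else 0"
  obtain g where g: "g \<in> carrier G" "(\<lambda>p. a p g) = ?x" using ex_element[of ?x "\<lambda>_. 0"] by auto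
  have ag: "a p g = ?x p" for p using g(2) by (rule fun_cong)
  have "alt_radical m \<gamma> (\<lambda>p. a p g)"
    unfolding alt_radical_def
  proof (intro allI impI)
    fix j assume j: "j < m"
    have "t * (if j = 0 then 0 else \<gamma> (j - 1) * radical_vec \<gamma> s (j - 1)) =
        t * (\<gamma> j * radical_vec \<gamma> s (Suc j))"
      using alt_radical_radical_vec[OF \<gamma> s(2)] j unfolding alt_radical_def by simp
    moreover have "\<not> Suc j < m \<Longrightarrow> \<gamma> j = 0" using \<gamma> by (auto simp: supp_below_def)
    ultimately show "(if j = 0 then 0 else \<gamma> (j - 1) * a (j - 1) g) = \<gamma> j * a (Suc j) g"
      using j by (cases "Suc j < m"; cases "j = 0") (auto simp: ag)
  qed
  then have "g \<in> Z \<gamma>" using g(1) by (simp add: Z_def)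
  moreover have "(\<Sum>p<m. \<epsilon> p * a p g) = \<epsilon> s * t" if "(\<epsilon>, \<gamma>) \<in> functional_data m" for \<epsilon>
  proof -
    have "\<epsilon> p * a p g = (if p = s then \<epsilon> s * t else 0)" if "p < m" for p
    proof (cases "\<epsilon> p = 0 \<or> p = s")
      case True
      then show ?thesis using that by (auto simp: ag radical_vec_start)
    next
      case False
      then have "p \<in> run_starts \<gamma>" using \<open>(\<epsilon>, \<gamma>) \<in> functional_data m\<close> by (auto simp: functional_data_def)
      then have "radical_vec \<gamma> s p = 0" using radical_vec_even[OF \<gamma> s(2), of p] False by blast
      then show ?thesis using that False by (simp add: ag)
    qed
    then show ?thesis using s(1) by simp
  qed
  ultimately have "\<theta> (\<delta> s * t - \<delta>' s * t) = 1"
    using eq[of g] \<delta> by (simp add: lam_def theta_diff theta_add)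
  then show False using t by (simp add: algebra_simps)
qed

section \<open>Commutators and the classification of irreducible characters\<close>

lemma commutator_in_U2:
  assumes "h \<in> carrier G" "k \<in> carrier G"
  shows "h \<otimes> k \<otimes> inv h \<otimes> inv k \<in> U2"
  using assms by (simp add: U2_def a_mult a_inv)

lemma commutator_in_U3:
  assumes h: "h \<in> carrier G" and k: "k \<in> U2"
  shows "h \<otimes> k \<otimes> inv h \<otimes> inv k \<in> U3"
proof -
  have kc: "k \<in> carrier G" using k U2_closed by blast
  have "c p (h \<otimes> k \<otimes> inv h) = c p k" for p
    using c_conj[OF h kc] k by (simp add: U2_def)
  moreover have "a p (h \<otimes> k \<otimes> inv h) = 0" for p using a_conj[OF h kc] k by (simp add: U2_def)
  ultimately show ?thesis
    using h k kc c_inv_U2[OF k] by (simp add: U3_def a_mult[of _ "inv k"] c_mult[of _ "inv k"] a_inv U2_def)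
qed

lemma commutator_subgroup_subset_U3:
  "commutator_subgroup G (carrier G) (derived G (carrier G)) \<subseteq> U3"
proof -
  have "derived G (carrier G) \<subseteq> U2"
    unfolding derived_def
    by (intro generate_subgroup_incl normal_imp_subgroup[OF U2_normal]) (use commutator_in_U2 in auto)
  then show ?thesis
    unfolding commutator_subgroup_def
    by (intro generate_subgroup_incl normal_imp_subgroup[OF U3_normal]) (use commutator_in_U3 in blast)
qed

text \<open>A Stone-von Neumann argument: the scalars by which \<open>U2\<close> acts give
  \<open>\<gamma>\<close>, the resulting commutator pairing makes the trace vanish off
  \<open>Z \<gamma>\<close> and makes \<open>Z \<gamma>\<close> act by scalars, those scalars give
  \<open>\<delta>\<close>, and the norm relation gives the degree.\<close>

lemma irrep_classified:
  assumes irr: "irrep G d \<rho>" and U3: "\<And>u. u \<in> U3 \<Longrightarrow> character_of G \<rho> u = of_nat d"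
  shows "\<exists>\<delta> \<gamma>. (\<delta>, \<gamma>) \<in> functional_data m \<and>
    (\<forall>z\<in>Z \<gamma>. character_of G \<rho> z = of_nat d * \<theta> (lam \<delta> \<gamma> z)) \<and>
    (\<forall>g\<in>carrier G - Z \<gamma>. character_of G \<rho> g = 0) \<and>
    d\<^sup>2 * card (Z \<gamma>) = card (carrier G)"
proof -
  interpret irrep G d \<rho> by fact
  have d: "of_nat d \<noteq> (0 :: complex)" using dim_pos by simp
  \<comment> \<open>\<open>\<rho>\<close> depends only on the coordinates \<open>a\<close> and
    \<open>c\<close>, because \<open>U3\<close> acts trivially.\<close>
  have rep_cong: "\<rho> g = \<rho> h"
    if gh: "g \<in> carrier G" "h \<in> carrier G" "\<And>p. a p g = a p h" "\<And>p. c p g = c p h" for g h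
  proof -
    have k: "g \<otimes> inv h \<in> carrier G" "g = g \<otimes> inv h \<otimes> h" using gh by (simp_all add: m_assoc)
    have "a p g = a p (g \<otimes> inv h) + a p h" for p using a_mult[of "g \<otimes> inv h" h p] k gh by simp
    then have ak: "a p (g \<otimes> inv h) = 0" for p using gh(3)[of p] by simp
    have "c p g = c p (g \<otimes> inv h) + c p h" for p
      using c_mult[of "g \<otimes> inv h" h p] k gh ak by simp
    then have "g \<otimes> inv h \<in> U3" using gh(4) ak k by (simp add: U3_def)
    then have "\<rho> (g \<otimes> inv h) = 1\<^sub>m d" using trivial_on_normal_subgroup[OF U3_normal U3] by blast
    then show ?thesis using rep_mult[of "g \<otimes> inv h" h] k gh left_mult_one_mat[OF rep_carrier[of h]]
      by simp
  qed
  have scalar: "\<rho> z = (character_of G \<rho> z / of_nat d) \<cdot>\<^sub>m 1\<^sub>m d"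
    if z: "z \<in> carrier G" "\<And>g. g \<in> carrier G \<Longrightarrow> \<rho> (z \<otimes> g) = \<rho> (g \<otimes> z)" for z
  proof -
    obtain k where k: "\<rho> z = k \<cdot>\<^sub>m 1\<^sub>m d"
      using schur[of "\<rho> z"] z by (auto simp: rep_mult)
    then have "character_of G \<rho> z = of_nat d * k" using z by (simp add: character_eq mat_trace_smult_one)
    then show ?thesis using k d by simp
  qed
  have scalar_mult: "character_of G \<rho> (z \<otimes> g) = character_of G \<rho> z / of_nat d * character_of G \<rho> g"
    if "z \<in> carrier G" "g \<in> carrier G" "\<rho> z = (character_of G \<rho> z / of_nat d) \<cdot>\<^sub>m 1\<^sub>m d" for z g
  proof -
    have "\<rho> (z \<otimes> g) = (character_of G \<rho> z / of_nat d) \<cdot>\<^sub>m (1\<^sub>m d * \<rho> g)"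
      using that rep_mult[of z g] mult_smult_assoc_mat[of "1\<^sub>m d" d d "\<rho> g" d] by simp
    also have "1\<^sub>m d * \<rho> g = \<rho> g" using that by (intro left_mult_one_mat[of _ d d]) auto
    finally have "mat_trace (\<rho> (z \<otimes> g)) = character_of G \<rho> z / of_nat d * mat_trace (\<rho> g)"
      using mat_trace_smult[OF rep_carrier[OF that(2)]] by simp
    then show ?thesis using that(1,2) by (simp add: character_eq[of "z \<otimes> g"] character_eq[of g])
  qed
  have comm_U2: "\<rho> (z \<otimes> g) = \<rho> (g \<otimes> z)" if "z \<in> U2" "g \<in> carrier G" for z g
    using that by (intro rep_cong) (auto simp: a_mult c_mult U2_def)
  have scalar_U2: "\<rho> z = (character_of G \<rho> z / of_nat d) \<cdot>\<^sub>m 1\<^sub>m d" if "z \<in> U2" for z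
    using scalar[OF U2_closed[OF that]] comm_U2[OF that] by blast
  let ?\<omega> = "\<lambda>z. character_of G \<rho> z / of_nat d"
  have U2: "subgroup U2 G" by (rule normal_imp_subgroup[OF U2_normal])
  \<comment> \<open>The scalar character of \<open>U2\<close> is trivial on \<open>U3\<close>, so it
    is \<open>\<theta>\<close> of a linear form in the coordinates \<open>c\<close>; the
    coefficients of that form are \<open>\<gamma>\<close>.\<close>
  have "\<exists>w. (\<forall>p. p \<notin> {p. Suc p < m} \<longrightarrow> w p = 0) \<and>
      (\<forall>x\<in>U2. ?\<omega> x = \<theta> (\<Sum>p | Suc p < m. w p * c p x))"
  proof (rule character_eq_theta[OF is_group U2])
    show "finite U2" using finG subgroup.subset[OF U2] finite_subset by blast
    show "finite {p. Suc p < m}" by (rule finite_subset[of _ "{..m}"]) auto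
    show "?\<omega> (x \<otimes> y) = ?\<omega> x * ?\<omega> y" if "x \<in> U2" "y \<in> U2" for x y
      using scalar_mult[of x y] scalar_U2[OF that(1)] that U2_closed by simp
    show "c p (x \<otimes> y) = c p x + c p y" if "x \<in> U2" "y \<in> U2" for p x y
      using that by (simp add: U2_def c_mult)
    show "?\<omega> x = 1" if "x \<in> U2" "\<And>p. p \<in> {p. Suc p < m} \<Longrightarrow> c p x = 0" for x
    proof -
      have "x \<in> U3" using that c_out by (auto simp: U2_def U3_def) (meson not_less)
      then show ?thesis using U3 d by simp
    qed
  qed
  then obtain \<gamma> where \<gamma>0: "\<forall>p. p \<notin> {p. Suc p < m} \<longrightarrow> \<gamma> p = 0"
    and \<gamma>\<omega>: "\<forall>x\<in>U2. ?\<omega> x = \<theta> (\<Sum>p | Suc p < m. \<gamma> p * c p x)" by blast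
  have \<gamma>: "supp_below m \<gamma>" using \<gamma>0 by (auto simp: supp_below_def)
  have lam_U2: "?\<omega> x = \<theta> (lam \<delta> \<gamma> x)" if x: "x \<in> U2" for x \<delta>
  proof -
    have "(\<Sum>p | Suc p < m. \<gamma> p * c p x) = (\<Sum>p<m. \<gamma> p * c p x)"
      by (rule sum.mono_neutral_left) (use \<gamma>0 in auto)
    then show ?thesis using \<gamma>\<omega> x by (simp add: lam_def U2_def)
  qed
  have Z: "subgroup (Z \<gamma>) G" by (rule normal_imp_subgroup[OF Z_normal])
  \<comment> \<open>The commutator of \<open>g\<close> and \<open>h\<close> lies in
    \<open>U2\<close>, hence acts by a scalar, and pairing its \<open>c\<close> coordinates with
    \<open>\<gamma>\<close> yields the alternating form.\<close>
  have conj: "\<rho> (g \<otimes> h \<otimes> inv g) =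
      \<theta> (alt_form m \<gamma> (\<lambda>p. a p g) (\<lambda>p. a p h)) \<cdot>\<^sub>m \<rho> h"
    if gh: "g \<in> carrier G" "h \<in> carrier G" for g h
  proof -
    let ?k = "g \<otimes> h \<otimes> inv g \<otimes> inv h"
    have kh: "?k \<otimes> h = g \<otimes> h \<otimes> inv g" using gh by (simp add: m_assoc)
    have ak: "a p ?k = 0" for p using gh by (simp add: a_mult a_inv)
    then have kU2: "?k \<in> U2" using gh by (simp add: U2_def)
    have "c p (?k \<otimes> h) = c p ?k + c p h" for p using gh ak by (subst c_mult) auto
    then have "c p ?k = a p g * a (Suc p) h - a (Suc p) g * a p h" for p
      using c_conj[OF gh, of p] unfolding kh by simp
    then have "lam (\<lambda>_. 0) \<gamma> ?k = alt_form m \<gamma> (\<lambda>p. a p g) (\<lambda>p. a p h)"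
      by (simp add: lam_def alt_form_def)
    then have "\<rho> ?k = \<theta> (alt_form m \<gamma> (\<lambda>p. a p g) (\<lambda>p. a p h)) \<cdot>\<^sub>m 1\<^sub>m d"
      using scalar_U2[OF kU2] lam_U2[OF kU2, of "\<lambda>_. 0"] by simp
    moreover have "\<rho> (g \<otimes> h \<otimes> inv g) = \<rho> ?k * \<rho> h"
      using rep_mult[of ?k h] gh unfolding kh by simp
    ultimately show ?thesis
      using gh mult_smult_assoc_mat[of "1\<^sub>m d" d d "\<rho> h" d] left_mult_one_mat[OF rep_carrier[of h]]
      by simp
  qed
  have off_Z: "character_of G \<rho> h = 0" if h: "h \<in> carrier G" "h \<notin> Z \<gamma>" for h
  proof -
    obtain y where y: "\<forall>p\<ge>m. y p = 0" "alt_form m \<gamma> (\<lambda>p. a p h) y \<noteq> 0"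
      using not_alt_radical[OF \<gamma>, of "\<lambda>p. a p h"] h by (auto simp: Z_def)
    \<comment> \<open>Rescaling \<open>y\<close> makes the conjugation scalar differ from 1, while
      conjugation preserves the trace; hence the trace is zero.\<close>
    obtain t where t: "\<theta> (t * - alt_form m \<gamma> (\<lambda>p. a p h) y) \<noteq> 1"
      using theta_separates[of "- alt_form m \<gamma> (\<lambda>p. a p h) y"] y(2) by auto
    obtain g where g: "g \<in> carrier G" "(\<lambda>p. a p g) = (\<lambda>p. t * y p)"
      using ex_element[of "\<lambda>p. t * y p" "\<lambda>_. 0"] y(1) by auto
    have "alt_form m \<gamma> (\<lambda>p. a p g) (\<lambda>p. a p h) = t * - alt_form m \<gamma> (\<lambda>p. a p h) y"
      unfolding g(2) alt_form_commute[of m \<gamma> "\<lambda>p. t * y p"] alt_form_scale by simp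
    then have "mat_trace (\<rho> (g \<otimes> h \<otimes> inv g)) =
        \<theta> (t * - alt_form m \<gamma> (\<lambda>p. a p h) y) * mat_trace (\<rho> h)"
      using conj[OF g(1) h(1)] mat_trace_smult[OF rep_carrier[OF h(1)]] by simp
    moreover have "mat_trace (\<rho> (g \<otimes> h \<otimes> inv g)) = mat_trace (\<rho> h)"
    proof -
      have "mat_trace (\<rho> (g \<otimes> h \<otimes> inv g)) = mat_trace (\<rho> (g \<otimes> h) * \<rho> (inv g))"
        using g h by (simp add: rep_mult)
      also have "\<dots> = mat_trace (\<rho> (inv g) * \<rho> (g \<otimes> h))"
        using g h by (intro mat_trace_mult_commute[of _ d]) auto
      also have "\<rho> (inv g) * \<rho> (g \<otimes> h) = \<rho> (inv g \<otimes> (g \<otimes> h))"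
        using g h rep_mult[of "inv g" "g \<otimes> h"] by simp
      also have "inv g \<otimes> (g \<otimes> h) = h" using g h by (simp flip: m_assoc)
      finally show ?thesis .
    qed
    ultimately show ?thesis using t h by (simp add: character_eq)
  qed
  have comm_Z: "\<rho> (z \<otimes> g) = \<rho> (g \<otimes> z)" if z: "z \<in> Z \<gamma>" and g: "g \<in> carrier G" for z g
  proof -
    note zc = Z_closed[OF z]
    have "alt_form m \<gamma> (\<lambda>p. a p z) (\<lambda>p. a p g) = 0"
      using z alt_form_radical[OF \<gamma>] by (simp add: Z_def)
    then have "\<rho> (z \<otimes> g \<otimes> inv z) = \<rho> g" using conj[OF zc g] by (simp add: eq_matI)
    moreover have "z \<otimes> g = z \<otimes> g \<otimes> inv z \<otimes> z" using zc g by (simp add: m_assoc)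
    ultimately show ?thesis using rep_mult[of "z \<otimes> g \<otimes> inv z" z] rep_mult[of g z] zc g by simp
  qed
  have scalar_Z: "\<rho> z = ?\<omega> z \<cdot>\<^sub>m 1\<^sub>m d" if "z \<in> Z \<gamma>" for z
    using scalar[OF Z_closed[OF that]] comm_Z[OF that] by blast
  have \<omega>_mult: "?\<omega> (x \<otimes> y) = ?\<omega> x * ?\<omega> y" if "x \<in> Z \<gamma>" "y \<in> Z \<gamma>" for x y
    using scalar_mult[of x y] scalar_Z[OF that(1)] that Z_closed by simp
  let ?I = "{p. p < m \<and> p \<in> run_starts \<gamma>}"
  \<comment> \<open>Dividing out the \<open>\<gamma>\<close> part leaves a character trivial on
    \<open>U2\<close>. On \<open>Z \<gamma>\<close> it therefore depends only on the coordinates at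
    starts of odd blocks, by \<open>alt_radical_zero\<close>.\<close>
  let ?\<psi> = "\<lambda>z. ?\<omega> z / \<theta> (lam (\<lambda>_. 0) \<gamma> z)"
  have "\<exists>w. (\<forall>p. p \<notin> ?I \<longrightarrow> w p = 0) \<and> (\<forall>x\<in>Z \<gamma>. ?\<psi> x = \<theta> (\<Sum>p\<in>?I. w p * a p x))"
  proof (rule character_eq_theta[OF is_group Z])
    show "finite (Z \<gamma>)" using finG subgroup.subset[OF Z] finite_subset by blast
    show "?\<psi> (x \<otimes> y) = ?\<psi> x * ?\<psi> y" if "x \<in> Z \<gamma>" "y \<in> Z \<gamma>" for x y
    proof -
      have "lam (\<lambda>_. 0) \<gamma> (x \<otimes> y) = lam (\<lambda>_. 0) \<gamma> x + lam (\<lambda>_. 0) \<gamma> y"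
        using that Z_subset_L[OF \<gamma>] by (intro lam_mult[OF \<gamma>]) auto
      then show ?thesis using \<omega>_mult[OF that] by (simp add: theta_add)
    qed
    show "a p (x \<otimes> y) = a p x + a p y" if "x \<in> Z \<gamma>" "y \<in> Z \<gamma>" for p x y
      using that Z_closed by (simp add: a_mult)
    show "?\<psi> x = 1" if x: "x \<in> Z \<gamma>" "\<And>p. p \<in> ?I \<Longrightarrow> a p x = 0" for x
    proof -
      have "a p x = 0" if "p < m" for p
        using alt_radical_zero[OF \<gamma>, of "\<lambda>p. a p x" p] x that by (auto simp: Z_def)
      then have "a p x = 0" for p using a_out[of p x] by (cases "p < m") auto
      then have "x \<in> U2" using Z_closed[OF x(1)] by (simp add: U2_def)
      then show ?thesis using lam_U2[of x "\<lambda>_. 0"] by simp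
    qed
  qed simp
  then obtain \<delta> where \<delta>0: "\<forall>p. p \<notin> ?I \<longrightarrow> \<delta> p = 0"
    and \<delta>\<psi>: "\<forall>x\<in>Z \<gamma>. ?\<psi> x = \<theta> (\<Sum>p\<in>?I. \<delta> p * a p x)" by blast
  have data: "(\<delta>, \<gamma>) \<in> functional_data m" using \<gamma> \<delta>0 by (auto simp: functional_data_def)
  have on_Z: "character_of G \<rho> z = of_nat d * \<theta> (lam \<delta> \<gamma> z)" if z: "z \<in> Z \<gamma>" for z
  proof -
    have "(\<Sum>p\<in>?I. \<delta> p * a p z) = (\<Sum>p<m. \<delta> p * a p z)"
      by (rule sum.mono_neutral_left) (use \<delta>0 in auto)
    then have "lam \<delta> \<gamma> z = (\<Sum>p\<in>?I. \<delta> p * a p z) + lam (\<lambda>_. 0) \<gamma> z" by (simp add: lam_def)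
    then have "\<theta> (lam \<delta> \<gamma> z) = ?\<psi> z * \<theta> (lam (\<lambda>_. 0) \<gamma> z)" using \<delta>\<psi> z by (simp add: theta_add)
    then show ?thesis using d by simp
  qed
  \<comment> \<open>In the norm relation every element of \<open>Z \<gamma>\<close> contributes
    \<open>d\<^sup>2\<close> and every other element contributes 0.\<close>
  have "of_nat (card (carrier G)) =
      (\<Sum>g\<in>carrier G. character_of G \<rho> g * character_of G \<rho> (inv g))"
    using character_norm by simp
  also have "\<dots> = (\<Sum>g\<in>Z \<gamma>. character_of G \<rho> g * character_of G \<rho> (inv g))"
    by (rule sum.mono_neutral_right) (use finG Z_closed off_Z in auto)
  also have "\<dots> = (\<Sum>g\<in>Z \<gamma>. (of_nat d)\<^sup>2)"
  proof (rule sum.cong)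
    fix z assume z: "z \<in> Z \<gamma>"
    have zi: "inv z \<in> Z \<gamma>" using z by (rule subgroup.m_inv_closed[OF Z])
    have "?\<omega> (z \<otimes> inv z) = 1" using Z_closed[OF z] d by (simp add: character_one)
    then have "?\<omega> z * ?\<omega> (inv z) = 1" using \<omega>_mult[OF z zi] by simp
    then show "character_of G \<rho> z * character_of G \<rho> (inv z) = (of_nat d)\<^sup>2"
      using d by (simp add: field_simps power2_eq_square)
  qed simp
  also have "\<dots> = of_nat (d\<^sup>2 * card (Z \<gamma>))" by simp
  finally have "card (carrier G) = d\<^sup>2 * card (Z \<gamma>)" using of_nat_eq_iff by blast
  then show ?thesis using data on_Z off_Z by (intro exI[of _ \<delta>] exI[of _ \<gamma>]) auto
qed

lemma irreducible_characters_irrep: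
  assumes "\<chi> \<in> irreducible_characters G"
  obtains \<rho> d where "irrep G d \<rho>" "\<chi> = character_of G \<rho>" "\<chi> \<one> = of_nat d"
proof -
  obtain \<rho> d where \<rho>: "\<chi> = character_of G \<rho>" "irreducible_representation G d \<rho>"
    using assms by (auto simp: irreducible_characters_def)
  then have "irrep G d \<rho>" using finG is_group by (simp add: irrep_def irrep_axioms_def)
  then show ?thesis using that \<rho> irrep.character_one by metis
qed

text \<open>At first \<open>Z \<gamma>\<close> and \<open>Z \<gamma>'\<close> may differ, so
  \<open>\<gamma> = \<gamma>'\<close> is derived on their common subgroup \<open>U2\<close>; only
  then can \<open>\<delta>\<close> and \<open>\<delta>'\<close> be compared.\<close>

lemma heis_char_data_unique:
  assumes "(\<delta>, \<gamma>) \<in> functional_data m" "(\<delta>', \<gamma>') \<in> functional_data m" "K \<noteq> 0"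
    and "\<And>z. z \<in> Z \<gamma> \<Longrightarrow> f z = K * \<theta> (lam \<delta> \<gamma> z)"
    and "\<And>z. z \<in> Z \<gamma>' \<Longrightarrow> f z = K * \<theta> (lam \<delta>' \<gamma>' z)"
  shows "\<delta> = \<delta>' \<and> \<gamma> = \<gamma>'"
proof -
  have eq: "\<theta> (lam \<delta> \<gamma> z) = \<theta> (lam \<delta>' \<gamma>' z)" if "z \<in> Z \<gamma>" "z \<in> Z \<gamma>'" for z
    using assms(4)[OF that(1)] assms(5)[OF that(2)] assms(3) by simp
  have "\<gamma> = \<gamma>'"
    using assms(1,2) eq U2_subset_Z
    by (intro gamma_unique[of _ _ \<delta> \<delta>']) (auto simp: functional_data_def)
  then show ?thesis using assms(1,2) eq delta_unique by blast
qed

theorem bij_betw_heis_char: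
  "bij_betw (\<lambda>(\<delta>, \<gamma>). heis_char \<delta> \<gamma>) (functional_data m)
     {\<chi> \<in> irreducible_characters G. \<forall>u\<in>U3. \<chi> u = \<chi> \<one>}"
proof -
  \<comment> \<open>The classification is applied to \<open>heis_char \<delta> \<gamma>\<close>
    itself; by uniqueness the data that it returns are \<open>\<delta>\<close> and
    \<open>\<gamma>\<close>.\<close>
  have formula: "\<exists>d. d \<noteq> 0 \<and> (\<forall>z\<in>Z \<gamma>. heis_char \<delta> \<gamma> z = of_nat d * \<theta> (lam \<delta> \<gamma> z)) \<and>
      (\<forall>g\<in>carrier G - Z \<gamma>. heis_char \<delta> \<gamma> g = 0) \<and> d\<^sup>2 * card (Z \<gamma>) = card (carrier G)"
    if data: "(\<delta>, \<gamma>) \<in> functional_data m" for \<delta> \<gamma>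
  proof -
    have \<gamma>: "supp_below m \<gamma>" using data by (simp add: functional_data_def)
    obtain \<rho> d where \<rho>: "irrep G d \<rho>" "heis_char \<delta> \<gamma> = character_of G \<rho>"
      and one: "heis_char \<delta> \<gamma> \<one> = of_nat d"
      using irreducible_characters_irrep[OF heis_char_irreducible[OF \<gamma>]] by metis
    have d: "d \<noteq> 0" using irrep.dim_pos[OF \<rho>(1)] by simp
    have "character_of G \<rho> u = of_nat d" if "u \<in> U3" for u
      using heis_char_U3[OF \<gamma> that, of \<delta>] one \<rho>(2) by simp
    from irrep_classified[OF \<rho>(1) this] obtain \<delta>' \<gamma>'
      where *: "(\<delta>', \<gamma>') \<in> functional_data m"
        "\<forall>z\<in>Z \<gamma>'. heis_char \<delta> \<gamma> z = of_nat d * \<theta> (lam \<delta>' \<gamma>' z)"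
        "\<forall>g\<in>carrier G - Z \<gamma>'. heis_char \<delta> \<gamma> g = 0" "d\<^sup>2 * card (Z \<gamma>') = card (carrier G)"
      unfolding \<rho>(2)[symmetric] by blast
    have "\<delta> = \<delta>' \<and> \<gamma> = \<gamma>'"
      using * d heis_char_Z[OF \<gamma>, of _ \<delta>] one data
      by (intro heis_char_data_unique[of _ _ _ _ "of_nat d" "heis_char \<delta> \<gamma>"]) auto
    then show ?thesis using * d by blast
  qed
  have "inj_on (\<lambda>(\<delta>, \<gamma>). heis_char \<delta> \<gamma>) (functional_data m)"
  proof (rule inj_onI, clarify)
    fix \<delta> \<gamma> \<delta>' \<gamma>' assume data: "(\<delta>, \<gamma>) \<in> functional_data m" "(\<delta>', \<gamma>') \<in> functional_data m"
      and eq: "heis_char \<delta> \<gamma> = heis_char \<delta>' \<gamma>'"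
    obtain d d' where d: "d \<noteq> 0" "\<forall>z\<in>Z \<gamma>. heis_char \<delta> \<gamma> z = of_nat d * \<theta> (lam \<delta> \<gamma> z)"
      and d': "\<forall>z\<in>Z \<gamma>'. heis_char \<delta> \<gamma> z = of_nat d' * \<theta> (lam \<delta>' \<gamma>' z)"
      using formula[OF data(1)] formula[OF data(2)] eq by metis
    have one: "\<one> \<in> Z \<mu>" for \<mu> by (rule subgroup.one_closed[OF normal_imp_subgroup[OF Z_normal]])
    have "of_nat d = (of_nat d' :: complex)"
      using d(2)[rule_format, OF one] d'[rule_format, OF one] by (simp add: lam_one)
    then show "\<delta> = \<delta>' \<and> \<gamma> = \<gamma>'"
      using d d' data
      by (intro heis_char_data_unique[of _ _ _ _ "of_nat d" "heis_char \<delta> \<gamma>"]) auto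
  qed
  moreover have "(\<lambda>(\<delta>, \<gamma>). heis_char \<delta> \<gamma>) ` functional_data m =
      {\<chi> \<in> irreducible_characters G. \<forall>u\<in>U3. \<chi> u = \<chi> \<one>}"
  proof (intro equalityI subsetI)
    fix \<chi> assume "\<chi> \<in> (\<lambda>(\<delta>, \<gamma>). heis_char \<delta> \<gamma>) ` functional_data m"
    then show "\<chi> \<in> {\<chi> \<in> irreducible_characters G. \<forall>u\<in>U3. \<chi> u = \<chi> \<one>}"
      using heis_char_irreducible heis_char_U3 by (auto simp: functional_data_def)
  next
    fix \<chi> assume \<chi>: "\<chi> \<in> {\<chi> \<in> irreducible_characters G. \<forall>u\<in>U3. \<chi> u = \<chi> \<one>}"
    then obtain \<rho> d where \<rho>: "irrep G d \<rho>" "\<chi> = character_of G \<rho>" "\<chi> \<one> = of_nat d"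
      using irreducible_characters_irrep by blast
    have "character_of G \<rho> u = of_nat d" if "u \<in> U3" for u using \<chi> \<rho> that by auto
    from irrep_classified[OF \<rho>(1) this] obtain \<delta> \<gamma>
      where data: "(\<delta>, \<gamma>) \<in> functional_data m"
        and d: "\<forall>z\<in>Z \<gamma>. \<chi> z = of_nat d * \<theta> (lam \<delta> \<gamma> z)"
        "\<forall>g\<in>carrier G - Z \<gamma>. \<chi> g = 0" "d\<^sup>2 * card (Z \<gamma>) = card (carrier G)"
      unfolding \<rho>(2)[symmetric] by blast
    \<comment> \<open>\<open>\<chi>\<close> and \<open>heis_char \<delta> \<gamma>\<close> have the
      same \<open>Z \<gamma>\<close>, so the two order relations force equal degrees.\<close>
    obtain d' where d': "\<forall>z\<in>Z \<gamma>. heis_char \<delta> \<gamma> z = of_nat d' * \<theta> (lam \<delta> \<gamma> z)"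
        "\<forall>g\<in>carrier G - Z \<gamma>. heis_char \<delta> \<gamma> g = 0" "d'\<^sup>2 * card (Z \<gamma>) = card (carrier G)"
      using formula[OF data] by blast
    have "card (carrier G) \<noteq> 0" using finG one_closed by (auto simp: card_eq_0_iff)
    then have "d\<^sup>2 = d'\<^sup>2" using d(3) d'(3) by (metis mult_right_cancel mult_0_right)
    then have "d = d'" by (simp add: power2_eq_iff_nonneg)
    have "\<chi> g = heis_char \<delta> \<gamma> g" for g
    proof (cases "g \<in> carrier G")
      case True
      then show ?thesis using d d' \<open>d = d'\<close> by (cases "g \<in> Z \<gamma>") auto
    next
      case False
      then show ?thesis by (simp add: \<rho>(2) character_of_def heis_char_def induced_function_def)
    qed
    then show "\<chi> \<in> (\<lambda>(\<delta>, \<gamma>). heis_char \<delta> \<gamma>) ` functional_data m"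
      using data by (intro image_eqI[of _ _ "(\<delta>, \<gamma>)"]) auto
  qed
  ultimately show ?thesis by (simp add: bij_betw_def)
qed

end

subsection \<open>Lattice paths and functionals\<close>

definition path_size :: "(step \<times> 'a list) list \<Rightarrow> nat" where
  "path_size P = start_sum P (length P)"

text \<open>Numbered from 0, the coordinate \<open>e*_{i,i+1}\<close> with \<open>i = d + 1\<close>
  is entry \<open>d\<close> of the first superdiagonal, and \<open>e*_{i,i+2}\<close> is entry
  \<open>d\<close> of the second.\<close>

definition step_delta :: "nat \<Rightarrow> step \<times> 'a::zero list \<Rightarrow> nat \<Rightarrow> 'a" where
  "step_delta d st p = (if fst st = (0, 1) \<and> p = d then snd st ! 0 else 0)"

text \<open>The truncated \<open>d - 1\<close> is harmless because a path in \<^const>\<open>heis_paths_tilde\<close> does not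
  begin with the step \<open>(0, 2)\<close>.\<close>

definition step_gamma :: "nat \<Rightarrow> step \<times> 'a::zero list \<Rightarrow> nat \<Rightarrow> 'a" where
  "step_gamma d st p =
     (if fst st = (1, 1) \<and> p = d then snd st ! 0
      else if fst st = (0, 2) \<and> p = d then snd st ! 1
      else if fst st = (0, 2) \<and> p = d - 1 then snd st ! 0 else 0)"

definition path_delta :: "(step \<times> 'a::comm_monoid_add list) list \<Rightarrow> nat \<Rightarrow> 'a" where
  "path_delta P p = (\<Sum>k<length P. step_delta (start_sum P k) (P ! k) p)"

definition path_gamma :: "(step \<times> 'a::comm_monoid_add list) list \<Rightarrow> nat \<Rightarrow> 'a" where
  "path_gamma P p = (\<Sum>k<length P. step_gamma (start_sum P k) (P ! k) p)"

lemma path_size_snoc: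
  "path_size (P @ [st]) = path_size P + fst (fst st) + snd (fst st)"
  by (simp add: path_size_def start_sum_def path_end_def)

lemma start_sum_append: "k \<le> length P \<Longrightarrow> start_sum (P @ Q) k = start_sum P k"
  by (simp add: start_sum_def)

lemma path_size_Nil [simp]: "path_size [] = 0"
  and path_delta_Nil [simp]: "path_delta [] = (\<lambda>_. 0)"
  and path_gamma_Nil [simp]: "path_gamma [] = (\<lambda>_. 0)"
  by (auto simp: path_size_def start_sum_def path_end_def path_delta_def path_gamma_def)

lemma path_delta_snoc:
  "path_delta (P @ [st]) p = path_delta P p + step_delta (path_size P) st p"
  by (simp add: path_delta_def path_size_def start_sum_append nth_append)

lemma path_gamma_snoc:
  "path_gamma (P @ [st]) p = path_gamma P p + step_gamma (path_size P) st p"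
  by (simp add: path_gamma_def path_size_def start_sum_append nth_append)

definition tilde_paths :: "nat \<Rightarrow> (step \<times> 'a::zero list) list set" where
  "tilde_paths m =
     {P \<in> labeled_paths heis_steps. path_size P = m \<and> (P = [] \<or> fst (hd P) \<noteq> (0, 2))}"

lemma heis_paths_tilde_eq: "heis_paths_tilde n = tilde_paths (n - 1)"
  by (auto simp: heis_paths_tilde_def heis_paths_def tilde_paths_def path_size_def start_sum_def)

text \<open>The steps \<open>(1, 0)\<close> and \<open>(0, 1)\<close> both advance by one; reading
  the former as label 0 turns them into one step with an arbitrary field element as its value of
  \<open>\<delta>\<close>.\<close>

definition short_step :: "'a::zero \<Rightarrow> step \<times> 'a list" where
  "short_step t = (if t = 0 then ((1, 0), []) else ((0, 1), [t]))"

lemma step_cases: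
  assumes "[st] \<in> labeled_paths heis_steps"
  obtains (short) t where "st = short_step t"
  | (diagonal) t where "st = ((1, 1), [t])" "t \<noteq> 0"
  | (double) t u where "st = ((0, 2), [t, u])" "t \<noteq> 0" "u \<noteq> 0"
proof -
  obtain s ts where st: "st = (s, ts)" by (cases st)
  then have s: "s \<in> heis_steps" "length ts = snd s" "0 \<notin> set ts"
    using assms by (auto simp: labeled_paths_def)
  then consider "s = (1, 0)" "ts = []" | t where "s = (1, 1)" "ts = [t]" | t where "s = (0, 1)" "ts = [t]"
    | t u where "s = (0, 2)" "ts = [t, u]"
    unfolding heis_steps_def by (auto simp: length_Suc_conv numeral_2_eq_2)
  then show ?thesis
  proof cases
    case 1
    then show ?thesis using short[of 0] st by (simp add: short_step_def)
  next
    case (2 t)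
    then show ?thesis using diagonal[of t] st s by simp
  next
    case (3 t)
    then show ?thesis using short[of t] st s by (simp add: short_step_def)
  next
    case (4 t u)
    then show ?thesis using double[of t u] st s by simp
  qed
qed

lemma labeled_step [simp]:
  "[short_step t] \<in> labeled_paths heis_steps"
  "[((1, 1), [t])] \<in> labeled_paths heis_steps \<longleftrightarrow> t \<noteq> 0"
  "[((0, 2), [t, u])] \<in> labeled_paths heis_steps \<longleftrightarrow> t \<noteq> 0 \<and> u \<noteq> 0"
  by (auto simp: labeled_paths_def short_step_def heis_steps_def)

lemma tilde_paths_snoc:
  "P @ [st] \<in> tilde_paths m \<longleftrightarrow>
     P \<in> tilde_paths (path_size P) \<and> [st] \<in> labeled_paths heis_steps \<and>
     (P = [] \<longrightarrow> fst st \<noteq> (0, 2)) \<and> m = path_size P + fst (fst st) + snd (fst st)"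
  by (auto simp: tilde_paths_def labeled_paths_def path_size_snoc hd_append)

lemma size_short_step: "fst (fst (short_step t)) + snd (fst (short_step t)) = 1"
  by (simp add: short_step_def)

lemma tilde_paths_size: "P \<in> tilde_paths m \<Longrightarrow> path_size P = m"
  by (simp add: tilde_paths_def)

lemma fst_short_step: "fst (short_step t) \<noteq> (0, 2)"
  by (simp add: short_step_def)

lemma path_size_eq_0:
  "P \<in> labeled_paths heis_steps \<Longrightarrow> path_size P = 0 \<longleftrightarrow> P = []"
  by (cases P rule: rev_cases) (auto simp: path_size_snoc labeled_paths_def heis_steps_def)

text \<open>Going left from \<open>e\<close>, the parity is either reset by a zero or flipped, in
  the same way for both sequences.\<close>

lemma even_run_length_cong:
  assumes \<gamma>: "supp_below m \<gamma>" "supp_below m' \<gamma>'"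
    and eq: "\<And>q. q < e \<Longrightarrow> \<gamma>' q = \<gamma> q"
    and e: "even (run_length \<gamma>' e) = even (run_length \<gamma> e)"
  shows "p \<le> e \<Longrightarrow> even (run_length \<gamma>' p) = even (run_length \<gamma> p)"
proof (induction "e - p" arbitrary: p)
  case 0
  then show ?case using e by simp
next
  case (Suc k)
  then have IH: "even (run_length \<gamma>' (Suc p)) = even (run_length \<gamma> (Suc p))" and p: "p < e"
    using Suc.hyps(1)[of "Suc p"] by auto
  show ?case
  proof (cases "\<gamma> p = 0")
    case True
    then show ?thesis using eq[OF p] by (simp add: run_length_eq_0)
  next
    case False
    then show ?thesis
      using eq[OF p] IH run_length_Suc[OF \<gamma>(1), of p] run_length_Suc[OF \<gamma>(2), of p] by simp
  qed
qed

section \<open>Functional data under appending one step\<close>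

lemma functional_data_0: "functional_data 0 = {(\<lambda>_. 0, \<lambda>_. 0)}"
  by (auto simp: functional_data_def supp_below_def)

text \<open>Coordinate \<open>d\<close> forms a block of size one, so it is a start and its value of
  \<open>\<delta>\<close> is free.\<close>

lemma functional_data_short:
  assumes "\<gamma> d = 0" "d = 0 \<or> \<gamma> (d - 1) = 0"
  shows "(\<delta>, \<gamma>) \<in> functional_data (Suc d) \<longleftrightarrow> (\<delta>(d := 0), \<gamma>) \<in> functional_data d"
proof -
  have "d \<in> run_starts \<gamma>" using assms by (auto simp: run_starts_def run_length_eq_0)
  moreover have "supp_below (Suc d) \<gamma> \<longleftrightarrow> supp_below d \<gamma>"
    using assms(2) by (auto simp: supp_below_def less_Suc_eq)
  ultimately show ?thesis by (auto simp: functional_data_def less_Suc_eq)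
qed

text \<open>Here \<open>\<gamma>0\<close> is \<open>\<gamma>\<close> with its last one or two links
  erased. The linked coordinates \<open>d\<close> and \<open>Suc d\<close> either form a new block
  of size two or lengthen the preceding block by two, so in both cases the set of starts of odd
  blocks is unchanged.\<close>

lemma functional_data_extend:
  assumes \<gamma>0: "\<And>q. Suc q \<ge> d \<Longrightarrow> \<gamma>0 q = 0"
    and \<gamma>: "\<gamma> d \<noteq> 0" "\<And>q. q > d \<Longrightarrow> \<gamma> q = 0"
    and eq: "\<And>q. Suc q < d \<Longrightarrow> \<gamma> q = \<gamma>0 q"
  shows "(\<delta>, \<gamma>) \<in> functional_data (Suc (Suc d)) \<longleftrightarrow> (\<delta>, \<gamma>0) \<in> functional_data d"
proof -
  have s0: "supp_below d \<gamma>0" using \<gamma>0 by (auto simp: supp_below_def) (meson not_less)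
  have s: "supp_below (Suc (Suc d)) \<gamma>"
    unfolding supp_below_def using \<gamma>(2) not_less_eq by blast
  have "run_length \<gamma> (Suc d) = 0" using \<gamma>(2) by (simp add: run_length_eq_0)
  then have rd: "run_length \<gamma> d = 1" using run_length_Suc[OF s \<gamma>(1)] by simp
  have starts: "p \<in> run_starts \<gamma> \<longleftrightarrow> p \<in> run_starts \<gamma>0" if "p < d" for p
  proof -
    have "even (run_length \<gamma> (d - 1)) = even (run_length \<gamma>0 (d - 1))"
    proof (cases "\<gamma> (d - 1) = 0")
      case True
      then show ?thesis using \<gamma>0[of "d - 1"] by (simp add: run_length_eq_0)
    next
      case False
      then have "run_length \<gamma> (d - 1) = 2" using run_length_Suc[OF s False] rd that by simp
      then show ?thesis using \<gamma>0[of "d - 1"] by (simp add: run_length_eq_0)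
    qed
    moreover have "\<gamma> q = \<gamma>0 q" if "q < d - 1" for q using eq[of q] that by simp
    moreover have "p \<le> d - 1" using that by simp
    ultimately have "even (run_length \<gamma> p) = even (run_length \<gamma>0 p)"
      using even_run_length_cong[OF s0 s, of "d - 1" p] by blast
    moreover have "p = 0 \<or> \<gamma> (p - 1) = \<gamma>0 (p - 1)" using eq[of "p - 1"] that by (cases p) auto
    ultimately show ?thesis by (auto simp: run_starts_def)
  qed
  have "d \<notin> run_starts \<gamma>" "Suc d \<notin> run_starts \<gamma>" using rd \<gamma>(1) by (auto simp: run_starts_def)
  then have "p < Suc (Suc d) \<and> p \<in> run_starts \<gamma> \<longleftrightarrow> p < d \<and> p \<in> run_starts \<gamma>0" for p
    using starts[of p] by (metis less_Suc_eq)
  then show ?thesis using s s0 by (simp add: functional_data_def)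
qed

text \<open>The inverse map, reading blocks from the right: the last coordinate stands alone, or the
  last two form a block, or they continue an earlier block. The updates erase what the removed step
  contributed, so that the remainder is again functional data of the smaller size.\<close>

fun data_path :: "nat \<Rightarrow> (nat \<Rightarrow> 'a::zero) \<Rightarrow> (nat \<Rightarrow> 'a) \<Rightarrow> (step \<times> 'a list) list" where
  "data_path 0 \<delta> \<gamma> = []"
| "data_path (Suc 0) \<delta> \<gamma> = [short_step (\<delta> 0)]"
| "data_path (Suc (Suc d)) \<delta> \<gamma> =
     (if \<gamma> d = 0 then data_path (Suc d) (\<delta>(Suc d := 0)) \<gamma> @ [short_step (\<delta> (Suc d))]
      else if d = 0 \<or> \<gamma> (d - 1) = 0 then data_path d \<delta> (\<gamma>(d := 0)) @ [((1, 1), [\<gamma> d])]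
      else data_path d \<delta> (\<gamma>(d - 1 := 0, d := 0)) @ [((0, 2), [\<gamma> (d - 1), \<gamma> d])])"

lemma path_data_short:
  fixes P :: "(step \<times> 'a::comm_monoid_add list) list"
  shows "path_delta (P @ [short_step t]) = (\<lambda>p. path_delta P p + (if p = path_size P then t else 0))"
    "path_gamma (P @ [short_step t]) = path_gamma P"
  by (auto simp: fun_eq_iff path_delta_snoc path_gamma_snoc step_delta_def step_gamma_def short_step_def)

lemma path_data_diagonal:
  "path_delta (P @ [((1, 1), [t])]) = path_delta P"
  "path_gamma (P @ [((1, 1), [t])]) = (\<lambda>p. path_gamma P p + (if p = path_size P then t else 0))"
  by (auto simp: fun_eq_iff path_delta_snoc path_gamma_snoc step_delta_def step_gamma_def)

lemma path_data_double:
  "path_delta (P @ [((0, 2), [t, u])]) = path_delta P"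
  "path_gamma (P @ [((0, 2), [t, u])]) = (\<lambda>p. path_gamma P p +
     (if p = path_size P then u else if p = path_size P - 1 then t else 0))"
  by (auto simp: fun_eq_iff path_delta_snoc path_gamma_snoc step_delta_def step_gamma_def)

lemma functional_data_outside:
  assumes "(\<delta>, \<gamma>) \<in> functional_data m"
  shows "p \<ge> m \<Longrightarrow> \<delta> p = 0" "Suc p \<ge> m \<Longrightarrow> \<gamma> p = 0"
  using assms by (auto simp: functional_data_def supp_below_def not_less[symmetric])

lemma data_path_correct:
  fixes \<delta> \<gamma> :: "nat \<Rightarrow> 'a::comm_monoid_add"
  assumes "(\<delta>, \<gamma>) \<in> functional_data m"
  shows "data_path m \<delta> \<gamma> \<in> tilde_paths m \<and>
    path_delta (data_path m \<delta> \<gamma>) = \<delta> \<and> path_gamma (data_path m \<delta> \<gamma>) = \<gamma>"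
  using assms
proof (induction m \<delta> \<gamma> rule: data_path.induct)
  case (1 \<delta> \<gamma>)
  then show ?case by (auto simp: functional_data_0 tilde_paths_def labeled_paths_def)
next
  case (2 \<delta> \<gamma>)
  have g: "\<gamma> p = 0" for p using functional_data_outside(2)[OF 2] by simp
  have d: "p \<noteq> 0 \<Longrightarrow> \<delta> p = 0" for p using functional_data_outside(1)[OF 2, of p] by simp
  have "[short_step (\<delta> 0)] = [] @ [short_step (\<delta> 0)]" by simp
  then show ?case
    unfolding data_path.simps path_data_short[of "[]" "\<delta> 0", simplified]
    by (auto simp: tilde_paths_def path_size_def start_sum_def path_end_def fun_eq_iff g d)
      (auto simp: short_step_def split: if_splits)
next
  case (3 d \<delta> \<gamma>)
  note out = functional_data_outside[OF 3(4)]
  show ?case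
  proof (cases "\<gamma> d = 0")
    case True
    then have "(\<delta>(Suc d := 0), \<gamma>) \<in> functional_data (Suc d)"
      using 3(4) functional_data_short[of \<gamma> "Suc d" \<delta>] out(2)[of "Suc d"] by simp
    note IH = 3(1)[OF True this]
    let ?P = "data_path (Suc d) (\<delta>(Suc d := 0)) \<gamma>"
    have eq: "data_path (Suc (Suc d)) \<delta> \<gamma> = ?P @ [short_step (\<delta> (Suc d))]" using True by simp
    have size: "path_size ?P = Suc d" using IH tilde_paths_size by blast
    have IH': "path_delta ?P = \<delta>(Suc d := 0)" "path_gamma ?P = \<gamma>" using IH by blast+
    show ?thesis
      unfolding eq path_data_short IH' size tilde_paths_snoc
      by (intro conjI conjunct1[OF IH])
        (auto simp: fst_short_step size_short_step add.assoc)
  next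
    case nz: False
    have hi: "\<gamma> q = 0" if "q > d" for q using out(2)[of q] that by simp
    show ?thesis
    proof (cases "d = 0 \<or> \<gamma> (d - 1) = 0")
      case True
      have lo: "(\<gamma>(d := 0)) q = 0" if "Suc q \<ge> d" for q
        using that hi[of q] True by (cases "q = d"; cases "Suc q = d") auto
      have "\<gamma> q = (\<gamma>(d := 0)) q" if "Suc q < d" for q using that by simp
      then have "(\<delta>, \<gamma>(d := 0)) \<in> functional_data d"
        using functional_data_extend[of d "\<gamma>(d := 0)" \<gamma> \<delta>] lo nz hi 3(4) by blast
      note IH = 3(2)[OF nz True this]
      let ?P = "data_path d \<delta> (\<gamma>(d := 0))"
      have eq: "data_path (Suc (Suc d)) \<delta> \<gamma> = ?P @ [((1, 1), [\<gamma> d])]" using nz True by auto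
      have size: "path_size ?P = d" using IH tilde_paths_size by blast
      have IH': "path_delta ?P = \<delta>" "path_gamma ?P = \<gamma>(d := 0)" using IH by blast+
      show ?thesis
        unfolding eq path_data_diagonal IH' size tilde_paths_snoc
        by (intro conjI conjunct1[OF IH]) (use nz in \<open>auto simp del: One_nat_def\<close>)
    next
      case False
      have lo: "(\<gamma>(d - 1 := 0, d := 0)) q = 0" if "Suc q \<ge> d" for q
        using that hi[of q] by (cases "q = d"; cases "Suc q = d") auto
      have "\<gamma> q = (\<gamma>(d - 1 := 0, d := 0)) q" if "Suc q < d" for q using that by auto
      then have "(\<delta>, \<gamma>(d - 1 := 0, d := 0)) \<in> functional_data d"
        using functional_data_extend[of d "\<gamma>(d - 1 := 0, d := 0)" \<gamma> \<delta>] lo nz hi 3(4) by blast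
      note IH = 3(3)[OF nz False this]
      let ?P = "data_path d \<delta> (\<gamma>(d - 1 := 0, d := 0))"
      have eq: "data_path (Suc (Suc d)) \<delta> \<gamma> = ?P @ [((0, 2), [\<gamma> (d - 1), \<gamma> d])]"
        using nz False by simp
      have size: "path_size ?P = d" using IH tilde_paths_size by blast
      \<comment> \<open>The step \<open>(0, 2)\<close> may not open a path; the link at
        \<open>d - 1\<close> requires \<open>d > 0\<close>, so a step precedes it.\<close>
      have ne: "?P \<noteq> []"
      proof
        assume "?P = []"
        then have "path_size ?P = 0" by (simp only: path_size_Nil)
        then show False using size False by simp
      qed
      have IH': "path_delta ?P = \<delta>" "path_gamma ?P = \<gamma>(d - 1 := 0, d := 0)" using IH by blast+
      show ?thesis
        unfolding eq path_data_double IH' size tilde_paths_snoc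
        by (intro conjI conjunct1[OF IH]) (use nz False ne in auto)
    qed
  qed
qed

lemma path_data_correct:
  fixes P :: "(step \<times> 'a::comm_monoid_add list) list"
  shows "P \<in> tilde_paths m \<Longrightarrow> (path_delta P, path_gamma P) \<in> functional_data m \<and>
    data_path m (path_delta P) (path_gamma P) = P"
proof (induction P arbitrary: m rule: rev_induct)
  case Nil
  then have "m = 0" by (auto simp: tilde_paths_def)
  then show ?case by (simp add: functional_data_0)
next
  case (snoc st P)
  let ?d = "path_size P" and ?\<delta> = "path_delta P" and ?\<gamma> = "path_gamma P"
  have P: "P \<in> tilde_paths ?d" and st: "[st] \<in> labeled_paths heis_steps"
    and ne: "P = [] \<Longrightarrow> fst st \<noteq> (0, 2)" and m: "m = ?d + fst (fst st) + snd (fst st)"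
    using snoc.prems unfolding tilde_paths_snoc by blast+
  have IH: "(?\<delta>, ?\<gamma>) \<in> functional_data ?d" "data_path ?d ?\<delta> ?\<gamma> = P"
    using snoc.IH[OF P] by auto
  note out = functional_data_outside[OF IH(1)]
  show ?case using st
  proof (cases rule: step_cases)
    case (short t)
    have m: "m = Suc ?d" using m short size_short_step[of t] by simp
    have \<delta>': "path_delta (P @ [st]) = ?\<delta>(?d := t)"
      using out(1) by (auto simp: short path_data_short)
    have \<gamma>': "path_gamma (P @ [st]) = ?\<gamma>" by (simp add: short path_data_short)
    have upd: "?\<delta>(?d := t, ?d := 0) = ?\<delta>" using out(1) by auto
    have "(?\<delta>(?d := t), ?\<gamma>) \<in> functional_data (Suc ?d)"
      using functional_data_short[of ?\<gamma> ?d "?\<delta>(?d := t)"] IH(1) out(2) upd by auto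
    moreover have "data_path (Suc ?d) (?\<delta>(?d := t)) ?\<gamma> = P @ [st]"
    proof (cases ?d)
      case 0
      then have "P = []" using P path_size_eq_0[of P] by (auto simp: tilde_paths_def)
      then show ?thesis using 0 by (simp add: short)
    next
      case (Suc e)
      then show ?thesis using IH(2) out(2)[of e] upd by (simp add: short)
    qed
    ultimately show ?thesis unfolding m \<delta>' \<gamma>' by blast
  next
    case (diagonal t)
    have m: "m = Suc (Suc ?d)" using m diagonal by simp
    have \<delta>': "path_delta (P @ [st]) = ?\<delta>" unfolding diagonal(1) by (rule path_data_diagonal)
    have \<gamma>': "path_gamma (P @ [st]) = ?\<gamma>(?d := t)"
      unfolding diagonal(1) path_data_diagonal using out(2) by auto
    have upd: "?\<gamma>(?d := t, ?d := 0) = ?\<gamma>" using out(2) by auto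
    have "(?\<delta>, ?\<gamma>(?d := t)) \<in> functional_data (Suc (Suc ?d))"
      using IH(1) out(2) diagonal
      by (subst functional_data_extend[of ?d ?\<gamma>]) auto
    moreover have "data_path (Suc (Suc ?d)) ?\<delta> (?\<gamma>(?d := t)) = P @ [st]"
    proof -
      have "?d = 0 \<or> (?\<gamma>(?d := t)) (?d - 1) = 0" using out(2)[of "?d - 1"] by (cases ?d) auto
      then show ?thesis unfolding data_path.simps fun_upd_same upd IH(2) using diagonal by simp
    qed
    ultimately show ?thesis unfolding m \<delta>' \<gamma>' by blast
  next
    case (double t u)
    have m: "m = Suc (Suc ?d)" using m double by simp
    have d: "?d \<noteq> 0" using ne double P path_size_eq_0[of P] by (auto simp: tilde_paths_def)
    have \<delta>': "path_delta (P @ [st]) = ?\<delta>" unfolding double(1) by (rule path_data_double)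
    have \<gamma>': "path_gamma (P @ [st]) = ?\<gamma>(?d - 1 := t, ?d := u)"
      unfolding double(1) path_data_double using out(2) d by auto
    have upd: "?\<gamma>(?d - 1 := t, ?d := u, ?d - 1 := 0, ?d := 0) = ?\<gamma>" using out(2) d by auto
    have "(?\<delta>, ?\<gamma>(?d - 1 := t, ?d := u)) \<in> functional_data (Suc (Suc ?d))"
      using IH(1) out(2) double d
      by (subst functional_data_extend[of ?d ?\<gamma>]) auto
    moreover have "data_path (Suc (Suc ?d)) ?\<delta> (?\<gamma>(?d - 1 := t, ?d := u)) = P @ [st]"
    proof -
      have "?d - 1 \<noteq> ?d" using d by simp
      then show ?thesis using IH(2) upd double d by simp
    qed
    ultimately show ?thesis unfolding m \<delta>' \<gamma>' by blast
  qed
qed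

lemma bij_betw_path_data:
  "bij_betw (\<lambda>P :: (step \<times> 'a::comm_monoid_add list) list. (path_delta P, path_gamma P))
     (tilde_paths m) (functional_data m)"
  by (rule bij_betw_byWitness[where f' = "\<lambda>(\<delta>, \<gamma>). data_path m \<delta> \<gamma>"])
    (use path_data_correct data_path_correct in \<open>fast+\<close>)

subsection \<open>Counting paths\<close>

definition labelings :: "step list \<Rightarrow> (step \<times> 'a::zero list) list set" where
  "labelings p = {P \<in> labeled_paths heis_steps. map fst P = p}"

lemma card_nonzero_lists:
  "finite {ts :: 'a::{zero, finite} list. length ts = k \<and> 0 \<notin> set ts}"
  "card {ts :: 'a::{zero, finite} list. length ts = k \<and> 0 \<notin> set ts} = (card (UNIV :: 'a set) - 1) ^ k"
proof -
  have eq: "{ts :: 'a list. length ts = k \<and> 0 \<notin> set ts} = {ts. set ts \<subseteq> UNIV - {0} \<and> length ts = k}"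
    by auto
  show "finite {ts :: 'a list. length ts = k \<and> 0 \<notin> set ts}"
    unfolding eq by (rule finite_lists_length_eq) simp
  show "card {ts :: 'a list. length ts = k \<and> 0 \<notin> set ts} = (card (UNIV :: 'a set) - 1) ^ k"
    unfolding eq by (subst card_lists_length_eq) (simp_all add: card_Diff_singleton)
qed

text \<open>A step carries as many labels as its height, so the labels of a path number
  \<open>snd (path_end p)\<close> in all, each with \<open>q - 1\<close> choices.\<close>

lemma card_labelings:
  "set p \<subseteq> heis_steps \<Longrightarrow> finite (labelings p :: (step \<times> 'a::{zero, finite} list) list set) \<and>
    card (labelings p :: (step \<times> 'a list) list set) = (card (UNIV :: 'a set) - 1) ^ snd (path_end p)"
proof (induction p)
  case Nil
  have "labelings [] = ({[]} :: (step \<times> 'a list) list set)"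
    by (auto simp: labelings_def labeled_paths_def)
  then show ?case by (simp add: path_end_def)
next
  case (Cons s p)
  let ?T = "{ts :: 'a list. length ts = snd s \<and> 0 \<notin> set ts}"
  have eq: "labelings (s # p) = (\<lambda>(ts, P). (s, ts) # P) ` (?T \<times> labelings p)"
    using Cons.prems by (force simp: labelings_def labeled_paths_def)
  have "inj_on (\<lambda>(ts, P). (s, ts) # P) (?T \<times> labelings p)" by (auto simp: inj_on_def)
  then have "card (labelings (s # p) :: (step \<times> 'a list) list set) =
      card ?T * card (labelings p :: (step \<times> 'a list) list set)"
    unfolding eq by (simp add: card_image card_cartesian_product)
  moreover have "finite (labelings (s # p) :: (step \<times> 'a list) list set)"
    unfolding eq using Cons card_nonzero_lists(1)[where 'a = 'a] by auto
  ultimately show ?case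
    using Cons card_nonzero_lists(2)[where 'a = 'a, of "snd s"] by (simp add: path_end_def power_add)
qed

text \<open>Every step raises the coordinate sum; this bounds the length of paths and hence makes
  them finitely many.\<close>

lemma length_le_path_end:
  "set p \<subseteq> heis_steps \<Longrightarrow> length p \<le> fst (path_end p) + snd (path_end p)"
  by (induction p) (auto simp: path_end_def heis_steps_def)

text \<open>Sorting by the height \<open>k\<close> of the end point produces the terms of
  \<open>heis_poly\<close> at \<open>q - 1\<close>.\<close>

lemma card_heis_paths:
  "finite (heis_paths (Suc r) :: (step \<times> 'a::{zero, finite} list) list set)"
  "card (heis_paths (Suc r) :: (step \<times> 'a list) list set) =
     (\<Sum>k\<le>r. num_paths (r - k) k * (card (UNIV :: 'a set) - 1) ^ k)"
proof -
  define A where "A k = {p. set p \<subseteq> heis_steps \<and> path_end p = (r - k, k)}" for k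
  have finA: "finite (A k)" if "k \<le> r" for k
  proof (rule finite_subset)
    show "A k \<subseteq> {p. set p \<subseteq> heis_steps \<and> length p \<le> r}"
      using length_le_path_end that by (force simp: A_def)
    show "finite {p. set p \<subseteq> heis_steps \<and> length p \<le> r}"
      by (rule finite_lists_length_le) (simp add: heis_steps_def)
  qed
  have lab: "finite (labelings p :: (step \<times> 'a list) list set)"
    "card (labelings p :: (step \<times> 'a list) list set) = (card (UNIV :: 'a set) - 1) ^ k" if "p \<in> A k" for p k
    using card_labelings[of p, where 'a = 'a] that by (auto simp: A_def)
  have U: "heis_paths (Suc r) = (\<Union>k\<in>{..r}. \<Union>p\<in>A k. labelings p :: (step \<times> 'a list) list set)"
  proof (intro equalityI subsetI)
    fix P :: "(step \<times> 'a list) list" assume P: "P \<in> heis_paths (Suc r)"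
    let ?k = "snd (path_end (map fst P))"
    have "path_end (map fst P) = (r - ?k, ?k)" "?k \<le> r"
      using P by (auto simp: heis_paths_def prod_eq_iff)
    moreover have "set (map fst P) \<subseteq> heis_steps"
      using P by (auto simp: heis_paths_def labeled_paths_def)
    moreover have "P \<in> labelings (map fst P)"
      using P by (auto simp: heis_paths_def labelings_def)
    ultimately show "P \<in> (\<Union>k\<in>{..r}. \<Union>p\<in>A k. labelings p)" unfolding A_def by blast
  qed (auto simp: A_def labelings_def heis_paths_def)
  show "finite (heis_paths (Suc r) :: (step \<times> 'a list) list set)"
    unfolding U using finA lab by auto
  have "card (heis_paths (Suc r) :: (step \<times> 'a list) list set) =
      (\<Sum>k\<le>r. card (\<Union>p\<in>A k. labelings p :: (step \<times> 'a list) list set))"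
    unfolding U using finA lab
    by (intro card_UN_disjoint) (auto simp: A_def labelings_def)
  also have "\<dots> = (\<Sum>k\<le>r. \<Sum>p\<in>A k. card (labelings p :: (step \<times> 'a list) list set))"
    using finA lab by (intro sum.cong card_UN_disjoint) (auto simp: labelings_def)
  also have "\<dots> = (\<Sum>k\<le>r. num_paths (r - k) k * (card (UNIV :: 'a set) - 1) ^ k)"
    using lab by (intro sum.cong) (auto simp: num_paths_def A_def)
  finally show "card (heis_paths (Suc r) :: (step \<times> 'a list) list set) = \<dots>" .
qed

lemma int_card_minus_1:
  "int (card (UNIV :: 'a::finite set)) - 1 = int (card (UNIV :: 'a set) - 1)"
  using finite_UNIV_card_ge_0[where 'a = 'a] by simp

lemma poly_heis_poly:
  "poly (heis_poly (int (Suc r))) (int (card (UNIV :: 'a::{zero, finite} set)) - 1) =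
     int (card (heis_paths (Suc r) :: (step \<times> 'a list) list set))"
proof -
  have "heis_poly (int (Suc r)) = (\<Sum>k\<le>r. monom (int (num_paths (r - k) k)) k)"
    by (simp add: heis_poly_def Let_def)
  then show ?thesis
    unfolding int_card_minus_1
    by (simp add: poly_sum poly_monom card_heis_paths del: of_nat_diff)
qed

lemma labeled_paths_Cons:
  "st # P \<in> labeled_paths S \<longleftrightarrow> [st] \<in> labeled_paths S \<and> P \<in> labeled_paths S"
  by (auto simp: labeled_paths_def)

text \<open>Deleting an initial \<open>(0, 2)\<close> loses two labels and two units of size, which
  accounts for the subtracted term \<open>x^2\<close> times the polynomial of index
  \<open>n - 2\<close>.\<close>

lemma card_heis_paths_tilde:
  assumes "n \<ge> 1"
  shows "int (card (heis_paths_tilde n :: (step \<times> 'a::{zero, finite} list) list set)) =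
    poly (heis_poly_tilde (int n)) (int (card (UNIV :: 'a set)) - 1)"
proof -
  define B where "B = {P \<in> heis_paths n. P \<noteq> [] \<and> fst (hd P) = (0, 2)} \<inter>
    (UNIV :: (step \<times> 'a list) list set)"
  obtain r where r: "n = Suc r" using assms by (cases n) auto
  have fin: "finite (heis_paths n :: (step \<times> 'a list) list set)"
    using card_heis_paths(1)[of r, where 'a = 'a] r by simp
  have "heis_paths n = heis_paths_tilde n \<union> B" "heis_paths_tilde n \<inter> B = {}" "finite B"
    "finite (heis_paths_tilde n :: (step \<times> 'a list) list set)"
    using fin by (auto simp: heis_paths_tilde_def B_def)
  then have split: "card (heis_paths n :: (step \<times> 'a list) list set) =
      card (heis_paths_tilde n :: (step \<times> 'a list) list set) + card B"
    using card_Un_disjoint by metis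
  have "int (card B) = (int (card (UNIV :: 'a set)) - 1)\<^sup>2 * poly (heis_poly (int n - 2)) (int (card (UNIV :: 'a set)) - 1)"
  proof (cases "n \<le> 2")
    case True
    \<comment> \<open>The size \<open>n - 1\<close> is at most 1, too small for a step
      \<open>(0, 2)\<close>; correspondingly \<open>heis_poly\<close> is 0 at indices up to
      0.\<close>
    have "B = {}"
    proof (rule equals0I)
      fix P assume "P \<in> B"
      then show False using True by (cases P) (auto simp: B_def heis_paths_def path_end_def)
    qed
    then show ?thesis using True by (simp add: heis_poly_def)
  next
    case False
    then obtain r' where r': "n = Suc (Suc (Suc r'))" by (metis Suc_le_D not_less_eq_eq numeral_2_eq_2)
    let ?T = "{ts :: 'a list. length ts = 2 \<and> 0 \<notin> set ts}"
    have "B = (\<lambda>(ts, P). ((0, 2), ts) # P) ` (?T \<times> heis_paths (Suc r'))"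
    proof (intro equalityI subsetI)
      fix P assume P: "P \<in> B"
      then obtain ts Q where PQ: "P = ((0, 2), ts) # Q"
        unfolding B_def by (cases P) (auto simp: prod_eq_iff)
      then have "ts \<in> ?T" "Q \<in> heis_paths (Suc r')"
        using P r' by (auto simp: B_def heis_paths_def labeled_paths_def path_end_def)
      then show "P \<in> (\<lambda>(ts, P). ((0, 2), ts) # P) ` (?T \<times> heis_paths (Suc r'))"
        using PQ by auto
    next
      fix P assume "P \<in> (\<lambda>(ts, P). ((0, 2), ts) # P) ` (?T \<times> heis_paths (Suc r'))"
      then obtain ts Q where PQ: "P = ((0, 2), ts) # Q" "ts \<in> ?T" "Q \<in> heis_paths (Suc r')"
        by auto
      then have "[((0, 2), ts)] \<in> labeled_paths heis_steps"
        by (auto simp: labeled_paths_def heis_steps_def)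
      then show "P \<in> B"
        using PQ r' by (auto simp: B_def heis_paths_def labeled_paths_Cons[of "((0, 2), ts)" Q] path_end_def)
    qed
    moreover have "inj_on (\<lambda>(ts, P). ((0, 2), ts) # P) (?T \<times> heis_paths (Suc r'))"
      by (auto simp: inj_on_def)
    ultimately have "card B = (card (UNIV :: 'a set) - 1)\<^sup>2 *
        card (heis_paths (Suc r') :: (step \<times> 'a list) list set)"
      by (simp add: card_image card_cartesian_product card_nonzero_lists(2))
    then have "int (card B) = (int (card (UNIV :: 'a set)) - 1)\<^sup>2 *
        int (card (heis_paths (Suc r') :: (step \<times> 'a list) list set))"
      unfolding int_card_minus_1 by (simp del: of_nat_diff)
    moreover have "int n - 2 = int (Suc r')" using r' by simp
    ultimately show ?thesis using poly_heis_poly[of r', where 'a = 'a] by metis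
  qed
  moreover have "poly (heis_poly (int n)) (int (card (UNIV :: 'a set)) - 1) =
      int (card (heis_paths n :: (step \<times> 'a list) list set))"
    unfolding r by (rule poly_heis_poly)
  ultimately show ?thesis
    using split by (simp add: heis_poly_tilde_def poly_monom)
qed

subsection \<open>Unitriangular matrices\<close>

text \<open>Contains the unitriangular and the strictly upper triangular matrices, so that one
  product formula with a sum over \<open>i..k\<close> serves both.\<close>

definition upper_mats :: "nat \<Rightarrow> 'a::zero mat set" where
  "upper_mats n = {M \<in> carrier_mat n n. \<forall>i<n. \<forall>j<i. M $$ (i, j) = 0}"

definition unitri :: "nat \<Rightarrow> 'a::zero_neq_one mat set" where
  "unitri n = {M \<in> upper_mats n. \<forall>i<n. M $$ (i, i) = 1}"

lemma strictly_upper_upper: "X \<in> strictly_upper n \<Longrightarrow> X \<in> upper_mats n"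
  by (auto simp: strictly_upper_def upper_mats_def)

lemma upper_mats_mult_index:
  fixes A B :: "'a::semiring_0 mat"
  assumes "A \<in> upper_mats n" "B \<in> upper_mats n" "i < n" "k < n"
  shows "(A * B) $$ (i, k) = (\<Sum>l=i..k. A $$ (i, l) * B $$ (l, k))"
proof -
  have "(A * B) $$ (i, k) = (\<Sum>l\<in>{0..<n}. A $$ (i, l) * B $$ (l, k))"
    using assms by (auto simp: upper_mats_def scalar_prod_def intro!: sum.cong)
  also have "\<dots> = (\<Sum>l=i..k. A $$ (i, l) * B $$ (l, k))"
  proof (rule sum.mono_neutral_right)
    show "\<forall>l\<in>{0..<n} - {i..k}. A $$ (i, l) * B $$ (l, k) = 0"
    proof
      fix l assume "l \<in> {0..<n} - {i..k}"
      then have "l < i \<or> k < l" "l < n" by auto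
      then show "A $$ (i, l) * B $$ (l, k) = 0" using assms by (auto simp: upper_mats_def)
    qed
  qed (use assms in auto)
  finally show ?thesis .
qed

lemma upper_mats_mult: "A \<in> upper_mats n \<Longrightarrow> B \<in> upper_mats n \<Longrightarrow> A * B \<in> upper_mats n"
  for A B :: "'a::semiring_0 mat"
  using upper_mats_mult_index[of A n B]
  by (auto simp: upper_mats_def)

lemma unitri_mult: "A \<in> unitri n \<Longrightarrow> B \<in> unitri n \<Longrightarrow> A * B \<in> unitri n"
  for A B :: "'a::ring_1 mat"
  using upper_mats_mult[of A n B] upper_mats_mult_index[of A n B] by (auto simp: unitri_def)

lemma one_unitri: "1\<^sub>m n \<in> unitri n"
  by (auto simp: unitri_def upper_mats_def)

lemma carrier_unitriangular: "carrier (unitriangular_group n :: 'a::ring_1 mat monoid) = unitri n"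
proof (intro equalityI subsetI)
  fix M :: "'a mat" assume M: "M \<in> unitri n"
  have "M = 1\<^sub>m n + (M - 1\<^sub>m n)" "M - 1\<^sub>m n \<in> strictly_upper n"
    using M by (auto simp: unitri_def upper_mats_def strictly_upper_def le_less)
  then show "M \<in> carrier (unitriangular_group n)"
    unfolding unitriangular_group_def by auto
qed (auto simp: unitriangular_group_def unitri_def upper_mats_def strictly_upper_def)

lemma finite_carrier_mat: "finite (carrier_mat n m :: 'a::finite mat set)"
proof (rule finite_subset)
  show "carrier_mat n m \<subseteq> (\<lambda>f. mat n m f) ` (({..<n} \<times> {..<m}) \<rightarrow>\<^sub>E (UNIV :: 'a set))"
  proof
    fix M :: "'a mat" assume M: "M \<in> carrier_mat n m"
    let ?f = "restrict (\<lambda>ij. M $$ ij) ({..<n} \<times> {..<m})"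
    have "M = mat n m ?f" using M by (intro eq_matI) auto
    moreover have "?f \<in> ({..<n} \<times> {..<m}) \<rightarrow>\<^sub>E UNIV" by auto
    ultimately show "M \<in> (\<lambda>f. mat n m f) ` (({..<n} \<times> {..<m}) \<rightarrow>\<^sub>E UNIV)" by blast
  qed
qed (intro finite_imageI finite_PiE, auto)

lemma finite_unitri: "finite (unitri n :: 'a::{zero_neq_one, finite} mat set)"
  by (rule finite_subset[OF _ finite_carrier_mat]) (auto simp: unitri_def upper_mats_def)

lemma unitri_invertible:
  fixes M :: "'a::field mat"
  assumes "M \<in> unitri n"
  shows "\<exists>B\<in>carrier_mat n n. M * B = 1\<^sub>m n"
proof -
  have M: "M \<in> carrier_mat n n" "upper_triangular M"
    using assms by (auto simp: unitri_def upper_mats_def)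
  have "0 \<notin> set (diag_mat M)" using assms M(1) by (auto simp: diag_mat_def unitri_def)
  then have "det M \<noteq> 0" using det_upper_triangular[OF M(2,1)] by (simp add: prod_list_zero_iff)
  from det_non_zero_imp_unit[OF M(1) this, of "()"] show ?thesis
    by (auto simp: Units_def ring_mat_simps)
qed

text \<open>That inverses stay unitriangular is obtained by finiteness: right multiplication by
  \<open>x\<close> is injective on \<open>unitri n\<close>, hence surjective, so it hits the
  identity.\<close>

lemma group_unitriangular: "group (unitriangular_group n :: 'a::{field, finite} mat monoid)"
proof (rule groupI; unfold carrier_unitriangular)
  let ?G = "unitriangular_group n :: 'a mat monoid"
  have sub: "M \<in> unitri n \<Longrightarrow> M \<in> carrier_mat n n" for M :: "'a mat"
    by (auto simp: unitri_def upper_mats_def)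
  show "x \<otimes>\<^bsub>?G\<^esub> y \<in> unitri n" if "x \<in> unitri n" "y \<in> unitri n" for x y
    using unitri_mult that by (simp add: unitriangular_group_def)
  show "\<one>\<^bsub>?G\<^esub> \<in> unitri n" by (simp add: unitriangular_group_def one_unitri)
  show "x \<otimes>\<^bsub>?G\<^esub> y \<otimes>\<^bsub>?G\<^esub> z = x \<otimes>\<^bsub>?G\<^esub> (y \<otimes>\<^bsub>?G\<^esub> z)"
    if "x \<in> unitri n" "y \<in> unitri n" "z \<in> unitri n" for x y z
    using that sub by (simp add: unitriangular_group_def assoc_mult_mat[of _ n n _ n _ n])
  show "\<one>\<^bsub>?G\<^esub> \<otimes>\<^bsub>?G\<^esub> x = x" if "x \<in> unitri n" for x
    using left_mult_one_mat[OF sub[OF that]] by (simp add: unitriangular_group_def)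
  show "\<exists>y\<in>unitri n. y \<otimes>\<^bsub>?G\<^esub> x = \<one>\<^bsub>?G\<^esub>" if x: "x \<in> unitri n" for x
  proof -
    obtain B where B: "B \<in> carrier_mat n n" "x * B = 1\<^sub>m n" using unitri_invertible[OF x] by blast
    have "inj_on (\<lambda>y. y * x) (unitri n)"
    proof (rule inj_onI)
      fix y z assume yz: "y \<in> unitri n" "z \<in> unitri n" "y * x = z * x"
      then have "y * x * B = z * x * B" by simp
      then show "y = z"
        using yz(1,2) x B sub
        by (simp add: assoc_mult_mat[of _ n n _ n _ n] right_mult_one_mat[of _ n n])
    qed
    then have "(\<lambda>y. y * x) ` unitri n = unitri n"
      using x by (intro endo_inj_surj finite_unitri) (auto intro: unitri_mult)
    then have "\<exists>y\<in>unitri n. y * x = 1\<^sub>m n" using one_unitri by (metis imageE)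
    then show ?thesis by (simp add: unitriangular_group_def)
  qed
qed

text \<open>The value 0 beyond the matrix makes the product rules below valid for every
  \<open>p\<close>.\<close>

definition superdiag :: "nat \<Rightarrow> nat \<Rightarrow> nat \<Rightarrow> 'a::zero mat \<Rightarrow> 'a" where
  "superdiag n k p M = (if p + k < n then M $$ (p, p + k) else 0)"

lemma superdiag_mult:
  fixes A B :: "'a::ring_1 mat"
  assumes "A \<in> unitri n" "B \<in> unitri n"
  shows "superdiag n (Suc 0) p (A * B) = superdiag n (Suc 0) p A + superdiag n (Suc 0) p B"
    "superdiag n 2 p (A * B) = superdiag n 2 p A + superdiag n 2 p B +
       superdiag n (Suc 0) p A * superdiag n (Suc 0) (Suc p) B"
proof -
  have idx: "(A * B) $$ (i, k) = (\<Sum>l=i..k. A $$ (i, l) * B $$ (l, k))" if "i < n" "k < n" for i k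
    using upper_mats_mult_index that assms by (auto simp: unitri_def)
  have diag: "i < n \<Longrightarrow> A $$ (i, i) = 1" "i < n \<Longrightarrow> B $$ (i, i) = 1" for i
    using assms by (auto simp: unitri_def)
  show "superdiag n (Suc 0) p (A * B) = superdiag n (Suc 0) p A + superdiag n (Suc 0) p B"
    by (simp add: superdiag_def idx diag add.commute)
  have "{p..Suc (Suc p)} = {p, Suc p, Suc (Suc p)}" by auto
  then show "superdiag n 2 p (A * B) = superdiag n 2 p A + superdiag n 2 p B +
       superdiag n (Suc 0) p A * superdiag n (Suc 0) (Suc p) B"
    by (simp add: superdiag_def idx diag add.commute add.left_commute)
qed

lemma heis_group_unitriangular:
  fixes \<theta> :: "'a::{field, finite} \<Rightarrow> complex"
  assumes "n \<ge> 1" "nontrivial_additive_character \<theta>"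
  shows "heis_group (unitriangular_group n) \<theta> (n - 1) (superdiag n (Suc 0)) (superdiag n 2)"
proof -
  interpret group "unitriangular_group n :: 'a mat monoid" by (rule group_unitriangular)
  let ?G = "unitriangular_group n :: 'a mat monoid"
  have mult: "g \<otimes>\<^bsub>?G\<^esub> h = g * h" for g h by (simp add: unitriangular_group_def)
  show ?thesis
  proof unfold_locales
    fix x y :: "nat \<Rightarrow> 'a"
    let ?M = "mat n n (\<lambda>(i, j). if i = j then 1 else if j = Suc i then x i
      else if j = Suc (Suc i) then y i else 0)"
    have "?M \<in> unitri n" by (auto simp: unitri_def upper_mats_def)
    then show "\<exists>g\<in>carrier ?G. (\<forall>p<n - 1. superdiag n (Suc 0) p g = x p) \<and>
        (\<forall>p. Suc p < n - 1 \<longrightarrow> superdiag n 2 p g = y p)"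
      by (intro bexI[of _ ?M]) (auto simp: superdiag_def carrier_unitriangular)
    show "superdiag n (Suc 0) p g = 0" if "n - 1 \<le> p" for p and g :: "'a mat"
      using that assms(1) by (simp add: superdiag_def)
    show "superdiag n 2 p g = 0" if "n - 1 \<le> Suc p" for p and g :: "'a mat"
      using that assms(1) by (simp add: superdiag_def)
  qed (use assms(2) in \<open>auto simp: carrier_unitriangular finite_unitri mult superdiag_mult\<close>)
qed

subsection \<open>The polarization of a path functional\<close>

definition diag_functional :: "nat \<Rightarrow> (nat \<Rightarrow> 'a) \<Rightarrow> (nat \<Rightarrow> 'a) \<Rightarrow> 'a::ring_1 mat \<Rightarrow> 'a" where
  "diag_functional n \<delta> \<gamma> X =
     (\<Sum>p<n - 1. \<delta> p * superdiag n (Suc 0) p X) + (\<Sum>p<n - 1. \<gamma> p * superdiag n 2 p X)"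

lemma path_functional_snoc:
  "path_functional (P @ [st]) X = path_functional P X + step_functional (path_size P + 1) st X"
  by (simp add: path_functional_def path_size_def start_sum_append nth_append)

lemma sum_add_single:
  fixes f h :: "nat \<Rightarrow> 'a::semiring_0"
  assumes "d < k"
  shows "(\<Sum>p<k. (f p + (if p = d then t else 0)) * h p) = (\<Sum>p<k. f p * h p) + t * h d"
proof -
  have "(\<Sum>p<k. (f p + (if p = d then t else 0)) * h p) =
      (\<Sum>p<k. f p * h p + (if p = d then t * h d else 0))"
    by (rule sum.cong) (auto simp: distrib_right)
  then show ?thesis using assms by (simp add: sum.distrib)
qed

text \<open>A proper prefix has smaller size than the path, so the induction needs
  \<open>m \<le> n - 1\<close> in place of equality.\<close>

lemma path_functional_eq:
  fixes P :: "(step \<times> 'a::ring_1 list) list"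
  shows "P \<in> tilde_paths m \<Longrightarrow> m \<le> n - 1 \<Longrightarrow>
    path_functional P X = diag_functional n (path_delta P) (path_gamma P) X"
proof (induction P arbitrary: m rule: rev_induct)
  case Nil
  then show ?case by (simp add: path_functional_def diag_functional_def)
next
  case (snoc st P)
  let ?d = "path_size P"
  have P: "P \<in> tilde_paths ?d" and st: "[st] \<in> labeled_paths heis_steps"
    and ne: "P = [] \<Longrightarrow> fst st \<noteq> (0, 2)" and m: "m = ?d + fst (fst st) + snd (fst st)"
    using snoc.prems unfolding tilde_paths_snoc by blast+
  have IH: "path_functional P X = diag_functional n (path_delta P) (path_gamma P) X"
    using snoc.IH[OF P] snoc.prems(2) m by simp
  show ?case using st
  proof (cases rule: step_cases)
    case (short t)
    have d: "?d < n - 1" using m snoc.prems(2) size_short_step[of t] short by simp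
    then have step: "step_functional (?d + 1) (short_step t) X = t * superdiag n (Suc 0) ?d X"
      using less_diff_conv[of ?d n 1] by (simp add: short_step_def step_functional_def matrix_coord_def superdiag_def)
    show ?thesis
      unfolding path_functional_snoc IH
      unfolding short step path_data_short diag_functional_def sum_add_single[OF d]
      by (simp add: add_ac)
  next
    case (diagonal t)
    have d: "?d < n - 1" "Suc (Suc ?d) < n" using m snoc.prems(2) diagonal by auto
    have step: "step_functional (?d + 1) ((1, 1), [t]) X = t * superdiag n 2 ?d X"
      using d by (simp add: step_functional_def matrix_coord_def superdiag_def)
    show ?thesis
      unfolding path_functional_snoc IH
      unfolding diagonal(1) step path_data_diagonal diag_functional_def sum_add_single[OF d(1)]
      by (simp add: add_ac)
  next
    case (double t u)
    have d: "?d < n - 1" "?d - 1 < n - 1" "Suc (Suc ?d) < n"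
      using m snoc.prems(2) double by auto
    have d0: "?d \<noteq> 0" using ne double P path_size_eq_0[of P] by (auto simp: tilde_paths_def)
    have step: "step_functional (?d + 1) st X = t * superdiag n 2 (?d - 1) X + u * superdiag n 2 ?d X"
      using d d0 by (cases ?d) (auto simp: double step_functional_def matrix_coord_def superdiag_def)
    have \<gamma>: "path_gamma (P @ [st]) = (\<lambda>p. path_gamma P p + (if p = ?d then u else 0) +
        (if p = ?d - 1 then t else 0))"
      unfolding double(1) path_data_double using d0 by (intro ext) auto
    have \<delta>: "path_delta (P @ [st]) = path_delta P"
      unfolding double(1) by (rule path_data_double)
    show ?thesis
      unfolding path_functional_snoc IH step \<gamma> \<delta> diag_functional_def
        sum_add_single[OF d(1)] sum_add_single[OF d(2)]
      by (simp add: add_ac)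
  qed
qed

lemma superdiag_mult_strictly_upper:
  fixes X Y :: "'a::ring_1 mat"
  assumes "X \<in> strictly_upper n" "Y \<in> strictly_upper n"
  shows "superdiag n (Suc 0) p (X * Y) = 0"
    "superdiag n 2 p (X * Y) = superdiag n (Suc 0) p X * superdiag n (Suc 0) (Suc p) Y"
proof -
  have idx: "(X * Y) $$ (i, k) = (\<Sum>l=i..k. X $$ (i, l) * Y $$ (l, k))" if "i < n" "k < n" for i k
    using upper_mats_mult_index that assms strictly_upper_upper by blast
  have diag: "i < n \<Longrightarrow> X $$ (i, i) = 0" "i < n \<Longrightarrow> Y $$ (i, i) = 0" for i
    using assms by (auto simp: strictly_upper_def)
  show "superdiag n (Suc 0) p (X * Y) = 0" by (simp add: superdiag_def idx diag)
  have "{p..Suc (Suc p)} = {p, Suc p, Suc (Suc p)}" by auto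
  then show "superdiag n 2 p (X * Y) = superdiag n (Suc 0) p X * superdiag n (Suc 0) (Suc p) Y"
    by (simp add: superdiag_def idx diag)
qed

definition unit_superdiag :: "nat \<Rightarrow> nat \<Rightarrow> 'a::zero_neq_one mat" where
  "unit_superdiag n q = mat n n (\<lambda>(i, j). if i = q \<and> j = Suc q then 1 else 0)"

lemma unit_superdiag:
  assumes "Suc q < n"
  shows "(unit_superdiag n q :: 'a::zero_neq_one mat) \<in> strictly_upper n"
    "superdiag n (Suc 0) p (unit_superdiag n q :: 'a mat) = (if p = q then 1 else 0)"
  using assms by (auto simp: unit_superdiag_def strictly_upper_def superdiag_def)

context
  fixes n :: nat and \<mu> :: "'a::field mat \<Rightarrow> 'a" and \<delta> \<gamma> :: "nat \<Rightarrow> 'a"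
  assumes \<gamma>: "supp_below (n - 1) \<gamma>" and \<mu>: "\<mu> = diag_functional n \<delta> \<gamma>"
begin

lemma functional_mult:
  assumes "X \<in> strictly_upper n" "Y \<in> strictly_upper n"
  shows "\<mu> (X * Y) = (\<Sum>p<n - 1. \<gamma> p * (superdiag n (Suc 0) p X * superdiag n (Suc 0) (Suc p) Y))"
  by (simp only: \<mu> diag_functional_def superdiag_mult_strictly_upper[OF assms]) simp

text \<open>A test matrix that isolates position \<open>p\<close> of \<open>X\<close>; the converse
  inclusions of both stage lemmas rest on it.\<close>

lemma functional_mult_unit:
  assumes "X \<in> strictly_upper n" "\<gamma> p \<noteq> 0"
  shows "\<mu> (X * unit_superdiag n (Suc p)) = \<gamma> p * superdiag n (Suc 0) p X"
proof -
  have p: "Suc p < n - 1" "Suc (Suc p) < n" using \<gamma> assms(2) by (auto simp: supp_below_def)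
  have "\<mu> (X * unit_superdiag n (Suc p)) =
      (\<Sum>q<n - 1. if q = p then \<gamma> p * superdiag n (Suc 0) p X else 0)"
    unfolding functional_mult[OF assms(1) unit_superdiag(1)[OF p(2)]] unit_superdiag(2)[OF p(2)]
    by (rule sum.cong) auto
  then show ?thesis using p by simp
qed

text \<open>Closed form of \<open>l_seq n \<mu> (Suc i)\<close>, with the index shifted by one so
  that it pairs with \<open>s_seq n \<mu> i\<close>, whose closed form is
  \<open>s_stage i\<close>.\<close>

definition l_stage :: "nat \<Rightarrow> 'a mat set" where
  "l_stage i = {X \<in> strictly_upper n. \<forall>p. superdiag n (Suc 0) p X \<noteq> 0 \<longrightarrow>
     even (run_length \<gamma> p) \<and> run_length \<gamma> p \<le> 2 * i}"

definition s_stage :: "nat \<Rightarrow> 'a mat set" where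
  "s_stage i = {X \<in> strictly_upper n. \<forall>p. superdiag n (Suc 0) p X \<noteq> 0 \<longrightarrow>
     \<not> (odd (run_length \<gamma> p) \<and> run_length \<gamma> p < 2 * i)}"

text \<open>Position \<open>p\<close> of \<open>X\<close> meets only position \<open>Suc p\<close>
  of \<open>Y\<close>, weighted by \<open>\<gamma> p\<close>, and its run length is one larger. So
  \<open>X\<close> may be nonzero at \<open>p\<close> exactly if \<open>\<gamma> p = 0\<close> or
  \<open>s_stage i\<close> forbids \<open>Suc p\<close>, that is, if \<open>Suc p\<close> has odd
  run length below \<open>2 * i\<close>.\<close>

lemma l_stage_eq: "l_stage i = {X \<in> s_stage i. \<forall>Y\<in>s_stage i. \<mu> (X * Y) = 0}"
proof (intro equalityI subsetI)
  fix X assume X: "X \<in> l_stage i"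
  have "\<mu> (X * Y) = 0" if Y: "Y \<in> s_stage i" for Y
  proof -
    have XY: "X \<in> strictly_upper n" "Y \<in> strictly_upper n"
      using X Y by (auto simp: l_stage_def s_stage_def)
    have "\<gamma> p * (superdiag n (Suc 0) p X * superdiag n (Suc 0) (Suc p) Y) = 0" for p
    proof (rule ccontr)
      assume nz: "\<gamma> p * (superdiag n (Suc 0) p X * superdiag n (Suc 0) (Suc p) Y) \<noteq> 0"
      then have "even (run_length \<gamma> p) \<and> run_length \<gamma> p \<le> 2 * i"
        "\<not> (odd (run_length \<gamma> (Suc p)) \<and> run_length \<gamma> (Suc p) < 2 * i)"
        using X Y by (auto simp: l_stage_def s_stage_def)
      then show False using run_length_Suc[OF \<gamma>, of p] nz by simp
    qed
    then show ?thesis by (simp only: functional_mult[OF XY]) simp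
  qed
  then show "X \<in> {X \<in> s_stage i. \<forall>Y\<in>s_stage i. \<mu> (X * Y) = 0}"
    using X by (auto simp: l_stage_def s_stage_def)
next
  fix X assume X: "X \<in> {X \<in> s_stage i. \<forall>Y\<in>s_stage i. \<mu> (X * Y) = 0}"
  then have Xs: "X \<in> strictly_upper n" by (simp add: s_stage_def)
  have "even (run_length \<gamma> p) \<and> run_length \<gamma> p \<le> 2 * i" if nz: "superdiag n (Suc 0) p X \<noteq> 0" for p
  proof (cases "\<gamma> p = 0")
    case True
    then show ?thesis by (simp add: run_length_eq_0)
  next
    case False
    then have p: "Suc (Suc p) < n" using \<gamma> by (auto simp: supp_below_def)
    have "unit_superdiag n (Suc p) \<notin> s_stage i"
      using X functional_mult_unit[OF Xs False] nz False by auto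
    then have "odd (run_length \<gamma> (Suc p)) \<and> run_length \<gamma> (Suc p) < 2 * i"
      using unit_superdiag[OF p, where ?'a = 'a] by (auto simp: s_stage_def split: if_splits)
    then show ?thesis using run_length_Suc[OF \<gamma> False] by auto
  qed
  then show "X \<in> l_stage i" using Xs by (simp add: l_stage_def)
qed

text \<open>A position of odd run length \<open>k < 2 * Suc i\<close> has a right neighbour of even
  run length \<open>k - 1 \<le> 2 * i\<close>, where \<open>l_stage i\<close> admits nonzero
  entries; testing against these kills the position.\<close>

lemma s_stage_eq: "s_stage (Suc i) = {X \<in> s_stage i. \<forall>Y\<in>l_stage i. \<mu> (X * Y) = 0}"
proof (intro equalityI subsetI)
  fix X assume X: "X \<in> s_stage (Suc i)"
  have "\<mu> (X * Y) = 0" if Y: "Y \<in> l_stage i" for Y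
  proof -
    have XY: "X \<in> strictly_upper n" "Y \<in> strictly_upper n"
      using X Y by (auto simp: l_stage_def s_stage_def)
    have "\<gamma> p * (superdiag n (Suc 0) p X * superdiag n (Suc 0) (Suc p) Y) = 0" for p
    proof (rule ccontr)
      assume nz: "\<gamma> p * (superdiag n (Suc 0) p X * superdiag n (Suc 0) (Suc p) Y) \<noteq> 0"
      then have "even (run_length \<gamma> (Suc p)) \<and> run_length \<gamma> (Suc p) \<le> 2 * i"
        "\<not> (odd (run_length \<gamma> p) \<and> run_length \<gamma> p < 2 * Suc i)"
        using X Y by (auto simp: l_stage_def s_stage_def)
      then show False using run_length_Suc[OF \<gamma>, of p] nz by simp
    qed
    then show ?thesis by (simp only: functional_mult[OF XY]) simp
  qed
  then show "X \<in> {X \<in> s_stage i. \<forall>Y\<in>l_stage i. \<mu> (X * Y) = 0}"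
    using X by (auto simp: s_stage_def)
next
  fix X assume X: "X \<in> {X \<in> s_stage i. \<forall>Y\<in>l_stage i. \<mu> (X * Y) = 0}"
  then have Xs: "X \<in> strictly_upper n" by (simp add: s_stage_def)
  have "superdiag n (Suc 0) p X = 0" if odd: "odd (run_length \<gamma> p)" "run_length \<gamma> p < 2 * Suc i" for p
  proof -
    have nz: "\<gamma> p \<noteq> 0" using odd_run_length_nonzero odd(1) .
    then have p: "Suc (Suc p) < n" using \<gamma> by (auto simp: supp_below_def)
    have "unit_superdiag n (Suc p) \<in> l_stage i"
      using unit_superdiag[OF p, where ?'a = 'a] odd run_length_Suc[OF \<gamma> nz] by (auto simp: l_stage_def)
    then show ?thesis using X functional_mult_unit[OF Xs nz] nz by auto
  qed
  then show "X \<in> s_stage (Suc i)" using Xs by (auto simp: s_stage_def)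
qed

lemma seq_eq_stage: "s_seq n \<mu> i = s_stage i \<and> l_seq n \<mu> (Suc i) = l_stage i"
proof (induction i)
  case 0
  have "s_seq n \<mu> 0 = s_stage 0" by (simp add: s_stage_def)
  then show ?case using l_stage_eq[of 0] by simp
next
  case (Suc i)
  have "s_seq n \<mu> (Suc i) = s_stage (Suc i)"
    using Suc s_stage_eq[of i] by (simp only: s_seq.simps)
  then show ?case using l_stage_eq[of "Suc i"] by (simp only: l_seq.simps)
qed

lemma l_bar_eq:
  "l_bar n \<mu> = {X \<in> strictly_upper n. \<forall>p. odd (run_length \<gamma> p) \<longrightarrow> superdiag n (Suc 0) p X = 0}"
proof (intro equalityI subsetI)
  fix X assume "X \<in> l_bar n \<mu>"
  then obtain i where i: "X \<in> l_seq n \<mu> i" by (auto simp: l_bar_def)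
  show "X \<in> {X \<in> strictly_upper n. \<forall>p. odd (run_length \<gamma> p) \<longrightarrow> superdiag n (Suc 0) p X = 0}"
  proof (cases i)
    case 0
    then show ?thesis using i by (auto simp: strictly_upper_def superdiag_def)
  next
    case (Suc k)
    then show ?thesis using i seq_eq_stage[of k] by (auto simp: l_stage_def simp del: l_seq.simps)
  qed
next
  fix X :: "'a mat" assume X: "X \<in> {X \<in> strictly_upper n. \<forall>p. odd (run_length \<gamma> p) \<longrightarrow> superdiag n (Suc 0) p X = 0}"
  \<comment> \<open>A stage late enough for all runs: the sum bounds every run length that matters,
    so the size condition in \<open>l_stage\<close> is met.\<close>
  let ?i = "\<Sum>p<n. run_length \<gamma> p"
  have "run_length \<gamma> p \<le> 2 * ?i" if "superdiag n (Suc 0) p X \<noteq> 0" for p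
  proof -
    have "p < n" using that by (auto simp: superdiag_def split: if_splits)
    then have "run_length \<gamma> p \<le> ?i" by (intro member_le_sum) auto
    then show ?thesis by simp
  qed
  then have "X \<in> l_stage ?i" using X by (auto simp: l_stage_def)
  then show "X \<in> l_bar n \<mu>" using seq_eq_stage[of ?i] unfolding l_bar_def by blast
qed

end

subsection \<open>The third term of the lower central series\<close>

definition elem_mat :: "nat \<Rightarrow> nat \<Rightarrow> nat \<Rightarrow> 'a::zero_neq_one \<Rightarrow> 'a mat" where
  "elem_mat n i j t = mat n n (\<lambda>(r, s). if r = s then 1 else if r = i \<and> s = j then t else 0)"

lemma elem_mat_index:
  "r < n \<Longrightarrow> s < n \<Longrightarrow> elem_mat n i j t $$ (r, s) =
     (if r = s then 1 else if r = i \<and> s = j then t else 0)"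
  by (simp add: elem_mat_def)

lemma elem_mat_carrier [simp]: "elem_mat n i j t \<in> carrier_mat n n"
  by (simp add: elem_mat_def)

lemma elem_mat_unitri: "i < j \<Longrightarrow> elem_mat n i j t \<in> unitri n"
  by (auto simp: unitri_def upper_mats_def elem_mat_index)

lemma mult_elem_mat:
  fixes M :: "'a::comm_ring_1 mat"
  assumes "M \<in> carrier_mat n n" "i < n" "j < n" "i \<noteq> j" "r < n" "s < n"
  shows "(M * elem_mat n i j t) $$ (r, s) = M $$ (r, s) + (if s = j then M $$ (r, i) * t else 0)"
proof -
  have "(M * elem_mat n i j t) $$ (r, s) = (\<Sum>l\<in>{0..<n}. M $$ (r, l) * elem_mat n i j t $$ (l, s))"
    using assms by (auto simp: scalar_prod_def elem_mat_def intro!: sum.cong)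
  also have "\<dots> = (\<Sum>l\<in>{0..<n}. (if l = s then M $$ (r, s) else 0) +
      (if l = i then (if s = j then M $$ (r, i) * t else 0) else 0))"
    by (rule sum.cong) (use assms in \<open>auto simp: elem_mat_index\<close>)
  finally show ?thesis using assms by (simp add: sum.distrib)
qed

lemma elem_mat_mult:
  fixes M :: "'a::comm_ring_1 mat"
  assumes "M \<in> carrier_mat n n" "i < n" "j < n" "i \<noteq> j" "r < n" "s < n"
  shows "(elem_mat n i j t * M) $$ (r, s) = M $$ (r, s) + (if r = i then t * M $$ (j, s) else 0)"
proof -
  have "(elem_mat n i j t * M) $$ (r, s) = (\<Sum>l\<in>{0..<n}. elem_mat n i j t $$ (r, l) * M $$ (l, s))"
    using assms by (auto simp: scalar_prod_def elem_mat_def intro!: sum.cong)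
  also have "\<dots> = (\<Sum>l\<in>{0..<n}. (if l = r then M $$ (r, s) else 0) +
      (if l = j then (if r = i then t * M $$ (j, s) else 0) else 0))"
    by (rule sum.cong) (use assms in \<open>auto simp: elem_mat_index\<close>)
  finally show ?thesis using assms by (simp add: sum.distrib)
qed

text \<open>Checked entrywise in the inverse-free form \<open>h k = x (k h)\<close>.\<close>

lemma elem_mat_commutator:
  fixes s t :: "'a::{field, finite}" and n :: nat
  assumes "i < j" "j < k" "k < n"
  defines "G \<equiv> unitriangular_group n :: 'a mat monoid"
  shows "elem_mat n i j s \<otimes>\<^bsub>G\<^esub> elem_mat n j k t \<otimes>\<^bsub>G\<^esub> inv\<^bsub>G\<^esub> elem_mat n i j s \<otimes>\<^bsub>G\<^esub>
    inv\<^bsub>G\<^esub> elem_mat n j k t = elem_mat n i k (s * t)"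
proof -
  interpret group G unfolding G_def by (rule group_unitriangular)
  let ?h = "elem_mat n i j s" and ?k = "elem_mat n j k t" and ?x = "elem_mat n i k (s * t)"
  have mem: "?h \<in> carrier G" "?k \<in> carrier G" "?x \<in> carrier G"
    using assms(1-3) by (auto simp: G_def carrier_unitriangular intro!: elem_mat_unitri)
  have "?h * ?k = ?x * (?k * ?h)"
  proof (rule eq_matI)
    fix r c assume "r < dim_row (?x * (?k * ?h))" "c < dim_col (?x * (?k * ?h))"
    then have rc: "r < n" "c < n" by (auto simp: elem_mat_def)
    have "?k * ?h \<in> carrier_mat n n" by (rule mult_carrier_mat[of _ n n]) auto
    then show "(?h * ?k) $$ (r, c) = (?x * (?k * ?h)) $$ (r, c)"
      using rc assms(1-3)
      by (simp add: elem_mat_mult mult_elem_mat elem_mat_index)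
  qed (auto simp: elem_mat_def)
  then have "?h \<otimes>\<^bsub>G\<^esub> ?k = ?x \<otimes>\<^bsub>G\<^esub> (?k \<otimes>\<^bsub>G\<^esub> ?h)" by (simp add: G_def unitriangular_group_def)
  then have "?h \<otimes>\<^bsub>G\<^esub> ?k \<otimes>\<^bsub>G\<^esub> inv\<^bsub>G\<^esub> (?k \<otimes>\<^bsub>G\<^esub> ?h) = ?x"
    using mem by (simp add: m_assoc)
  then show ?thesis using mem by (simp add: inv_mult_group m_assoc)
qed

text \<open>Elimination by column operations from \<open>[G, [G, G]]\<close>, with induction on the
  number of nonzero entries above the diagonal. This supplies the inclusion opposite to
  \<open>commutator_subgroup_subset_U3\<close>.\<close>

lemma unitriangular_lower_central:
  fixes M :: "'a::{field, finite} mat" and n :: nat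
  defines "G \<equiv> unitriangular_group n :: 'a mat monoid"
  assumes "M \<in> unitri n" "\<And>p. superdiag n (Suc 0) p M = 0" "\<And>p. superdiag n 2 p M = 0"
  shows "M \<in> commutator_subgroup G (carrier G) (derived G (carrier G))"
  using assms(2-4)
proof (induction "card {(r, s). r < s \<and> s < n \<and> M $$ (r, s) \<noteq> 0}" arbitrary: M rule: less_induct)
  case less
  interpret group G unfolding G_def by (rule group_unitriangular)
  let ?C = "commutator_subgroup G (carrier G) (derived G (carrier G))"
  have der: "derived G (carrier G) \<subseteq> carrier G" by (rule derived_in_carrier) simp
  have C: "subgroup ?C G"
    unfolding commutator_subgroup_def by (rule generate_is_subgroup) (use der in auto)
  have mult: "g \<otimes>\<^bsub>G\<^esub> h = g * h" and one: "\<one>\<^bsub>G\<^esub> = 1\<^sub>m n" for g h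
    by (simp_all add: G_def unitriangular_group_def)
  have elem_G: "i < j \<Longrightarrow> elem_mat n i j t \<in> carrier G" for i j and t :: 'a
    using elem_mat_unitri by (simp add: G_def carrier_unitriangular)
  \<comment> \<open>With indices of elementary matrices, \<open>(i, j)\<close> is the commutator of
    \<open>(i, i+1)\<close> with the commutator of \<open>(i+1, i+2)\<close> and
    \<open>(i+2, j)\<close>; this is why \<open>j\<close> must exceed \<open>i + 2\<close>.\<close>
  have elem_C: "elem_mat n i j t \<in> ?C" if ij: "Suc (Suc i) < j" "j < n" for i j and t :: 'a
  proof -
    have "elem_mat n (Suc i) j (1 * 1) \<in> derived G (carrier G)"
      unfolding derived_def
    proof (rule generate.incl)
      show "elem_mat n (Suc i) j (1 * 1) \<in> (\<Union>h\<^sub>1\<in>carrier G. \<Union>h\<^sub>2\<in>carrier G.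
          {h\<^sub>1 \<otimes>\<^bsub>G\<^esub> h\<^sub>2 \<otimes>\<^bsub>G\<^esub> inv\<^bsub>G\<^esub> h\<^sub>1 \<otimes>\<^bsub>G\<^esub> inv\<^bsub>G\<^esub> h\<^sub>2})"
        using ij elem_G[of "Suc i" "Suc (Suc i)" "1 :: 'a"] elem_G[of "Suc (Suc i)" j "1 :: 'a"]
          elem_mat_commutator[of "Suc i" "Suc (Suc i)" j n "1 :: 'a" 1, folded G_def] by force
    qed
    then show ?thesis
      unfolding commutator_subgroup_def
      using ij elem_G[of i "Suc i" t] elem_mat_commutator[of i "Suc i" j n t 1, folded G_def]
      by (intro generate.incl) force
  qed
  have Mc: "M \<in> carrier_mat n n" using less.prems(1) by (auto simp: unitri_def upper_mats_def)
  let ?N = "\<lambda>M :: 'a mat. {(r, s). r < s \<and> s < n \<and> M $$ (r, s) \<noteq> 0}"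
  have finN: "finite (?N M)"
    by (rule finite_subset[of _ "{..<n} \<times> {..<n}"]) auto
  show ?case
  proof (cases "?N M = {}")
    case True
    have "M = 1\<^sub>m n"
    proof (rule eq_matI)
      fix r s assume "r < dim_row (1\<^sub>m n :: 'a mat)" "s < dim_col (1\<^sub>m n :: 'a mat)"
      then show "M $$ (r, s) = 1\<^sub>m n $$ (r, s)"
        using True less.prems(1) by (cases r s rule: linorder_cases) (auto simp: unitri_def upper_mats_def)
    qed (use Mc in auto)
    then show ?thesis using subgroup.one_closed[OF C] one by simp
  next
    case False
    then have "\<exists>s r. (r, s) \<in> ?N M" by auto
    \<comment> \<open>The leftmost column that still has a nonzero entry above the diagonal.\<close>
    define s0 where "s0 = (LEAST s. \<exists>r. (r, s) \<in> ?N M)"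
    have "\<exists>r. (r, s0) \<in> ?N M"
      unfolding s0_def using \<open>\<exists>s r. (r, s) \<in> ?N M\<close> by (rule LeastI_ex)
    then obtain r0 where r0: "r0 < s0" "s0 < n" "M $$ (r0, s0) \<noteq> 0" by auto
    have min: "M $$ (r, s) = 0" if "r < s" "s < s0" for r s
      using not_less_Least[of s "\<lambda>s. \<exists>r. (r, s) \<in> ?N M"] that r0(2) unfolding s0_def[symmetric] by auto
    have far: "Suc (Suc r0) < s0"
    proof (rule ccontr)
      assume "\<not> Suc (Suc r0) < s0"
      then have "s0 = Suc r0 \<or> s0 = Suc (Suc r0)" using r0(1) by auto
      then show False
        using less.prems(2)[of r0] less.prems(3)[of r0] r0 by (auto simp: superdiag_def)
    qed
    define t where "t = M $$ (r0, s0)"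
    \<comment> \<open>Column \<open>r0\<close> lies to the left of \<open>s0\<close>, hence is a
      unit vector, so the column operation below changes the entry \<open>(r0, s0)\<close> and
      nothing else.\<close>
    have col: "M $$ (r, r0) = (if r = r0 then 1 else 0)" if "r < n" for r
      using that r0 min[of r r0] less.prems(1)
      by (cases r r0 rule: linorder_cases) (auto simp: unitri_def upper_mats_def)
    define M' where "M' = M * elem_mat n r0 s0 (- t)"
    have M': "M' $$ (r, s) = (if (r, s) = (r0, s0) then 0 else M $$ (r, s))" if "r < n" "s < n" for r s
      unfolding M'_def using r0 that Mc col[OF that(1)] by (auto simp: mult_elem_mat t_def)
    have M'u: "M' \<in> unitri n"
      unfolding M'_def using less.prems(1) r0 by (intro unitri_mult elem_mat_unitri)
    then have M'c: "M' \<in> carrier_mat n n" by (auto simp: unitri_def upper_mats_def)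
    have "M' $$ (r, s) = (if (r, s) = (r0, s0) then 0 else M $$ (r, s))" if "r < s" "s < n" for r s
      by (rule M') (use that in auto)
    then have N: "?N M' = ?N M - {(r0, s0)}" by (auto split: if_splits)
    have "card (?N M') < card (?N M)"
      unfolding N using r0 by (intro card_Diff1_less finN) simp
    moreover have "superdiag n (Suc 0) p M' = 0" "superdiag n 2 p M' = 0" for p
      using less.prems(2,3)[of p] by (auto simp: superdiag_def M' split: if_splits)
    ultimately have "M' \<in> ?C" by (rule less.hyps[OF _ M'u])
    moreover have "elem_mat n r0 s0 t \<in> ?C" using elem_C far r0 by blast
    ultimately have "M' \<otimes>\<^bsub>G\<^esub> elem_mat n r0 s0 t \<in> ?C" by (rule subgroup.m_closed[OF C])
    moreover have "M' * elem_mat n r0 s0 t = M"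
    proof (rule eq_matI)
      fix r s assume "r < dim_row M" "s < dim_col M"
      then have "r < n" "s < n" using Mc by auto
      then show "(M' * elem_mat n r0 s0 t) $$ (r, s) = M $$ (r, s)"
        using r0 M'c col[of r] by (auto simp: mult_elem_mat M' t_def)
    qed (use Mc M'c in \<open>auto simp: elem_mat_def\<close>)
    ultimately show ?thesis by (simp add: mult)
  qed
qed

theorem theorem4p4:
  fixes n :: nat and \<theta> :: "'a::{field, finite} \<Rightarrow> complex"
  assumes "n \<ge> 1"
    and "nontrivial_additive_character \<theta>"
  shows "bij_betw (xi_path n \<theta>) (heis_paths_tilde n)
           (heisenberg_characters (unitriangular_group n :: 'a mat monoid)) \<and>
         int (card (heisenberg_characters (unitriangular_group n :: 'a mat monoid))) =
           poly (heis_poly_tilde (int n)) (int (card (UNIV :: 'a set)) - 1)"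
proof -
  let ?G = "unitriangular_group n :: 'a mat monoid"
  interpret H: heis_group ?G \<theta> "n - 1" "superdiag n (Suc 0)" "superdiag n 2"
    by (rule heis_group_unitriangular[OF assms])
  \<comment> \<open>This turns the kernel condition on Heisenberg characters into triviality on
    \<open>U3\<close>.\<close>
  have "commutator_subgroup ?G (carrier ?G) (derived ?G (carrier ?G)) = H.U3"
    using H.commutator_subgroup_subset_U3 unitriangular_lower_central[where n = n and 'a = 'a]
    by (auto simp: H.U3_def carrier_unitriangular)
  then have heis: "heisenberg_characters ?G =
      {\<chi> \<in> irreducible_characters ?G. \<forall>u\<in>H.U3. \<chi> u = \<chi> \<one>\<^bsub>?G\<^esub>}"
    using H.U3_closed by (auto simp: heisenberg_characters_def character_kernel_def)
  have xi: "xi_path n \<theta> P = H.heis_char (path_delta P) (path_gamma P)"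
    if P: "P \<in> tilde_paths (n - 1)" for P :: "(step \<times> 'a list) list"
  proof -
    let ?\<delta> = "path_delta P" and ?\<gamma> = "path_gamma P"
    have \<gamma>: "supp_below (n - 1) ?\<gamma>" using path_data_correct[OF P] by (simp add: functional_data_def)
    have \<mu>: "path_functional P = diag_functional n ?\<delta> ?\<gamma>"
      using path_functional_eq[OF P order_refl] by (rule ext)
    have off: "superdiag n k p (1\<^sub>m n + X) = superdiag n k p X"
      if "X \<in> strictly_upper n" "k > 0" for k p and X :: "'a mat"
      using that by (auto simp: superdiag_def strictly_upper_def)
    have L: "L_bar n (path_functional P) = H.L ?\<gamma>"
    proof (intro equalityI subsetI)
      fix g assume "g \<in> L_bar n (path_functional P)"
      then obtain X where X: "g = 1\<^sub>m n + X" "X \<in> strictly_upper n"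
        "\<forall>p. odd (run_length ?\<gamma> p) \<longrightarrow> superdiag n (Suc 0) p X = 0"
        unfolding L_bar_def l_bar_eq[OF \<gamma> \<mu>] by blast
      then show "g \<in> H.L ?\<gamma>"
        using off[OF X(2), of "Suc 0"] unfolding H.L_def by (auto simp: unitriangular_group_def)
    next
      fix g assume g: "g \<in> H.L ?\<gamma>"
      then obtain X where X: "g = 1\<^sub>m n + X" "X \<in> strictly_upper n"
        unfolding H.L_def by (auto simp: unitriangular_group_def)
      then show "g \<in> L_bar n (path_functional P)"
        using g off[OF X(2), of "Suc 0"] unfolding L_bar_def l_bar_eq[OF \<gamma> \<mu>] H.L_def by auto
    qed
    have \<theta>: "theta_fun n \<theta> (path_functional P) g = \<theta> (H.lam ?\<delta> ?\<gamma> g)" if g: "g \<in> H.L ?\<gamma>" for g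
    proof -
      obtain X where X: "g = 1\<^sub>m n + X" "X \<in> strictly_upper n"
        using g unfolding H.L_def by (auto simp: unitriangular_group_def)
      have "g - 1\<^sub>m n = X" using X by (auto simp: strictly_upper_def)
      then show ?thesis
        unfolding theta_fun_def \<mu> diag_functional_def H.lam_def X(1)
        using off[OF X(2)] by simp
    qed
    \<comment> \<open>Both sides are induced from the same subgroup; the inducing functions agree on
      it, and they are evaluated nowhere else.\<close>
    show ?thesis
      unfolding xi_path_def xi_def H.heis_char_def L induced_function_def Let_def
      using \<theta> by (auto intro!: restrict_ext sum.cong arg_cong2[where f = "(/)"])
  qed
  have "bij_betw ((\<lambda>(\<delta>, \<gamma>). H.heis_char \<delta> \<gamma>) \<circ> (\<lambda>P. (path_delta P, path_gamma P)))
      (tilde_paths (n - 1)) (heisenberg_characters ?G)"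
    unfolding heis by (rule bij_betw_trans[OF bij_betw_path_data H.bij_betw_heis_char])
  then have bij: "bij_betw (xi_path n \<theta>) (heis_paths_tilde n) (heisenberg_characters ?G)"
    unfolding heis_paths_tilde_eq by (rule iffD1[OF bij_betw_cong, rotated]) (simp add: xi)
  then show ?thesis
    using bij_betw_same_card[OF bij] card_heis_paths_tilde[OF assms(1), where 'a = 'a] by simp
qed

end
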